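(* Let $d\ge 3$ and let $G$ be a finite simple graph with no isolated vertices such that its matching complex $M(G)$ is a $d$-dimensional homology manifold without boundary. Then $G$ is a disjoint union of copies of $P_3$, $C_5$, and $K_{3,2}$, and therefore $M(G)$ is a combinatorial $d$-sphere.
   Context: A matching of a graph $G$ is a set of edges of $G$ no two of which share a vertex. The matching complex $M(G)$ is the simplicial complex whose vertices are the edges of $G$ and whose faces are the matchings of $G$ (including the empty matching). $P_n$ is the path with $n$ vertices, $C_n$ the cycle with $n$ vertices, $K_{m,n}$ the complete bipartite graph. For a face $\sigma$ of a simplicial complex $\Delta$, $\mathrm{link}_\Delta\sigma=\{\tau\in\Delta:\tau\cup\sigma\in\Delta,\ \tau\cap\sigma=\varnothing\}$. Fix a field $\Bbbk$; homology is taken over $\Bbbk$. A homology manifold (without boundary) is a (finite) $d$-dimensional simplicial complex $\Delta$ such that $\mathrm{link}_\Delta\sigma$ has the homology of a $(d-|\sigma|)$-sphere for all nonempty faces $\sigma\in\Delta$ (where the $(-1)$-sphere is the complex $\{\varnothing\}$). A combinatorial $d$-sphere is a simplicial complex PL-homeomorphic to the boundary of a $(d+1)$-simplex. *)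

theory Defs
  imports "HOL-Analysis.Analysis" "HOL-Library.Function_Algebras"
begin

section \<open>Finite simple graphs\<close>

text \<open>A graph is a pair of a vertex set and an edge set, an edge being a two-element set of
  vertices.\<close>

type_synonym 'a graph = "'a set \<times> 'a set set"

abbreviation graph_verts :: "'a graph \<Rightarrow> 'a set"
  where "graph_verts G \<equiv> fst G"

abbreviation graph_edges :: "'a graph \<Rightarrow> 'a set set"
  where "graph_edges G \<equiv> snd G"

definition finite_simple_graph :: "'a graph \<Rightarrow> bool"
  where "finite_simple_graph G \<longleftrightarrow>
    finite (graph_verts G) \<and> (\<forall>e\<in>graph_edges G. e \<subseteq> graph_verts G \<and> card e = 2)"

definition no_isolated_vertices :: "'a graph \<Rightarrow> bool"
  where "no_isolated_vertices G \<longleftrightarrow> (\<forall>v\<in>graph_verts G. \<exists>e\<in>graph_edges G. v \<in> e)"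

definition graph_isomorphic :: "'a graph \<Rightarrow> 'b graph \<Rightarrow> bool"
  where "graph_isomorphic G H \<longleftrightarrow>
    (\<exists>f. bij_betw f (graph_verts G) (graph_verts H) \<and> (\<lambda>e. f ` e) ` graph_edges G = graph_edges H)"

definition path_graph :: "nat \<Rightarrow> nat graph"
  where "path_graph n = ({..<n}, {{i, Suc i} | i. Suc i < n})"

definition cycle_graph :: "nat \<Rightarrow> nat graph"
  where "cycle_graph n = ({..<n}, {{i, Suc i mod n} | i. i < n})"

definition complete_bipartite_graph :: "nat \<Rightarrow> nat \<Rightarrow> (nat + nat) graph"
  where "complete_bipartite_graph m n =
    ({..<m} <+> {..<n}, {{Inl i, Inr j} | i j. i < m \<and> j < n})"

definition disjoint_union_of_graphs :: "'a graph \<Rightarrow> 'a graph set \<Rightarrow> bool"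
  where "disjoint_union_of_graphs G \<H> \<longleftrightarrow>
    pairwise (\<lambda>H H'. disjnt (graph_verts H) (graph_verts H')) \<H> \<and>
    graph_verts G = (\<Union>H\<in>\<H>. graph_verts H) \<and> graph_edges G = (\<Union>H\<in>\<H>. graph_edges H)"


section \<open>Abstract simplicial complexes and matching complexes\<close>

text \<open>The name avoids the library's \<open>simplicial_complex\<close>, which is the geometric notion.\<close>

definition abstract_complex :: "'v set set \<Rightarrow> bool"
  where "abstract_complex \<Delta> \<longleftrightarrow>
    finite \<Delta> \<and> (\<forall>\<sigma>\<in>\<Delta>. finite \<sigma>) \<and> {} \<in> \<Delta> \<and> (\<forall>\<sigma>\<in>\<Delta>. \<forall>\<tau>. \<tau> \<subseteq> \<sigma> \<longrightarrow> \<tau> \<in> \<Delta>)"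

definition complex_dim :: "'v set set \<Rightarrow> int"
  where "complex_dim \<Delta> = int (Max (card ` \<Delta>)) - 1"

definition face_link :: "'v set set \<Rightarrow> 'v set \<Rightarrow> 'v set set"
  where "face_link \<Delta> \<sigma> = {\<tau> \<in> \<Delta>. \<tau> \<union> \<sigma> \<in> \<Delta> \<and> \<tau> \<inter> \<sigma> = {}}"

definition is_matching :: "'a graph \<Rightarrow> 'a set set \<Rightarrow> bool"
  where "is_matching G M \<longleftrightarrow> M \<subseteq> graph_edges G \<and> pairwise disjnt M"

definition matching_complex :: "'a graph \<Rightarrow> 'a set set set"
  where "matching_complex G = {M. is_matching G M}"

lemma abstract_complex_matching_complex:
  assumes "finite_simple_graph G"
  shows "abstract_complex (matching_complex G)"
proof -
  have E: "finite (graph_edges G)"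
    using assms by (auto simp: finite_simple_graph_def intro: finite_subset[of _ "Pow (graph_verts G)"])
  have "matching_complex G \<subseteq> Pow (graph_edges G)"
    by (auto simp: matching_complex_def is_matching_def)
  then have "finite (matching_complex G)" "\<forall>\<sigma>\<in>matching_complex G. finite \<sigma>"
    using E by (auto intro: finite_subset)
  then show ?thesis
    by (auto simp: abstract_complex_def matching_complex_def is_matching_def intro: pairwise_subset)
qed


section \<open>Reduced simplicial homology over a field\<close>

text \<open>An oriented simplex is a face together with an ordering of its vertices, up to even
  permutations.  An oriented \<open>p\<close>-chain is a function on ordered faces (distinct lists of length
  \<open>p + 1\<close>) that changes sign whenever two adjacent vertices are interchanged.  No order on the
  vertices has to be chosen.  The empty face is the only face of dimension \<open>-1\<close>, so the homology
  is the reduced one.\<close>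

definition oriented_chains :: "'v set set \<Rightarrow> int \<Rightarrow> ('v list \<Rightarrow> 'k::field) set"
  where "oriented_chains \<Delta> p = {c.
    (\<forall>xs. c xs \<noteq> 0 \<longrightarrow> distinct xs \<and> set xs \<in> \<Delta> \<and> int (length xs) = p + 1) \<and>
    (\<forall>xs u v ys. c (xs @ u # v # ys) = - c (xs @ v # u # ys))}"

text \<open>The boundary of the oriented simplex \<open>[v\<^sub>0, \<dots>, v\<^sub>p]\<close> is the alternating sum of its facets.
  The facet \<open>xs\<close> occurs with sign \<open>+\<close> in the boundary of \<open>v # xs\<close>, so the coefficient of \<open>xs\<close> in
  the boundary of a chain \<open>c\<close> is the sum of all \<open>c (v # xs)\<close>; terms that do not come from a face
  vanish.\<close>

definition oriented_boundary :: "'v set set \<Rightarrow> ('v list \<Rightarrow> 'k::field) \<Rightarrow> 'v list \<Rightarrow> 'k"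
  where "oriented_boundary \<Delta> c = (\<lambda>xs. \<Sum>v\<in>\<Union>\<Delta>. c (v # xs))"

definition reduced_cycles :: "'v set set \<Rightarrow> int \<Rightarrow> ('v list \<Rightarrow> 'k::field) set"
  where "reduced_cycles \<Delta> p = {c \<in> oriented_chains \<Delta> p. oriented_boundary \<Delta> c = (\<lambda>_. 0)}"

definition reduced_boundaries :: "'v set set \<Rightarrow> int \<Rightarrow> ('v list \<Rightarrow> 'k::field) set"
  where "reduced_boundaries \<Delta> p = oriented_boundary \<Delta> ` oriented_chains \<Delta> (p + 1)"

definition chain_scale :: "'k::field \<Rightarrow> ('v list \<Rightarrow> 'k) \<Rightarrow> 'v list \<Rightarrow> 'k"
  where "chain_scale a c = (\<lambda>xs. a * c xs)"

lemma vector_space_chain_scale: "vector_space chain_scale"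
  by unfold_locales (auto simp: chain_scale_def fun_eq_iff algebra_simps)

text \<open>The dimension of the quotient of cycles by boundaries.  For a finite complex all spaces are
  finite-dimensional and the boundaries form a subspace of the cycles
  (see \<open>reduced_boundaries_subset_cycles\<close> below), so the subtraction does not truncate.\<close>

definition reduced_betti :: "'k::field itself \<Rightarrow> 'v set set \<Rightarrow> int \<Rightarrow> nat"
  where "reduced_betti _ \<Delta> p =
    vector_space.dim chain_scale (reduced_cycles \<Delta> p :: ('v list \<Rightarrow> 'k) set) -
    vector_space.dim chain_scale (reduced_boundaries \<Delta> p :: ('v list \<Rightarrow> 'k) set)"

definition has_sphere_homology :: "'k::field itself \<Rightarrow> 'v set set \<Rightarrow> int \<Rightarrow> bool"
  where "has_sphere_homology k \<Delta> m \<longleftrightarrow> (\<forall>p. reduced_betti k \<Delta> p = (if p = m then 1 else 0))"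

definition homology_manifold :: "'k::field itself \<Rightarrow> nat \<Rightarrow> 'v set set \<Rightarrow> bool"
  where "homology_manifold k d \<Delta> \<longleftrightarrow>
    abstract_complex \<Delta> \<and> complex_dim \<Delta> = int d \<and>
    (\<forall>\<sigma>\<in>\<Delta>. \<sigma> \<noteq> {} \<longrightarrow> has_sphere_homology k (face_link \<Delta> \<sigma>) (int d - int (card \<sigma>)))"

lemma oriented_boundary_in_chains:
  fixes c :: "'v list \<Rightarrow> 'k::field"
  assumes \<Delta>: "abstract_complex \<Delta>" and c: "c \<in> oriented_chains \<Delta> (p + 1)"
  shows "oriented_boundary \<Delta> c \<in> oriented_chains \<Delta> p"
proof -
  have "distinct xs \<and> set xs \<in> \<Delta> \<and> int (length xs) = p + 1"
    if nonzero: "oriented_boundary \<Delta> c xs \<noteq> 0" for xs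
  proof -
    obtain v where "c (v # xs) \<noteq> 0"
      using nonzero unfolding oriented_boundary_def by (rule sum.not_neutral_contains_not_neutral)
    then have "distinct (v # xs) \<and> set (v # xs) \<in> \<Delta> \<and> int (length (v # xs)) = p + 1 + 1"
      using c unfolding oriented_chains_def by blast
    then show ?thesis
      using \<Delta> unfolding abstract_complex_def by auto
  qed
  moreover have "oriented_boundary \<Delta> c (xs @ u # v # ys) = - oriented_boundary \<Delta> c (xs @ v # u # ys)"
    for xs u v ys
  proof -
    have "c ((w # xs) @ u # v # ys) = - c ((w # xs) @ v # u # ys)" for w
      using c unfolding oriented_chains_def by blast
    then show ?thesis
      unfolding oriented_boundary_def
      by (subst sum_negf[symmetric], intro sum.cong refl) (metis append_Cons)
  qed
  ultimately show ?thesis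
    unfolding oriented_chains_def by blast
qed

lemma alternating_double_sum:
  fixes f :: "'v \<Rightarrow> 'v \<Rightarrow> 'k::field"
  assumes "finite A" "\<And>u. f u u = 0" "\<And>u v. f u v = - f v u"
  shows "(\<Sum>u\<in>A. \<Sum>v\<in>A. f u v) = 0"
  using assms(1)
proof (induction A rule: finite_induct)
  case (insert a A)
  have "(\<Sum>u\<in>A. f u a) = - (\<Sum>v\<in>A. f a v)"
    by (subst sum_negf[symmetric], rule sum.cong[OF refl], rule assms(3))
  then show ?case
    using insert assms(2) by (simp add: sum.distrib)
qed simp

lemma reduced_boundaries_subset_cycles:
  assumes \<Delta>: "abstract_complex \<Delta>"
  shows "(reduced_boundaries \<Delta> p :: ('v list \<Rightarrow> 'k::field) set) \<subseteq> reduced_cycles \<Delta> p"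
proof -
  have "oriented_boundary \<Delta> (oriented_boundary \<Delta> c) xs = 0"
    if c: "c \<in> oriented_chains \<Delta> (p + 1)" for c :: "'v list \<Rightarrow> 'k" and xs
  proof -
    have swap: "c (v # u # xs) = - c (u # v # xs)" for u v
    proof -
      have "c ([] @ v # u # xs) = - c ([] @ u # v # xs)"
        using c unfolding oriented_chains_def by blast
      then show ?thesis by simp
    qed
    have diag: "c (u # u # xs) = 0" for u
    proof (rule ccontr)
      assume "c (u # u # xs) \<noteq> 0"
      then have "distinct (u # u # xs)"
        using c unfolding oriented_chains_def by blast
      then show False by simp
    qed
    have fin: "finite (\<Union>\<Delta>)"
      using \<Delta> unfolding abstract_complex_def by auto
    show ?thesis
      unfolding oriented_boundary_def by (rule alternating_double_sum[OF fin diag swap])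
  qed
  then show ?thesis
    using oriented_boundary_in_chains[OF \<Delta>]
    unfolding reduced_boundaries_def reduced_cycles_def by (intro subsetI) (auto intro!: ext)
qed


section \<open>Piecewise linear homeomorphisms and combinatorial spheres\<close>

text \<open>\<open>f\<close> is affine on every simplex of some triangulation of the polyhedron \<open>S\<close>.  Such a map is
  automatically continuous on \<open>S\<close>.\<close>

definition piecewise_linear_on ::
  "'a::euclidean_space set \<Rightarrow> ('a \<Rightarrow> 'b::euclidean_space) \<Rightarrow> bool"
  where "piecewise_linear_on S f \<longleftrightarrow>
    (\<exists>\<T>. simplicial_complex \<T> \<and> \<Union>\<T> = S \<and>
      (\<forall>T\<in>\<T>. \<exists>A b. linear A \<and> (\<forall>x\<in>T. f x = A x + b)))"

text \<open>The inverse of a homeomorphism that is piecewise linear is piecewise linear as well: it is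
  affine on the images of the simplices.\<close>

definition pl_homeomorphic ::
  "'a::euclidean_space set \<Rightarrow> 'b::euclidean_space set \<Rightarrow> bool"
  where "pl_homeomorphic S T \<longleftrightarrow>
    (\<exists>f g. homeomorphism S T f g \<and> piecewise_linear_on S f)"

definition geometric_realization :: "'v::finite set set \<Rightarrow> (real ^ 'v) set"
  where "geometric_realization \<Delta> = (\<Union>\<sigma>\<in>\<Delta>. convex hull ((\<lambda>v. axis v 1) ` \<sigma>))"

text \<open>The relative frontier of a \<open>(d + 1)\<close>-simplex is the union of its proper faces.  Taking the
  model simplex in the space of the realization is no restriction: a complex that is
  PL-homeomorphic to the boundary of a \<open>(d + 1)\<close>-simplex has dimension \<open>d\<close>, hence at least \<open>d + 1\<close>
  vertices, so \<open>real ^ 'v\<close> has dimension at least \<open>d + 1\<close>; and any two \<open>(d + 1)\<close>-simplices are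
  affinely isomorphic.\<close>

definition combinatorial_sphere :: "nat \<Rightarrow> 'v::finite set set \<Rightarrow> bool"
  where "combinatorial_sphere d \<Delta> \<longleftrightarrow>
    abstract_complex \<Delta> \<and>
    (\<exists>T :: (real ^ 'v) set. (int d + 1) simplex T \<and>
      pl_homeomorphic (geometric_realization \<Delta>) (rel_frontier T))"

end

theory Submission
  imports Defs
begin

text \<open>
  Write \<open>M(E)\<close> for the complex of matchings of an edge set \<open>E\<close>.  The link of a matching \<open>\<sigma>\<close> in
  \<open>M(E)\<close> is \<open>M(E')\<close>, where \<open>E'\<close> consists of the edges that meet no edge of \<open>\<sigma>\<close>.  So the manifold
  condition is a condition on all these smaller edge sets, and the graph can be reconstructed by
  induction on the dimension.  Working with edge sets makes isolated vertices disappear.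

  Homology enters in four places only.  A link with the homology of the \<open>-1\<close>-sphere has no
  vertices; a link with the homology of a sphere of nonnegative dimension has some; a discrete link
  with the homology of the \<open>0\<close>-sphere has exactly two points, that is, its edge set is a \<open>P\<^sub>3\<close>; and
  the complex \<open>M(K\<^sub>4\<^sub>,\<^sub>3)\<close>, a torus with 24 triangles, does not have the homology of the
  \<open>2\<close>-sphere (\<open>torus_betti\<close>).  The first three say that deleting the ends of any \<open>d\<close> disjoint
  edges leaves a \<open>P\<^sub>3\<close>, the last one says that deleting the ends of \<open>d - 2\<close> disjoint edges never
  leaves a \<open>K\<^sub>4\<^sub>,\<^sub>3\<close>.  The predicate \<open>locally_spherical\<close> records exactly this, and
  \<open>homology_manifold_locally_spherical\<close> derives it.  This is where \<open>d \<ge> 3\<close> is used: the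
  \<open>2\<close>-dimensional links are then links of nonempty faces, whose homology is given.

  The rest of the classification is combinatorial (\<open>locally_spherical_imp_standard_union\<close>).
  Fix an edge \<open>e = uv\<close>, let \<open>F\<close> be the set of edges disjoint from \<open>e\<close>, which is known by induction, and ask which other edges
  meet \<open>e\<close>.  In dimension 1, \<open>F\<close> is a \<open>P\<^sub>3\<close>, and \<open>e\<close> is either part of another \<open>P\<^sub>3\<close> or attached to
  \<open>F\<close> in one of two ways, which give \<open>C\<^sub>5\<close> and \<open>K\<^sub>3\<^sub>,\<^sub>2\<close> (\<open>circle_around\<close>).  In dimension 2 this
  description applies to the set of edges disjoint from any edge \<open>f\<close> of \<open>F\<close>.  The descriptions
  for different \<open>f\<close> overlap so much that they fit together only if \<open>e\<close> is not attached to \<open>F\<close>, or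
  is attached to one of two copies of \<open>P\<^sub>3\<close>, or \<open>F\<close> is \<open>K\<^sub>3\<^sub>,\<^sub>2\<close> and the whole is the excluded
  \<open>K\<^sub>4\<^sub>,\<^sub>3\<close>.  In higher dimensions some component of \<open>F\<close> is not attached to \<open>e\<close>: otherwise, after
  deleting the ends of a suitable edge, \<open>e\<close> and two further disjoint edges would lie in one
  component, but \<open>P\<^sub>3\<close>, \<open>C\<^sub>5\<close> and \<open>K\<^sub>3\<^sub>,\<^sub>2\<close> have no three disjoint edges.  Such a component splits
  off, and induction applies to what remains.

  The matching complex of a disjoint union is the join of the matching complexes of its parts,
  which here are two points, a pentagon and a hexagon.  Up to stellar subdivisions of edges,
  pentagon and hexagon are joins of two copies of two points, and joining with two points is a
  suspension, which for the boundary of a simplex is a stellar subdivision of the boundary of the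
  next larger simplex.  So \<open>M(G)\<close> arises from the boundary of a simplex by stellar subdivisions
  (\<open>standard_union_imp_stellar_sphere\<close>).  Each stellar subdivision is undone by a linear map of
  the ambient space, which moves the new vertex to the barycentre of the subdivided face
  (\<open>stellar_linearly_equivalent\<close>).  The composite of these maps is linear, in particular affine on
  every face, and gives the required piecewise linear homeomorphism.
\<close>

section \<open>Edge sets and the links of matchings\<close>

text \<open>For a matching \<open>\<sigma>\<close> with union \<open>X\<close>, this is the edge set whose matching complex is the link
  of \<open>\<sigma>\<close>.\<close>
definition avoid :: "'a set set \<Rightarrow> 'a set \<Rightarrow> 'a set set"
  where "avoid E X = {f \<in> E. f \<inter> X = {}}"

definition two_uniform :: "'a set set \<Rightarrow> bool"
  where "two_uniform E \<longleftrightarrow> (\<forall>f\<in>E. card f = 2)"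

definition is_P3 :: "'a set set \<Rightarrow> bool"
  where "is_P3 H \<longleftrightarrow> (\<exists>x y z. distinct [x, y, z] \<and> H = {{x, y}, {x, z}})"

definition is_C5 :: "'a set set \<Rightarrow> bool"
  where "is_C5 H \<longleftrightarrow> (\<exists>a b c d e. distinct [a, b, c, d, e] \<and>
    H = {{a, b}, {b, c}, {c, d}, {d, e}, {e, a}})"

definition is_K32 :: "'a set set \<Rightarrow> bool"
  where "is_K32 H \<longleftrightarrow> (\<exists>a b c p q. distinct [a, b, c, p, q] \<and>
    H = {{a, p}, {b, p}, {c, p}, {a, q}, {b, q}, {c, q}})"

definition is_K43 :: "'a set set \<Rightarrow> bool"
  where "is_K43 H \<longleftrightarrow> (\<exists>a b c d p q r. distinct [a, b, c, d, p, q, r] \<and>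
    H = {{a, p}, {b, p}, {c, p}, {d, p}, {a, q}, {b, q}, {c, q}, {d, q},
         {a, r}, {b, r}, {c, r}, {d, r}})"

lemma avoid_avoid: "avoid (avoid E X) Y = avoid E (X \<union> Y)"
  by (auto simp: avoid_def)

lemma avoid_insert:
  "avoid (insert f E) X = (if f \<inter> X = {} then insert f (avoid E X) else avoid E X)"
  by (auto simp: avoid_def)

lemma avoid_empty [simp]: "avoid {} X = {}"
  by (auto simp: avoid_def)

lemma avoid_mono: "E \<subseteq> F \<Longrightarrow> avoid E X \<subseteq> avoid F X"
  by (auto simp: avoid_def)

lemma two_uniform_avoid: "two_uniform E \<Longrightarrow> two_uniform (avoid E X)"
  by (auto simp: two_uniform_def avoid_def)

lemma is_P3_card: "is_P3 H \<Longrightarrow> card H = 2"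
  by (auto simp: is_P3_def doubleton_eq_iff card_insert_if)

lemma is_P3_subset:
  assumes "is_P3 H" "H \<subseteq> {f, g}"
  shows "f \<in> H \<and> g \<in> H \<and> f \<noteq> g"
proof -
  obtain k l where "H = {k, l}" "k \<noteq> l"
    using assms(1) is_P3_card card_2_iff by metis
  then show ?thesis using assms(2) by auto
qed

lemma is_P3_superset:
  assumes "is_P3 H" "{f, g, h} \<subseteq> H" "f \<noteq> g"
  shows "h = f \<or> h = g"
proof -
  obtain k l where "H = {k, l}" "k \<noteq> l"
    using assms(1) is_P3_card card_2_iff by metis
  then show ?thesis using assms(2,3) by auto
qed

lemma is_P3_Ex1:
  assumes "is_P3 H" "{u, v} \<in> H"
  shows "\<exists>s w. s \<in> {u, v} \<and> w \<notin> {u, v} \<and> H = {{u, v}, {s, w}}"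
proof -
  obtain x y z where d: "distinct [x, y, z]" and H: "H = {{x, y}, {x, z}}"
    using assms(1) unfolding is_P3_def by metis
  then consider "{u, v} = {x, y}" | "{u, v} = {x, z}"
    using assms(2) by auto
  then show ?thesis
  proof cases
    case 1
    then have "x \<in> {u, v}" "z \<notin> {u, v}" "H = {{u, v}, {x, z}}" using d H by auto
    then show ?thesis by metis
  next
    case 2
    then have "x \<in> {u, v}" "y \<notin> {u, v}" "H = {{u, v}, {x, y}}" using d H by auto
    then show ?thesis by metis
  qed
qed

text \<open>The ways to complete an edge \<open>uv\<close> and a path \<open>y x z\<close> disjoint from it by edges between them to a
  \<open>C\<^sub>5\<close> (first line) or a \<open>K\<^sub>3\<^sub>,\<^sub>2\<close> (second line).\<close>
definition attached :: "'a \<Rightarrow> 'a \<Rightarrow> 'a \<Rightarrow> 'a \<Rightarrow> 'a \<Rightarrow> 'a set set \<Rightarrow> bool"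
  where "attached u v x y z A \<longleftrightarrow>
    A = {{u, y}, {v, z}} \<or> A = {{v, y}, {u, z}} \<or>
    A = {{u, y}, {u, z}, {v, x}} \<or> A = {{v, y}, {v, z}, {u, x}}"

definition around :: "'a set set \<Rightarrow> 'a set \<Rightarrow> 'a set set"
  where "around E e = {f \<in> E. f \<inter> e \<noteq> {} \<and> f \<noteq> e}"

lemma around_cases:
  assumes "two_uniform E" "f \<in> around E {u, v}"
  obtains s w where "s \<in> {u, v}" "w \<notin> {u, v}" "f = {s, w}"
proof -
  have f: "f \<inter> {u, v} \<noteq> {}" "f \<noteq> {u, v}" "f \<in> E"
    using assms(2) by (auto simp: around_def)
  then obtain s where s: "s \<in> f" "s \<in> {u, v}" by blast
  obtain w where w: "f = {s, w}" "w \<noteq> s"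
  proof -
    have "card f = 2" using f(3) assms(1) by (simp add: two_uniform_def)
    then obtain a b where "f = {a, b}" "a \<noteq> b" by (auto simp: card_2_iff)
    then show thesis using that[of a] that[of b] s(1) by auto
  qed
  then have "w \<notin> {u, v}" using s f(2) by auto
  then show thesis using that s w by blast
qed

lemma around_avoid:
  "e \<inter> X = {} \<Longrightarrow> around (avoid E X) e = avoid (around E e) X"
  by (auto simp: around_def avoid_def)

lemma split_around: "e \<in> E \<Longrightarrow> e \<noteq> {} \<Longrightarrow> E = insert e (avoid E e \<union> around E e)"
  by (auto simp: around_def avoid_def)

section \<open>Edge sets whose matching complex is a closed curve\<close>

lemma eq_singletonI: "a \<in> A \<Longrightarrow> (\<And>f. f \<in> A \<Longrightarrow> f = a) \<Longrightarrow> A = {a}"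
  and eq_doubletonI: "a \<in> A \<Longrightarrow> b \<in> A \<Longrightarrow> (\<And>f. f \<in> A \<Longrightarrow> f = a \<or> f = b) \<Longrightarrow> A = {a, b}"
  and eq_tripletonI: "a \<in> A \<Longrightarrow> b \<in> A \<Longrightarrow> c \<in> A \<Longrightarrow>
    (\<And>f. f \<in> A \<Longrightarrow> f = a \<or> f = b \<or> f = c) \<Longrightarrow> A = {a, b, c}"
  by blast+

text \<open>Deleting the ends of \<open>xy\<close> leaves a \<open>P\<^sub>3\<close> that contains \<open>uv\<close>, so \<open>uv\<close> has exactly one neighbouring
  edge that avoids \<open>x\<close> and \<open>y\<close>; likewise for \<open>x\<close> and \<open>z\<close>.  If the first of these two edges
  does not end in \<open>z\<close>, it also avoids \<open>x\<close> and \<open>z\<close>, so the two coincide.  Otherwise they end in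
  \<open>z\<close> and \<open>y\<close>.  The links of the edges found so far decide which of \<open>u\<close> and \<open>v\<close> is joined to
  \<open>x\<close>.\<close>
lemma circle_around:
  assumes uni: "two_uniform E" and links: "\<forall>e\<in>E. is_P3 (avoid E e)"
    and e: "{u, v} \<in> E" and xyz: "distinct [x, y, z]"
    and av: "avoid E {u, v} = {{x, y}, {x, z}}"
  shows "attached u v x y z (around E {u, v}) \<or>
    (\<exists>s w. s \<in> {u, v} \<and> w \<notin> {u, v, x, y, z} \<and> around E {u, v} = {{s, w}})"
proof -
  let ?A = "around E {u, v}"
  note E = uni bspec[OF links]
  have uv: "u \<noteq> v" using E(1) e by (force simp: two_uniform_def)
  have xy: "{x, y} \<in> E" and xz: "{x, z} \<in> E"
    and d: "x \<notin> {u, v}" "y \<notin> {u, v}" "z \<notin> {u, v}"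
  proof -
    have "{x, y} \<in> avoid E {u, v}" "{x, z} \<in> avoid E {u, v}" using av by auto
    then show "{x, y} \<in> E" "{x, z} \<in> E" "x \<notin> {u, v}" "y \<notin> {u, v}" "z \<notin> {u, v}"
      by (auto simp: avoid_def)
  qed
  have Ein: "f \<in> E \<longleftrightarrow> f = {u, v} \<or> f = {x, y} \<or> f = {x, z} \<or> f \<in> ?A" for f
    using split_around[OF e] av by auto
  have A: "\<exists>s w. s \<in> {u, v} \<and> w \<notin> {u, v} \<and> f = {s, w}" if "f \<in> ?A" for f
    using around_cases[OF E(1) that] by metis
  obtain s w where sw: "s \<in> {u, v}" "w \<notin> {u, v}" and 1: "avoid E {x, y} = {{u, v}, {s, w}}"
    using is_P3_Ex1[OF E(2)[OF xy], of u v] e d by (auto simp: avoid_def)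
  obtain s' w' where sw': "s' \<in> {u, v}" "w' \<notin> {u, v}" and 2: "avoid E {x, z} = {{u, v}, {s', w'}}"
    using is_P3_Ex1[OF E(2)[OF xz], of u v] e d by (auto simp: avoid_def)
  have swE: "{s, w} \<in> ?A" "w \<noteq> x" "w \<noteq> y"
  proof -
    have "{s, w} \<in> avoid E {x, y}" using 1 by blast
    then show "{s, w} \<in> ?A" "w \<noteq> x" "w \<noteq> y" using sw by (auto simp: avoid_def around_def)
  qed
  have swE': "{s', w'} \<in> ?A" "w' \<noteq> x" "w' \<noteq> z"
  proof -
    have "{s', w'} \<in> avoid E {x, z}" using 2 by blast
    then show "{s', w'} \<in> ?A" "w' \<noteq> x" "w' \<noteq> z" using sw' by (auto simp: avoid_def around_def)
  qed
  have ends1: "s1 = s \<and> w1 = w" if "{s1, w1} \<in> ?A" "s1 \<in> {u, v}" "w1 \<notin> {u, v}" "w1 \<noteq> x" "w1 \<noteq> y" for s1 w1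
  proof -
    have "{s1, w1} \<in> avoid E {x, y}" using that d by (auto simp: avoid_def around_def)
    then show ?thesis using that sw unfolding 1 by (auto simp: doubleton_eq_iff)
  qed
  have ends2: "s1 = s' \<and> w1 = w'" if "{s1, w1} \<in> ?A" "s1 \<in> {u, v}" "w1 \<notin> {u, v}" "w1 \<noteq> x" "w1 \<noteq> z" for s1 w1
  proof -
    have "{s1, w1} \<in> avoid E {x, z}" using that d by (auto simp: avoid_def around_def)
    then show ?thesis using that sw' unfolding 2 by (auto simp: doubleton_eq_iff)
  qed
  have Asub: "f = {s, w} \<or> f = {s', w'} \<or> f = {u, x} \<or> f = {v, x}" if f: "f \<in> ?A" for f
  proof -
    obtain s1 w1 where f1: "f = {s1, w1}" and s1: "s1 \<in> {u, v}" "w1 \<notin> {u, v}"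
      using A[OF f] by blast
    have "y \<noteq> z" using xyz by simp
    then consider "w1 = x" | "w1 \<noteq> x" "w1 \<noteq> y" | "w1 \<noteq> x" "w1 \<noteq> z" by blast
    then show ?thesis
    proof cases
      case 1
      then show ?thesis using f1 s1 by auto
    next
      case 2
      then show ?thesis using ends1[of s1 w1] f f1 s1 by simp
    next
      case 3
      then show ?thesis using ends2[of s1 w1] f f1 s1 by simp
    qed
  qed
  have AE: "f \<in> E" if "f \<in> ?A" for f using that by (simp add: around_def)
  have Esub: "E \<subseteq> {{u, v}, {x, y}, {x, z}, {s, w}, {s', w'}, {u, x}, {v, x}}"
  proof
    fix f assume "f \<in> E"
    then have "f = {u, v} \<or> f = {x, y} \<or> f = {x, z} \<or> f \<in> ?A" by (simp only: Ein)
    then show "f \<in> {{u, v}, {x, y}, {x, z}, {s, w}, {s', w'}, {u, x}, {v, x}}"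
      using Asub[of f] unfolding insert_iff by argo
  qed
  note sub = avoid_mono[OF Esub]
  show ?thesis
  proof (cases "w = z")
    case False
    then have eq: "s' = s" "w' = w" using ends2[OF swE(1)] sw swE by auto
    have no: "{t, x} \<notin> ?A" if t: "t = u \<or> t = v" for t
    proof
      assume *: "{t, x} \<in> ?A"
      have "is_P3 (avoid E {t, x})" by (rule E(2)[OF AE[OF *]])
      moreover have "avoid E {t, x} \<subseteq> {{s, w}}"
        using subset_trans[OF sub[of "{t, x}"]] t eq by (elim disjE) (simp_all add: avoid_insert)
      ultimately show False using is_P3_subset by (metis insert_absorb2)
    qed
    have "f = {s, w}" if "f \<in> ?A" for f
      using Asub[OF that] no[of u] no[of v] eq that by metis
    then have "?A = {{s, w}}" by (rule eq_singletonI[OF swE(1)])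
    moreover have "w \<noteq> z" "w \<noteq> x" "w \<noteq> y" using False swE by auto
    ultimately show ?thesis using sw by (intro disjI2 exI[of _ s] exI[of _ w]) simp
  next
    case wz: True
    have w'y: "w' = y" using ends1[OF swE'(1)] sw' swE' wz by auto
    show ?thesis
    proof (cases "s = s'")
      case True
      obtain t where t: "t = u \<or> t = v" "t \<noteq> s" "s = u \<or> s = v" "{s, t} = {u, v}" using sw uv by auto
      have sx: "{s, x} \<notin> ?A"
      proof
        assume *: "{s, x} \<in> ?A"
        have "is_P3 (avoid E {s, x})" by (rule E(2)[OF AE[OF *]])
        moreover have "avoid E {s, x} \<subseteq> {{s, w}}"
          using subset_trans[OF sub[of "{s, x}"]] t(3) True by (elim disjE) (simp_all add: avoid_insert)
        ultimately show False using is_P3_subset by (metis insert_absorb2)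
      qed
      \<comment> \<open>The link of \<open>sy\<close> needs a second edge besides \<open>xz\<close>.\<close>
      have "is_P3 (avoid E {s, y})" using E(2)[OF AE[OF swE'(1)]] True w'y by simp
      moreover have "avoid E {s, y} \<subseteq> {{x, z}, {t, x}}"
      proof -
        have "E \<subseteq> {{u, v}, {x, y}, {x, z}, {s, w}, {s', w'}, {t, x}, {s, x}}"
          using t(1-3) by (intro subset_trans[OF Esub]) (elim disjE; simp)
        then have "avoid E {s, y} \<subseteq> avoid {{u, v}, {x, y}, {x, z}, {s, w}, {s', w'}, {t, x}, {s, x}} {s, y}"
          by (rule avoid_mono)
        also have "\<dots> \<subseteq> {{x, z}, {t, x}}"
          using True w'y unfolding t(4)[symmetric] by (simp add: avoid_insert)
        finally show ?thesis .
      qed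
      ultimately have "{t, x} \<in> avoid E {s, y}"
        using is_P3_subset[of "avoid E {s, y}" "{x, z}" "{t, x}"] by simp
      then have tx: "{t, x} \<in> ?A" using t(1) d by (auto simp: avoid_def around_def)
      have "f = {s, y} \<or> f = {s, z} \<or> f = {t, x}" if f: "f \<in> ?A" for f
      proof -
        have "u = s \<or> u = t" "v = s \<or> v = t" using t(1-3) by auto
        moreover have "f \<noteq> {s, x}" using f sx by blast
        ultimately show ?thesis using Asub[OF f] True wz w'y by (elim disjE) simp_all
      qed
      then have "?A = {{s, y}, {s, z}, {t, x}}"
        using tx swE(1) swE'(1) wz w'y True by (intro eq_tripletonI) simp_all
      then show ?thesis using t(1-3) unfolding attached_def by (elim disjE) simp_all
    next
      case False
      \<comment> \<open>An edge from \<open>x\<close> to \<open>u\<close> or \<open>v\<close> would be a third edge in one of the links of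
        \<open>sz\<close> and \<open>s'y\<close>.\<close>
      have no1: "{s', x} \<notin> ?A"
      proof
        assume *: "{s', x} \<in> ?A"
        have "{{x, y}, {s', x}, {s', y}} \<subseteq> avoid E {s, z}"
        proof -
          have "{s', x} \<in> E" "{s', y} \<in> E" using AE[OF *] AE[OF swE'(1)] w'y by simp_all
          moreover have "x \<noteq> s" "y \<noteq> s" "z \<noteq> s'" "x \<noteq> z" "y \<noteq> z" using xyz sw sw' d by auto
          ultimately show ?thesis using False xy by (simp add: avoid_def)
        qed
        moreover have "is_P3 (avoid E {s, z})" using E(2)[OF AE[OF swE(1)]] wz by simp
        moreover have "{x, y} \<noteq> {s', x}" "{s', y} \<noteq> {x, y}" "{s', y} \<noteq> {s', x}"
          using xyz sw' d by (auto simp: doubleton_eq_iff)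
        ultimately show False using is_P3_superset[of _ "{x, y}" "{s', x}" "{s', y}"] by simp
      qed
      have no2: "{s, x} \<notin> ?A"
      proof
        assume *: "{s, x} \<in> ?A"
        have "{{x, z}, {s, x}, {s, z}} \<subseteq> avoid E {s', y}"
        proof -
          have "{s, x} \<in> E" "{s, z} \<in> E" using AE[OF *] AE[OF swE(1)] wz by simp_all
          moreover have "x \<noteq> s'" "y \<noteq> s" "z \<noteq> s'" "x \<noteq> y" "y \<noteq> z" using xyz sw sw' d by auto
          ultimately show ?thesis using False xz by (simp add: avoid_def)
        qed
        moreover have "is_P3 (avoid E {s', y})" using E(2)[OF AE[OF swE'(1)]] w'y by simp
        moreover have "{x, z} \<noteq> {s, x}" "{s, z} \<noteq> {x, z}" "{s, z} \<noteq> {s, x}"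
          using xyz sw d by (auto simp: doubleton_eq_iff)
        ultimately show False using is_P3_superset[of _ "{x, z}" "{s, x}" "{s, z}"] by simp
      qed
      have ss: "s = u \<and> s' = v \<or> s = v \<and> s' = u" using False sw sw' by auto
      have "f = {s', y} \<or> f = {s, z}" if f: "f \<in> ?A" for f
      proof -
        have "f \<noteq> {s, x}" "f \<noteq> {s', x}" using f no1 no2 by blast+
        then show ?thesis using Asub[OF f] ss wz w'y by (elim disjE) simp_all
      qed
      then have "?A = {{s', y}, {s, z}}"
        using swE(1) swE'(1) wz w'y by (intro eq_doubletonI) simp_all
      then show ?thesis using ss unfolding attached_def by (elim disjE) (simp_all add: insert_commute)
    qed
  qed
qed

text \<open>The number is the dimension plus one, that is, the common size of the maximal matchings.  The
  clause for \<open>n = 1\<close> concerns surfaces: there \<open>K\<^sub>4\<^sub>,\<^sub>3\<close> has all the right links but its matching complex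
  is a torus.\<close>
fun locally_spherical :: "nat \<Rightarrow> 'a set set \<Rightarrow> bool" where
  "locally_spherical 0 E \<longleftrightarrow> E = {}"
| "locally_spherical (Suc 0) E \<longleftrightarrow> is_P3 E"
| "locally_spherical (Suc (Suc n)) E \<longleftrightarrow>
    E \<noteq> {} \<and> (\<forall>e\<in>E. locally_spherical (Suc n) (avoid E e)) \<and> (n = 1 \<longrightarrow> \<not> is_K43 E)"

text \<open>The number again counts the edges of a maximal matching: one for each \<open>P\<^sub>3\<close>, two for each \<open>C\<^sub>5\<close>
  and each \<open>K\<^sub>3\<^sub>,\<^sub>2\<close>.\<close>
inductive standard_union :: "nat \<Rightarrow> 'a set set \<Rightarrow> bool" where
  standard_union_empty: "standard_union 0 {}"
| standard_union_P3: "is_P3 H \<Longrightarrow> standard_union n E \<Longrightarrow> \<Union>H \<inter> \<Union>E = {} \<Longrightarrow>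
    standard_union (n + 1) (H \<union> E)"
| standard_union_C5: "is_C5 H \<Longrightarrow> standard_union n E \<Longrightarrow> \<Union>H \<inter> \<Union>E = {} \<Longrightarrow>
    standard_union (n + 2) (H \<union> E)"
| standard_union_K32: "is_K32 H \<Longrightarrow> standard_union n E \<Longrightarrow> \<Union>H \<inter> \<Union>E = {} \<Longrightarrow>
    standard_union (n + 2) (H \<union> E)"

lemma standard_union_P3_alone: "is_P3 H \<Longrightarrow> standard_union 1 H"
  using standard_union_P3[OF _ standard_union_empty] by simp

lemma standard_union_C5_alone: "is_C5 H \<Longrightarrow> standard_union 2 H"
  using standard_union_C5[OF _ standard_union_empty] by (simp add: numeral_2_eq_2)

lemma standard_union_K32_alone: "is_K32 H \<Longrightarrow> standard_union 2 H"
  using standard_union_K32[OF _ standard_union_empty] by (simp add: numeral_2_eq_2)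

lemma is_C5I: "distinct [a, b, c, d, e] \<Longrightarrow>
    H = {{a, b}, {b, c}, {c, d}, {d, e}, {e, a}} \<Longrightarrow> is_C5 H"
  unfolding is_C5_def by (intro exI conjI; assumption)

lemma is_K32I: "distinct [a, b, c, p, q] \<Longrightarrow>
    H = {{a, p}, {b, p}, {c, p}, {a, q}, {b, q}, {c, q}} \<Longrightarrow> is_K32 H"
  unfolding is_K32_def by (intro exI conjI; assumption)

lemma attached_C5_or_K32:
  assumes "attached u v x y z A" "distinct [u, v, x, y, z]"
  shows "is_C5 ({{u, v}, {x, y}, {x, z}} \<union> A) \<or> is_K32 ({{u, v}, {x, y}, {x, z}} \<union> A)"
  using assms(1) unfolding attached_def
proof (elim disjE)
  assume A: "A = {{u, y}, {v, z}}"
  have "is_C5 ({{u, v}, {x, y}, {x, z}} \<union> A)"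
    by (rule is_C5I[of u y x z v]) (use assms(2) in force, simp add: A insert_commute)
  then show ?thesis by simp
next
  assume A: "A = {{v, y}, {u, z}}"
  have "is_C5 ({{u, v}, {x, y}, {x, z}} \<union> A)"
    by (rule is_C5I[of v y x z u]) (use assms(2) in force, simp add: A insert_commute)
  then show ?thesis by simp
next
  assume A: "A = {{u, y}, {u, z}, {v, x}}"
  have "is_K32 ({{u, v}, {x, y}, {x, z}} \<union> A)"
    by (rule is_K32I[of y z v x u]) (use assms(2) in force, simp add: A insert_commute)
  then show ?thesis by simp
next
  assume A: "A = {{v, y}, {v, z}, {u, x}}"
  have "is_K32 ({{u, v}, {x, y}, {x, z}} \<union> A)"
    by (rule is_K32I[of y z u x v]) (use assms(2) in force, simp add: A insert_commute)
  then show ?thesis by simp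
qed

lemma attached_verts: "attached u v x y z A \<Longrightarrow> \<Union>A \<subseteq> {u, v, x, y, z}"
  unfolding attached_def by (elim disjE) simp_all

lemma attached_ends:
  assumes "attached u v x y z A"
  obtains s where "s \<in> {u, v}" "{s, z} \<in> A"
proof -
  have "\<exists>s\<in>{u, v}. {s, z} \<in> A"
    using assms unfolding attached_def by (elim disjE) simp_all
  then show thesis using that by blast
qed

lemma two_uniform_pair: "two_uniform E \<Longrightarrow> {u, v} \<in> E \<Longrightarrow> u \<noteq> v"
  by (force simp: two_uniform_def)

lemma lone_is_P3:
  assumes "s \<in> {u, v}" "w \<notin> {u, v}" "u \<noteq> v"
  shows "is_P3 {{u, v}, {s, w}}"
  unfolding is_P3_def
proof (intro exI conjI)
  show "distinct [s, if s = u then v else u, w]" using assms by auto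
  have "{u, v} = {s, if s = u then v else u}" using assms(1) by auto
  then show "{{u, v}, {s, w}} = {{s, if s = u then v else u}, {s, w}}" by simp
qed

lemma is_P3I: "distinct [x, y, z] \<Longrightarrow> is_P3 {{x, y}, {x, z}}"
  unfolding is_P3_def by (intro exI conjI) (assumption, rule refl)

lemma locally_spherical_2_cases:
  assumes E: "two_uniform E" "locally_spherical 2 E"
  shows "is_C5 E \<or> is_K32 E \<or> (\<exists>x y z x' y' z'. distinct [x, y, z, x', y', z'] \<and>
    E = {{x, y}, {x, z}, {x', y'}, {x', z'}})"
proof -
  have P: "\<forall>e\<in>E. is_P3 (avoid E e)" using E(2) by (auto simp: numeral_2_eq_2)
  obtain e where e: "e \<in> E" using E(2) by (auto simp: numeral_2_eq_2)
  then obtain u v where uv: "e = {u, v}" "u \<noteq> v" using E(1) by (auto simp: two_uniform_def card_2_iff)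
  obtain x y z where xyz: "distinct [x, y, z]" and av: "avoid E {u, v} = {{x, y}, {x, z}}"
    using bspec[OF P e] unfolding uv is_P3_def by metis
  have "{x, y} \<in> avoid E {u, v}" "{x, z} \<in> avoid E {u, v}" using av by auto
  then have d: "distinct [u, v, x, y, z]" using xyz uv(2) by (auto simp: avoid_def)
  have EE: "E = insert {u, v} ({{x, y}, {x, z}} \<union> around E {u, v})"
    using split_around[of "{u, v}" E] av e uv by simp
  from circle_around[OF E(1) P e[unfolded uv] xyz av] show ?thesis
  proof (elim disjE exE conjE)
    assume "attached u v x y z (around E {u, v})"
    from attached_C5_or_K32[OF this d] have "is_C5 E \<or> is_K32 E"
      using EE by (simp add: insert_commute)
    then show ?thesis by (elim disjE) simp_all
  next
    fix s w assume sw: "s \<in> {u, v}" "w \<notin> {u, v, x, y, z}" and A: "around E {u, v} = {{s, w}}"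
    define t where "t = (if s = u then v else u)"
    have st: "{u, v} = {s, t}" using sw by (auto simp: t_def)
    have "distinct [s, t, w, x, y, z]" using sw d by (auto simp: t_def)
    moreover have "E = {{s, t}, {s, w}, {x, y}, {x, z}}"
      using EE[unfolded A] unfolding st by (simp add: insert_commute)
    ultimately show ?thesis
      by (intro disjI2 exI[of _ s] exI[of _ t] exI[of _ w] exI[of _ x] exI[of _ y] exI[of _ z] conjI)
  qed
qed

lemma locally_spherical_2_imp_standard_union:
  assumes E: "two_uniform E" "locally_spherical 2 E"
  shows "standard_union 2 E"
  using locally_spherical_2_cases[OF E]
proof (elim disjE exE conjE)
  fix x y z x' y' z' assume d: "distinct [x, y, z, x', y', z']"
    and E: "E = {{x, y}, {x, z}, {x', y'}, {x', z'}}"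
  have "standard_union (1 + 1) ({{x, y}, {x, z}} \<union> {{x', y'}, {x', z'}})"
    using d by (intro standard_union_P3 standard_union_P3_alone is_P3I) auto
  then show ?thesis unfolding E by (simp add: numeral_2_eq_2 insert_commute)
qed (simp_all add: standard_union_C5_alone standard_union_K32_alone)

section \<open>Edge sets whose matching complex is a surface\<close>

text \<open>The edges disjoint from a fixed edge \<open>f\<close> form one of the edge sets of the previous section, so
  \<open>circle_around\<close> describes the edges that meet \<open>uv\<close> but not \<open>f\<close>.  All arguments about surfaces
  compare these partial descriptions for several \<open>f\<close>.\<close>
lemma surface_around:
  assumes E: "two_uniform E" "locally_spherical 3 E" and e: "{u, v} \<in> E" and f: "f \<in> avoid E {u, v}"
    and xyz: "distinct [x, y, z]" and av: "avoid (avoid E {u, v}) f = {{x, y}, {x, z}}"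
  shows "attached u v x y z (avoid (around E {u, v}) f) \<or>
    (\<exists>s w. s \<in> {u, v} \<and> w \<notin> {u, v, x, y, z} \<union> f \<and> avoid (around E {u, v}) f = {{s, w}})"
proof -
  have fE: "f \<in> E" "{u, v} \<inter> f = {}" using f by (auto simp: avoid_def)
  have g: "locally_spherical 2 (avoid E f)" using E(2) fE(1) by (simp add: eval_nat_numeral)
  have P: "\<forall>e\<in>avoid E f. is_P3 (avoid (avoid E f) e)"
    using g by (simp add: numeral_2_eq_2)
  have "avoid (avoid E f) {u, v} = {{x, y}, {x, z}}" using av by (simp add: avoid_avoid Un_commute)
  moreover have "{u, v} \<in> avoid E f" using e fE by (simp add: avoid_def)
  moreover have A: "around (avoid E f) {u, v} = avoid (around E {u, v}) f" by (rule around_avoid[OF fE(2)])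
  ultimately have *: "attached u v x y z (avoid (around E {u, v}) f) \<or>
    (\<exists>s w. s \<in> {u, v} \<and> w \<notin> {u, v, x, y, z} \<and> avoid (around E {u, v}) f = {{s, w}})"
    using circle_around[OF two_uniform_avoid[OF E(1)] P _ xyz, of u v] by simp
  then show ?thesis
  proof (elim disjE exE conjE)
    fix s w assume sw: "s \<in> {u, v}" "w \<notin> {u, v, x, y, z}" "avoid (around E {u, v}) f = {{s, w}}"
    then have "{s, w} \<in> avoid (around E {u, v}) f" by blast
    then have "w \<notin> f" by (simp add: avoid_def)
    then show ?thesis using sw by (intro disjI2 exI[of _ s] exI[of _ w]) simp
  qed (rule disjI1)
qed

lemma surface_attached_P3:
  assumes "attached u v x y z A" "distinct [u, v, x, y, z, x', y', z']"
  shows "standard_union 3 (insert {u, v} ({{x, y}, {x, z}, {x', y'}, {x', z'}} \<union> A))"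
proof -
  have "\<Union>({{u, v}, {x, y}, {x, z}} \<union> A) \<inter> \<Union>{{x', y'}, {x', z'}} = {}"
    using attached_verts[OF assms(1)] assms(2) by auto
  moreover have "standard_union 1 {{x', y'}, {x', z'}}"
    using assms(2) by (intro standard_union_P3_alone is_P3I) simp
  moreover have "is_C5 ({{u, v}, {x, y}, {x, z}} \<union> A) \<or> is_K32 ({{u, v}, {x, y}, {x, z}} \<union> A)"
    using attached_C5_or_K32[OF assms(1)] assms(2) by simp
  ultimately have "standard_union (1 + 2) ({{u, v}, {x, y}, {x, z}} \<union> A \<union> {{x', y'}, {x', z'}})"
    using standard_union_C5[of "{{u, v}, {x, y}, {x, z}} \<union> A" 1 "{{x', y'}, {x', z'}}"]
      standard_union_K32[of "{{u, v}, {x, y}, {x, z}} \<union> A" 1 "{{x', y'}, {x', z'}}"]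
    by (elim disjE) simp_all
  moreover have "{{u, v}, {x, y}, {x, z}} \<union> A \<union> {{x', y'}, {x', z'}} =
    insert {u, v} ({{x, y}, {x, z}, {x', y'}, {x', z'}} \<union> A)" by (simp add: insert_commute)
  ultimately show ?thesis by (simp add: numeral_3_eq_3)
qed

lemma surface_lone_P3:
  assumes "standard_union 2 F" "s \<in> {u, v}" "w \<notin> {u, v}" "u \<noteq> v" "{u, v, w} \<inter> \<Union>F = {}"
  shows "standard_union 3 (insert {u, v} (F \<union> {{s, w}}))"
proof -
  have "standard_union (2 + 1) ({{u, v}, {s, w}} \<union> F)"
    using assms by (intro standard_union_P3 lone_is_P3) auto
  moreover have "{{u, v}, {s, w}} \<union> F = insert {u, v} (F \<union> {{s, w}})" by auto
  ultimately show ?thesis by (simp add: numeral_3_eq_3)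
qed

text \<open>If \<open>uv\<close> is attached to the path \<open>y x z\<close>, all its neighbouring edges that avoid \<open>x'\<close> and \<open>y'\<close>
  end in \<open>x\<close>, \<open>y\<close>, \<open>z\<close>.  If it were also attached to \<open>y' x' z'\<close>, there would be one that ends in
  \<open>z'\<close>.  So \<open>uv\<close> is attached to at most one of the two paths.\<close>
lemma surface_2P3:
  assumes E: "two_uniform E" "locally_spherical 3 E" and e: "{u, v} \<in> E"
    and d: "distinct [x, y, z, x', y', z']"
    and av: "avoid E {u, v} = {{x, y}, {x, z}, {x', y'}, {x', z'}}"
  shows "standard_union 3 E"
proof -
  let ?A = "around E {u, v}"
  have "u \<noteq> v" using two_uniform_pair[OF E(1) e] .
  moreover have "f \<inter> {u, v} = {}" if "f \<in> {{x, y}, {x, z}, {x', y'}, {x', z'}}" for f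
    using that unfolding av[symmetric] by (simp add: avoid_def)
  ultimately have d: "distinct [u, v, x, y, z, x', y', z']" using d by auto
  have EE: "E = insert {u, v} ({{x, y}, {x, z}, {x', y'}, {x', z'}} \<union> ?A)"
    using split_around[OF e] av by simp
  have A: "\<exists>s w. s \<in> {u, v} \<and> w \<notin> {u, v} \<and> f = {s, w}" if "f \<in> ?A" for f
    using around_cases[OF E(1) that] by metis
  have 1: "attached u v x y z (avoid ?A {x', y'}) \<or>
    (\<exists>s w. s \<in> {u, v} \<and> w \<notin> {u, v, x, y, z} \<union> {x', y'} \<and> avoid ?A {x', y'} = {{s, w}})"
    using d by (intro surface_around[OF E e]) (auto simp: av avoid_insert)
  have 2: "attached u v x' y' z' (avoid ?A {x, y}) \<or>
    (\<exists>s w. s \<in> {u, v} \<and> w \<notin> {u, v, x', y', z'} \<union> {x, y} \<and> avoid ?A {x, y} = {{s, w}})"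
    using d by (intro surface_around[OF E e]) (auto simp: av avoid_insert)
  have lone1: "?A = avoid ?A {x', y'}"
    if "s \<in> {u, v}" "w \<notin> {u, v, x', y', z'} \<union> {x, y}" "avoid ?A {x, y} = {{s, w}}" for s w
  proof -
    have "f \<inter> {x', y'} = {}" if f: "f \<in> ?A" for f
    proof (rule ccontr)
      assume *: "f \<inter> {x', y'} \<noteq> {}"
      obtain s' w' where s': "s' \<in> {u, v}" "w' \<notin> {u, v}" "f = {s', w'}" using A[OF f] by metis
      then have w': "w' = x' \<or> w' = y'" using * d by auto
      then have "f \<in> avoid ?A {x, y}" using f s' d by (auto simp: avoid_def)
      then have "f = {s, w}" using \<open>avoid ?A {x, y} = {{s, w}}\<close> by simp
      moreover have "w' \<noteq> s" using that(1) \<open>s \<in> {u, v}\<close> s' by auto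
      ultimately show False using s' w' \<open>w \<notin> _\<close> by (auto simp: doubleton_eq_iff)
    qed
    then show ?thesis by (auto simp: avoid_def)
  qed
  have lone2: "?A = avoid ?A {x, y}"
    if "s \<in> {u, v}" "w \<notin> {u, v, x, y, z} \<union> {x', y'}" "avoid ?A {x', y'} = {{s, w}}" for s w
  proof -
    have "f \<inter> {x, y} = {}" if f: "f \<in> ?A" for f
    proof (rule ccontr)
      assume *: "f \<inter> {x, y} \<noteq> {}"
      obtain s' w' where s': "s' \<in> {u, v}" "w' \<notin> {u, v}" "f = {s', w'}" using A[OF f] by metis
      then have w': "w' = x \<or> w' = y" using * d by auto
      then have "f \<in> avoid ?A {x', y'}" using f s' d by (auto simp: avoid_def)
      then have "f = {s, w}" using \<open>avoid ?A {x', y'} = {{s, w}}\<close> by simp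
      moreover have "w' \<noteq> s" using that(1) \<open>s \<in> {u, v}\<close> s' by auto
      ultimately show False using s' w' \<open>w \<notin> _\<close> by (auto simp: doubleton_eq_iff)
    qed
    then show ?thesis by (auto simp: avoid_def)
  qed
  from 1 show ?thesis
  proof (elim disjE exE conjE)
    assume a1: "attached u v x y z (avoid ?A {x', y'})"
    from 2 show ?thesis
    proof (elim disjE exE conjE)
      assume "attached u v x' y' z' (avoid ?A {x, y})"
      then obtain s where s: "s \<in> {u, v}" "{s, z'} \<in> avoid ?A {x, y}" by (rule attached_ends)
      then have "{s, z'} \<in> avoid ?A {x', y'}" using d by (auto simp: avoid_def)
      then have "z' \<in> \<Union>(avoid ?A {x', y'})" by blast
      then show ?thesis using attached_verts[OF a1] d by auto
    next
      fix s w
      assume "s \<in> {u, v}" "w \<notin> {u, v, x', y', z'} \<union> {x, y}" "avoid ?A {x, y} = {{s, w}}"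
      from lone1[OF this] have "attached u v x y z ?A" using a1 by simp
      from surface_attached_P3[OF this d] show ?thesis using EE by simp
    qed
  next
    fix s w
    assume sw: "s \<in> {u, v}" "w \<notin> {u, v, x, y, z} \<union> {x', y'}" and a1: "avoid ?A {x', y'} = {{s, w}}"
    note A2 = lone2[OF sw a1]
    from 2 show ?thesis
    proof (elim disjE exE conjE)
      assume "attached u v x' y' z' (avoid ?A {x, y})"
      then have "attached u v x' y' z' ?A" using A2 by simp
      from surface_attached_P3[OF this, of x y z] show ?thesis
        using EE d by (simp add: insert_commute) blast
    next
      fix s' w'
      assume sw': "s' \<in> {u, v}" "w' \<notin> {u, v, x', y', z'} \<union> {x, y}" and a2: "avoid ?A {x, y} = {{s', w'}}"
      have A': "?A = {{s, w}}" using lone1[OF sw' a2] a1 by simp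
      moreover have "?A = {{s', w'}}" using A2 a2 by simp
      ultimately have "{s, w} = {s', w'}" by simp
      then have "w = w'" using sw sw' by (auto simp: doubleton_eq_iff)
      then have w: "w \<notin> {u, v, x, y, z, x', y', z'}" using sw sw' by simp
      have "standard_union (1 + 1) ({{x, y}, {x, z}} \<union> {{x', y'}, {x', z'}})"
        using d by (intro standard_union_P3 standard_union_P3_alone is_P3I) auto
      then have "standard_union 2 {{x, y}, {x, z}, {x', y'}, {x', z'}}"
        by (simp add: numeral_2_eq_2 insert_commute)
      from surface_lone_P3[OF this sw(1), of w] show ?thesis
        using EE[unfolded A'] w d by auto
    qed
  qed
qed

text \<open>An edge from \<open>uv\<close> to a vertex outside \<open>F\<close> is seen from every edge \<open>f\<close> of \<open>F\<close>, and excludes every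
  other neighbouring edge that is seen from \<open>f\<close>.  As no vertex lies on all edges of \<open>F\<close>, each
  neighbouring edge is seen from some \<open>f\<close>.  So there is only one.\<close>
lemma surface_lone:
  assumes E: "two_uniform E" and e: "{u, v} \<in> E" and F: "standard_union 2 (avoid E {u, v})"
    and types: "\<forall>f\<in>avoid E {u, v}. \<Union>(avoid (around E {u, v}) f) \<subseteq> {u, v} \<union> \<Union>(avoid E {u, v}) \<or>
      (\<exists>s w. s \<in> {u, v} \<and> w \<notin> {u, v} \<union> \<Union>(avoid E {u, v}) \<and> avoid (around E {u, v}) f = {{s, w}})"
    and f0: "f0 \<in> avoid E {u, v}" "s \<in> {u, v}" "w \<notin> {u, v} \<union> \<Union>(avoid E {u, v})"
      "avoid (around E {u, v}) f0 = {{s, w}}"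
    and no_star: "\<forall>w. \<exists>f\<in>avoid E {u, v}. w \<notin> f"
  shows "standard_union 3 E"
proof -
  let ?A = "around E {u, v}" and ?F = "avoid E {u, v}"
  have swA: "{s, w} \<in> ?A" using f0(4) by (auto simp: avoid_def)
  have *: "avoid ?A f = {{s, w}}" if f: "f \<in> ?F" for f
  proof -
    have "s \<notin> f" "w \<notin> f" using f f0(2,3) by (auto simp: avoid_def)
    then have sw: "{s, w} \<in> avoid ?A f" using swA by (simp add: avoid_def)
    from bspec[OF types f] show ?thesis
    proof (elim disjE exE conjE)
      assume "\<Union>(avoid ?A f) \<subseteq> {u, v} \<union> \<Union>?F"
      moreover have "w \<in> \<Union>(avoid ?A f)" using sw by blast
      ultimately show ?thesis using f0(3) by blast
    next
      fix s' w' assume "avoid ?A f = {{s', w'}}"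
      then show ?thesis using sw by simp
    qed
  qed
  have "g = {s, w}" if g: "g \<in> ?A" for g
  proof -
    obtain s' w' where g': "s' \<in> {u, v}" "w' \<notin> {u, v}" "g = {s', w'}"
      using around_cases[OF E g] by metis
    obtain f where f: "f \<in> ?F" "w' \<notin> f" using no_star by blast
    moreover have "s' \<notin> f" using f g'(1) by (auto simp: avoid_def)
    ultimately have "g \<in> avoid ?A f" using g g' by (simp add: avoid_def)
    then show ?thesis using *[OF f(1)] by simp
  qed
  then have A: "?A = {{s, w}}" by (rule eq_singletonI[OF swA])
  have "{u, v, w} \<inter> \<Union>?F = {}" using f0(3) by (auto simp: avoid_def)
  then have "standard_union 3 (insert {u, v} (?F \<union> {{s, w}}))"
    using surface_lone_P3[OF F f0(2) _ two_uniform_pair[OF E e], of w] f0(3) by simp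
  then show ?thesis using split_around[OF e] A by simp
qed

text \<open>In terms of membership of the six possible edges the four cases of \<open>attached\<close> become a propositional
  formula.  Think of a vertex joined to \<open>u\<close> or to \<open>v\<close> as having one of two colours: the two ends
  of the path always have a colour; the centre has none if these colours differ, and
  the opposite colour if they agree.\<close>
lemma attached_colours:
  assumes "attached u v x y z (avoid A f)" "distinct [u, v, x, y, z]" "f \<inter> {u, v, x, y, z} = {}"
  shows "{u, y} \<in> A \<and> {v, y} \<notin> A \<and> {v, z} \<in> A \<and> {u, z} \<notin> A \<and> {u, x} \<notin> A \<and> {v, x} \<notin> A \<or>
    {u, y} \<notin> A \<and> {v, y} \<in> A \<and> {v, z} \<notin> A \<and> {u, z} \<in> A \<and> {u, x} \<notin> A \<and> {v, x} \<notin> A \<or>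
    {u, y} \<in> A \<and> {v, y} \<notin> A \<and> {v, z} \<notin> A \<and> {u, z} \<in> A \<and> {u, x} \<notin> A \<and> {v, x} \<in> A \<or>
    {u, y} \<notin> A \<and> {v, y} \<in> A \<and> {v, z} \<in> A \<and> {u, z} \<notin> A \<and> {u, x} \<in> A \<and> {v, x} \<notin> A"
proof -
  have f: "u \<notin> f" "v \<notin> f" "x \<notin> f" "y \<notin> f" "z \<notin> f" using assms(3) by auto
  have "{u, y} \<in> A \<longleftrightarrow> {u, y} \<in> avoid A f" "{v, y} \<in> A \<longleftrightarrow> {v, y} \<in> avoid A f"
    "{u, z} \<in> A \<longleftrightarrow> {u, z} \<in> avoid A f" "{v, z} \<in> A \<longleftrightarrow> {v, z} \<in> avoid A f"
    "{u, x} \<in> A \<longleftrightarrow> {u, x} \<in> avoid A f" "{v, x} \<in> A \<longleftrightarrow> {v, x} \<in> avoid A f"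
    using f by (simp_all add: avoid_def)
  moreover have "distinct [u, v, x, y, z] \<Longrightarrow> attached u v x y z B \<Longrightarrow>
    {u, y} \<in> B \<and> {v, y} \<notin> B \<and> {v, z} \<in> B \<and> {u, z} \<notin> B \<and> {u, x} \<notin> B \<and> {v, x} \<notin> B \<or>
    {u, y} \<notin> B \<and> {v, y} \<in> B \<and> {v, z} \<notin> B \<and> {u, z} \<in> B \<and> {u, x} \<notin> B \<and> {v, x} \<notin> B \<or>
    {u, y} \<in> B \<and> {v, y} \<notin> B \<and> {v, z} \<notin> B \<and> {u, z} \<in> B \<and> {u, x} \<notin> B \<and> {v, x} \<in> B \<or>
    {u, y} \<notin> B \<and> {v, y} \<in> B \<and> {v, z} \<in> B \<and> {u, z} \<notin> B \<and> {u, x} \<in> B \<and> {v, x} \<notin> B" for B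
    unfolding attached_def by (elim disjE) (simp_all add: doubleton_eq_iff, auto)
  ultimately show ?thesis using assms(1,2) by simp
qed

text \<open>This applies to \<open>F = C\<^sub>5\<close> and \<open>F = K\<^sub>3\<^sub>,\<^sub>2\<close>, where the ends of \<open>f\<close> and the path that remains exhaust
  the vertices of \<open>F\<close>.  So if the path is not attached to \<open>uv\<close>, the edge that \<open>surface_around\<close>
  provides instead leads to a vertex outside \<open>F\<close>, and \<open>surface_lone\<close> applies.\<close>
lemma surface_standard_union_or_attached:
  assumes E: "two_uniform E" "locally_spherical 3 E" and e: "{u, v} \<in> E" and ne: "\<not> standard_union 3 E"
    and F: "standard_union 2 (avoid E {u, v})" "\<forall>w. \<exists>f\<in>avoid E {u, v}. w \<notin> f"
    and P3: "\<forall>f\<in>avoid E {u, v}. \<exists>x y z. distinct [x, y, z] \<and>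
      avoid (avoid E {u, v}) f = {{x, y}, {x, z}} \<and> {x, y, z} \<union> f = \<Union>(avoid E {u, v})"
    and f: "f \<in> avoid E {u, v}" "distinct [x, y, z]" "avoid (avoid E {u, v}) f = {{x, y}, {x, z}}"
      "{x, y, z} \<union> f = \<Union>(avoid E {u, v})"
  shows "attached u v x y z (avoid (around E {u, v}) f)"
proof (rule ccontr)
  let ?A = "around E {u, v}" and ?F = "avoid E {u, v}"
  assume "\<not> ?thesis"
  then obtain s w where sw: "s \<in> {u, v}" "w \<notin> {u, v, x, y, z} \<union> f" "avoid ?A f = {{s, w}}"
    using surface_around[OF E e f(1-3)] by blast
  have types: "\<Union>(avoid ?A g) \<subseteq> {u, v} \<union> \<Union>?F \<or>
      (\<exists>s w. s \<in> {u, v} \<and> w \<notin> {u, v} \<union> \<Union>?F \<and> avoid ?A g = {{s, w}})" if g: "g \<in> ?F" for g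
  proof -
    from bspec[OF P3 g] obtain x' y' z' where x': "distinct [x', y', z']" "avoid ?F g = {{x', y'}, {x', z'}}"
      "{x', y', z'} \<union> g = \<Union>?F" by (elim exE conjE)
    from surface_around[OF E e g x'(1,2)] show ?thesis
    proof (elim disjE)
      assume "attached u v x' y' z' (avoid ?A g)"
      from attached_verts[OF this] show ?thesis using x'(3) by blast
    next
      assume *: "\<exists>s w. s \<in> {u, v} \<and> w \<notin> {u, v, x', y', z'} \<union> g \<and> avoid ?A g = {{s, w}}"
      have "{u, v, x', y', z'} \<union> g = {u, v} \<union> \<Union>?F" unfolding x'(3)[symmetric] by (simp add: insert_commute)
      then show ?thesis using * by (intro disjI2) (simp only:)
    qed
  qed
  have "w \<notin> {u, v} \<union> \<Union>?F" using sw(2) unfolding f(4)[symmetric] by simp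
  from surface_lone[OF E(1) e F(1) ballI[OF types] f(1) sw(1) this sw(3) F(2)] have "standard_union 3 E" .
  then show False using ne by simp
qed

text \<open>Every vertex of the pentagon is an end of one of the five paths, so all have a colour.  Hence all
  centres have the opposite colour of their two neighbours, whose colours agree.  Going around
  the pentagon in steps of two, all colours agree, a contradiction.\<close>
lemma surface_C5:
  assumes E: "two_uniform E" "locally_spherical 3 E" and e: "{u, v} \<in> E"
    and d: "distinct [a, b, c, d, k]"
    and av: "avoid E {u, v} = {{a, b}, {b, c}, {c, d}, {d, k}, {k, a}}"
  shows "standard_union 3 E"
proof (rule ccontr)
  assume ne: "\<not> standard_union 3 E"
  let ?A = "around E {u, v}" and ?F = "avoid E {u, v}"
  have "u \<noteq> v" using two_uniform_pair[OF E(1) e] .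
  moreover have "f \<inter> {u, v} = {}" if "f \<in> {{a, b}, {b, c}, {c, d}, {d, k}, {k, a}}" for f
    using that unfolding av[symmetric] by (simp add: avoid_def)
  ultimately have ds: "distinct [u, v, a, b, c, d, k]" using d by auto
  have q: "u \<noteq> v" "u \<noteq> a" "u \<noteq> b" "u \<noteq> c" "u \<noteq> d" "u \<noteq> k" "v \<noteq> a" "v \<noteq> b" "v \<noteq> c" "v \<noteq> d" "v \<noteq> k"
    "a \<noteq> b" "a \<noteq> c" "a \<noteq> d" "a \<noteq> k" "b \<noteq> c" "b \<noteq> d" "b \<noteq> k" "c \<noteq> d" "c \<noteq> k" "d \<noteq> k"
    using ds by auto
  note q = q q[symmetric]
  have U: "\<Union>?F = {a, b, c, d, k}" unfolding av by auto
  have F: "standard_union 2 ?F" unfolding av by (intro standard_union_C5_alone is_C5I[OF d] refl)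
  have st: "\<forall>w. \<exists>f\<in>?F. w \<notin> f"
  proof
    fix w
    have "w \<notin> {a, b} \<or> w \<notin> {c, d}" using q by auto
    then show "\<exists>f\<in>?F. w \<notin> f" unfolding av by auto
  qed
  have cases:
    "{a, b} \<in> ?F" "distinct [d, c, k]" "avoid ?F {a, b} = {{d, c}, {d, k}}" "{d, c, k} \<union> {a, b} = \<Union>?F"
    "{b, c} \<in> ?F" "distinct [k, d, a]" "avoid ?F {b, c} = {{k, d}, {k, a}}" "{k, d, a} \<union> {b, c} = \<Union>?F"
    "{c, d} \<in> ?F" "distinct [a, k, b]" "avoid ?F {c, d} = {{a, k}, {a, b}}" "{a, k, b} \<union> {c, d} = \<Union>?F"
    "{d, k} \<in> ?F" "distinct [b, a, c]" "avoid ?F {d, k} = {{b, a}, {b, c}}" "{b, a, c} \<union> {d, k} = \<Union>?F"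
    "{k, a} \<in> ?F" "distinct [c, b, d]" "avoid ?F {k, a} = {{c, b}, {c, d}}" "{c, b, d} \<union> {k, a} = \<Union>?F"
    unfolding U unfolding av by (simp_all add: avoid_insert q insert_commute)
  have P3: "\<forall>f\<in>?F. \<exists>x y z. distinct [x, y, z] \<and>
    avoid ?F f = {{x, y}, {x, z}} \<and> {x, y, z} \<union> f = \<Union>?F"
  proof
    fix f assume "f \<in> ?F"
    then have "f = {a, b} \<or> f = {b, c} \<or> f = {c, d} \<or> f = {d, k} \<or> f = {k, a}"
      unfolding av by simp
    then show "\<exists>x y z. distinct [x, y, z] \<and> avoid ?F f = {{x, y}, {x, z}} \<and> {x, y, z} \<union> f = \<Union>?F"
      using cases by metis
  qed
  note att = surface_standard_union_or_attached[OF E e ne F st P3]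
  note at = att[OF cases(1-4)] att[OF cases(5-8)] att[OF cases(9-12)] att[OF cases(13-16)] att[OF cases(17-20)]
  have ds': "distinct [u, v, d, c, k]" "distinct [u, v, k, d, a]" "distinct [u, v, a, k, b]"
    "distinct [u, v, b, a, c]" "distinct [u, v, c, b, d]"
    "{a, b} \<inter> {u, v, d, c, k} = {}" "{b, c} \<inter> {u, v, k, d, a} = {}" "{c, d} \<inter> {u, v, a, k, b} = {}"
    "{d, k} \<inter> {u, v, b, a, c} = {}" "{k, a} \<inter> {u, v, c, b, d} = {}"
    by (simp_all add: q)
  show False
    using attached_colours[OF at(1) ds'(1,6)] attached_colours[OF at(2) ds'(2,7)]
      attached_colours[OF at(3) ds'(3,8)] attached_colours[OF at(4) ds'(4,9)]
      attached_colours[OF at(5) ds'(5,10)]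
    by argo
qed

text \<open>Each of \<open>a\<close>, \<open>b\<close>, \<open>c\<close> is an end of some path, so it has a colour, and two of the three agree.  The
  centres \<open>p\<close>, \<open>q\<close> of the paths between these two then have the other colour, so that the ends
  of every path agree: \<open>a\<close>, \<open>b\<close>, \<open>c\<close> have one colour and \<open>p\<close>, \<open>q\<close> the other.  This is a
  \<open>K\<^sub>4\<^sub>,\<^sub>3\<close>.\<close>
lemma surface_K32:
  assumes E: "two_uniform E" "locally_spherical 3 E" and e: "{u, v} \<in> E"
    and d: "distinct [a, b, c, p, q]"
    and av: "avoid E {u, v} = {{a, p}, {b, p}, {c, p}, {a, q}, {b, q}, {c, q}}"
  shows "standard_union 3 E"
proof (rule ccontr)
  assume ne: "\<not> standard_union 3 E"
  let ?A = "around E {u, v}" and ?F = "avoid E {u, v}"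
  have "u \<noteq> v" using two_uniform_pair[OF E(1) e] .
  moreover have "f \<inter> {u, v} = {}" if "f \<in> {{a, p}, {b, p}, {c, p}, {a, q}, {b, q}, {c, q}}" for f
    using that unfolding av[symmetric] by (simp add: avoid_def)
  ultimately have ds: "distinct [u, v, a, b, c, p, q]" using d by auto
  have n: "u \<noteq> v" "u \<noteq> a" "u \<noteq> b" "u \<noteq> c" "u \<noteq> p" "u \<noteq> q" "v \<noteq> a" "v \<noteq> b" "v \<noteq> c" "v \<noteq> p" "v \<noteq> q"
    "a \<noteq> b" "a \<noteq> c" "a \<noteq> p" "a \<noteq> q" "b \<noteq> c" "b \<noteq> p" "b \<noteq> q" "c \<noteq> p" "c \<noteq> q" "p \<noteq> q"
    using ds by auto
  note n = n n[symmetric]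
  have U: "\<Union>?F = {a, b, c, p, q}" unfolding av by auto
  have F: "standard_union 2 ?F" unfolding av by (intro standard_union_K32_alone is_K32I[OF d] refl)
  have st: "\<forall>w. \<exists>f\<in>?F. w \<notin> f"
  proof
    fix w
    have "w \<notin> {a, p} \<or> w \<notin> {b, q}" using n by auto
    then show "\<exists>f\<in>?F. w \<notin> f" unfolding av by auto
  qed
  have cases:
    "{a, p} \<in> ?F" "distinct [q, b, c]" "avoid ?F {a, p} = {{q, b}, {q, c}}" "{q, b, c} \<union> {a, p} = \<Union>?F"
    "{b, p} \<in> ?F" "distinct [q, a, c]" "avoid ?F {b, p} = {{q, a}, {q, c}}" "{q, a, c} \<union> {b, p} = \<Union>?F"
    "{c, p} \<in> ?F" "distinct [q, a, b]" "avoid ?F {c, p} = {{q, a}, {q, b}}" "{q, a, b} \<union> {c, p} = \<Union>?F"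
    "{a, q} \<in> ?F" "distinct [p, b, c]" "avoid ?F {a, q} = {{p, b}, {p, c}}" "{p, b, c} \<union> {a, q} = \<Union>?F"
    "{b, q} \<in> ?F" "distinct [p, a, c]" "avoid ?F {b, q} = {{p, a}, {p, c}}" "{p, a, c} \<union> {b, q} = \<Union>?F"
    "{c, q} \<in> ?F" "distinct [p, a, b]" "avoid ?F {c, q} = {{p, a}, {p, b}}" "{p, a, b} \<union> {c, q} = \<Union>?F"
    unfolding U unfolding av by (simp_all add: avoid_insert n insert_commute)
  have P3: "\<forall>f\<in>?F. \<exists>x y z. distinct [x, y, z] \<and>
    avoid ?F f = {{x, y}, {x, z}} \<and> {x, y, z} \<union> f = \<Union>?F"
  proof
    fix f assume "f \<in> ?F"
    then have "f = {a, p} \<or> f = {b, p} \<or> f = {c, p} \<or> f = {a, q} \<or> f = {b, q} \<or> f = {c, q}"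
      unfolding av by simp
    then show "\<exists>x y z. distinct [x, y, z] \<and> avoid ?F f = {{x, y}, {x, z}} \<and> {x, y, z} \<union> f = \<Union>?F"
      using cases by metis
  qed
  note att = surface_standard_union_or_attached[OF E e ne F st P3]
  note at = att[OF cases(1-4)] att[OF cases(5-8)] att[OF cases(9-12)] att[OF cases(13-16)] att[OF cases(17-20)]
    att[OF cases(21-24)]
  have ds': "distinct [u, v, q, b, c]" "distinct [u, v, q, a, c]" "distinct [u, v, q, a, b]"
    "distinct [u, v, p, b, c]" "distinct [u, v, p, a, c]" "distinct [u, v, p, a, b]"
    "{a, p} \<inter> {u, v, q, b, c} = {}" "{b, p} \<inter> {u, v, q, a, c} = {}" "{c, p} \<inter> {u, v, q, a, b} = {}"
    "{a, q} \<inter> {u, v, p, b, c} = {}" "{b, q} \<inter> {u, v, p, a, c} = {}" "{c, q} \<inter> {u, v, p, a, b} = {}"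
    by (simp_all add: n)
  have col: "{u, p} \<in> ?A \<and> {u, q} \<in> ?A \<and> {v, a} \<in> ?A \<and> {v, b} \<in> ?A \<and> {v, c} \<in> ?A \<and>
      {v, p} \<notin> ?A \<and> {v, q} \<notin> ?A \<and> {u, a} \<notin> ?A \<and> {u, b} \<notin> ?A \<and> {u, c} \<notin> ?A \<or>
    {v, p} \<in> ?A \<and> {v, q} \<in> ?A \<and> {u, a} \<in> ?A \<and> {u, b} \<in> ?A \<and> {u, c} \<in> ?A \<and>
      {u, p} \<notin> ?A \<and> {u, q} \<notin> ?A \<and> {v, a} \<notin> ?A \<and> {v, b} \<notin> ?A \<and> {v, c} \<notin> ?A"
    using attached_colours[OF at(1) ds'(1,7)] attached_colours[OF at(2) ds'(2,8)]
      attached_colours[OF at(3) ds'(3,9)] attached_colours[OF at(4) ds'(4,10)]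
      attached_colours[OF at(5) ds'(5,11)] attached_colours[OF at(6) ds'(6,12)]
    by argo
  have A: "\<exists>s w. s \<in> {u, v} \<and> w \<in> {a, b, c, p, q} \<and> f = {s, w}" if f: "f \<in> ?A" for f
  proof -
    obtain s w where s: "s \<in> {u, v}" "w \<notin> {u, v}" "f = {s, w}" using around_cases[OF E(1) f] by metis
    obtain g where g: "g \<in> ?F" "w \<notin> g" using st by blast
    have "s \<notin> g" using g(1) s(1) by (auto simp: avoid_def)
    then have fg: "f \<in> avoid ?A g" using f s g by (simp add: avoid_def)
    from bspec[OF P3 g(1)] obtain x y z where x: "distinct [x, y, z]" "avoid ?F g = {{x, y}, {x, z}}"
      "{x, y, z} \<union> g = \<Union>?F" by (elim exE conjE)
    have "\<Union>(avoid ?A g) \<subseteq> {u, v, x, y, z}" by (rule attached_verts[OF att[OF g(1) x]])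
    then have "w \<in> {u, v, x, y, z}" using fg s by blast
    then have "w \<in> {x, y, z} \<union> g" using s(2) by auto
    then have "w \<in> {a, b, c, p, q}" unfolding x(3) U .
    then show ?thesis using s by (intro exI[of _ s] exI[of _ w] conjI)
  qed
  have EE: "E = insert {u, v} (?F \<union> ?A)" by (rule split_around[OF e]) simp
  have "\<exists>s t. {s, t} = {u, v} \<and> distinct [s, a, b, c, p, q, t] \<and>
    ?A = {{s, p}, {s, q}, {a, t}, {b, t}, {c, t}}"
    using col
  proof
    assume c: "{u, p} \<in> ?A \<and> {u, q} \<in> ?A \<and> {v, a} \<in> ?A \<and> {v, b} \<in> ?A \<and> {v, c} \<in> ?A \<and>
      {v, p} \<notin> ?A \<and> {v, q} \<notin> ?A \<and> {u, a} \<notin> ?A \<and> {u, b} \<notin> ?A \<and> {u, c} \<notin> ?A"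
    have "f \<in> {{u, p}, {u, q}, {v, a}, {v, b}, {v, c}}" if f: "f \<in> ?A" for f
      using A[OF f] f c by (elim exE conjE insertE emptyE) simp_all
    then have "?A = {{u, p}, {u, q}, {v, a}, {v, b}, {v, c}}" using c by (intro equalityI subsetI) auto
    then show ?thesis using ds by (intro exI[of _ u] exI[of _ v]) (simp add: insert_commute n)
  next
    assume c: "{v, p} \<in> ?A \<and> {v, q} \<in> ?A \<and> {u, a} \<in> ?A \<and> {u, b} \<in> ?A \<and> {u, c} \<in> ?A \<and>
      {u, p} \<notin> ?A \<and> {u, q} \<notin> ?A \<and> {v, a} \<notin> ?A \<and> {v, b} \<notin> ?A \<and> {v, c} \<notin> ?A"
    have "f \<in> {{v, p}, {v, q}, {u, a}, {u, b}, {u, c}}" if f: "f \<in> ?A" for f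
      using A[OF f] f c by (elim exE conjE insertE emptyE) simp_all
    then have "?A = {{v, p}, {v, q}, {u, a}, {u, b}, {u, c}}" using c by (intro equalityI subsetI) auto
    then show ?thesis using ds by (intro exI[of _ v] exI[of _ u]) (simp add: insert_commute n)
  qed
  then obtain s t where s: "{s, t} = {u, v}" "distinct [s, a, b, c, p, q, t]"
    "?A = {{s, p}, {s, q}, {a, t}, {b, t}, {c, t}}" by (elim exE conjE)
  have "E = insert {s, t} ({{a, p}, {b, p}, {c, p}, {a, q}, {b, q}, {c, q}} \<union>
      {{s, p}, {s, q}, {a, t}, {b, t}, {c, t}})"
    using EE[unfolded av s(3)] unfolding s(1) .
  also have "\<dots> = {{s, p}, {a, p}, {b, p}, {c, p}, {s, q}, {a, q}, {b, q}, {c, q},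
      {s, t}, {a, t}, {b, t}, {c, t}}"
    by (simp add: insert_commute)
  finally have "is_K43 E" unfolding is_K43_def using s(2)
    by (intro exI[of _ s] exI[of _ a] exI[of _ b] exI[of _ c] exI[of _ p] exI[of _ q] exI[of _ t] conjI)
  then show False using E(2) by (simp add: eval_nat_numeral)
qed

section \<open>Higher dimensions\<close>

definition piece :: "'a set set \<Rightarrow> bool"
  where "piece H \<longleftrightarrow> is_P3 H \<or> is_C5 H \<or> is_K32 H"

lemma standard_union_pieces:
  "standard_union n E \<Longrightarrow> \<exists>Hs. \<Union>Hs = E \<and> (\<forall>H\<in>Hs. piece H) \<and> pairwise (\<lambda>H K. \<Union>H \<inter> \<Union>K = {}) Hs"
proof (induction rule: standard_union.induct)
  case standard_union_empty
  show ?case by (intro exI[of _ "{}"]) simp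
next
  case (standard_union_P3 H n E)
  then obtain Hs where "\<Union>Hs = E" "\<forall>H\<in>Hs. piece H" "pairwise (\<lambda>H K. \<Union>H \<inter> \<Union>K = {}) Hs" by blast
  then show ?case using standard_union_P3
    by (intro exI[of _ "insert H Hs"]) (auto simp: piece_def pairwise_insert)
next
  case (standard_union_C5 H n E)
  then obtain Hs where "\<Union>Hs = E" "\<forall>H\<in>Hs. piece H" "pairwise (\<lambda>H K. \<Union>H \<inter> \<Union>K = {}) Hs" by blast
  then show ?case using standard_union_C5
    by (intro exI[of _ "insert H Hs"]) (auto simp: piece_def pairwise_insert)
next
  case (standard_union_K32 H n E)
  then obtain Hs where "\<Union>Hs = E" "\<forall>H\<in>Hs. piece H" "pairwise (\<lambda>H K. \<Union>H \<inter> \<Union>K = {}) Hs" by blast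
  then show ?case using standard_union_K32
    by (intro exI[of _ "insert H Hs"]) (auto simp: piece_def pairwise_insert)
qed

lemma piece_few_vertices: "piece H \<Longrightarrow> finite (\<Union>H) \<and> card (\<Union>H) \<le> 5"
  unfolding piece_def
proof (elim disjE)
  assume "is_P3 H"
  then obtain x y z where "H = {{x, y}, {x, z}}" unfolding is_P3_def by metis
  then show ?thesis by (simp add: card_insert_if)
next
  assume "is_C5 H"
  then obtain a b c d k where "H = {{a, b}, {b, c}, {c, d}, {d, k}, {k, a}}" unfolding is_C5_def by metis
  then have "\<Union>H = {a, b, c, d, k}" by auto
  then show ?thesis by (simp add: card_insert_if)
next
  assume "is_K32 H"
  then obtain a b c p q where "H = {{a, p}, {b, p}, {c, p}, {a, q}, {b, q}, {c, q}}"
    unfolding is_K32_def by metis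
  then have "\<Union>H = {a, b, c, p, q}" by auto
  then show ?thesis by (simp add: card_insert_if)
qed

text \<open>Three disjoint edges need six vertices.\<close>
lemma piece_no_3_matching:
  assumes "piece H" "two_uniform H" "f \<in> H" "g \<in> H" "h \<in> H"
    and "f \<inter> g = {}" "f \<inter> h = {}" "g \<inter> h = {}"
  shows False
proof -
  have c: "card f = 2" "card g = 2" "card h = 2" using assms by (auto simp: two_uniform_def)
  then have fin: "finite f" "finite g" "finite h" by (auto intro: card_ge_0_finite)
  have "card (f \<union> (g \<union> h)) = 6"
    using c fin assms(6-8) by (simp add: card_Un_disjoint Int_Un_distrib)
  moreover have "card (f \<union> (g \<union> h)) \<le> card (\<Union>H)"
    using piece_few_vertices[OF assms(1)] assms(3-5) by (intro card_mono) auto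
  ultimately show False using piece_few_vertices[OF assms(1)] by simp
qed

text \<open>A quantitative form of the connectedness of the components, which suffices to see that a component
  that meets another one from a disjoint family lies inside it.\<close>
lemma piece_line_diameter:
  assumes "piece H" "f \<in> H" "g \<in> H"
  shows "\<exists>h\<in>H. f \<inter> h \<noteq> {} \<and> h \<inter> g \<noteq> {}"
  using assms(1) unfolding piece_def
proof (elim disjE)
  assume "is_P3 H"
  then obtain x y z where H: "H = {{x, y}, {x, z}}" unfolding is_P3_def by metis
  show ?thesis using assms(2,3) unfolding H by (elim insertE emptyE; simp)
next
  assume "is_C5 H"
  then obtain a b c d k where H: "H = {{a, b}, {b, c}, {c, d}, {d, k}, {k, a}}" unfolding is_C5_def by metis
  show ?thesis using assms(2,3) unfolding H by (elim insertE emptyE; simp)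
next
  assume "is_K32 H"
  then obtain a b c p q where H: "H = {{a, p}, {b, p}, {c, p}, {a, q}, {b, q}, {c, q}}"
    unfolding is_K32_def by metis
  show ?thesis using assms(2,3) unfolding H by (elim insertE emptyE; simp)
qed

lemma pieces_eq:
  assumes "pairwise (\<lambda>H K. \<Union>H \<inter> \<Union>K = {}) Hs" "H \<in> Hs" "K \<in> Hs" "f \<in> H" "g \<in> K" "f \<inter> g \<noteq> {}"
  shows "H = K"
proof (rule ccontr)
  assume "H \<noteq> K"
  then have "\<Union>H \<inter> \<Union>K = {}" using pairwiseD[OF assms(1-3)] by simp
  then show False using assms(4-6) by blast
qed

text \<open>The edge \<open>g\<close> joins \<open>e\<close> to \<open>H\<close> and survives the deletion of the ends of \<open>f3\<close>, because its two
  ends lie on \<open>e\<close> and in \<open>H\<close>.  So the component of \<open>e\<close> among the remaining edges contains all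
  of \<open>H\<close>.\<close>
lemma connected_through:
  assumes E: "two_uniform E" and e: "e \<in> E" and f3: "f3 \<in> E" "f3 \<inter> e = {}" "f3 \<inter> \<Union>H = {}"
    and H: "piece H" "H \<subseteq> avoid E e" and f: "f \<in> H"
    and g: "g \<in> E" "g \<inter> e \<noteq> {}" "g \<inter> \<Union>H \<noteq> {}"
    and Ks: "\<Union>Ks = avoid E f3" "pairwise (\<lambda>H K. \<Union>H \<inter> \<Union>K = {}) Ks" and K: "K \<in> Ks" "e \<in> K"
  shows "f \<in> K"
proof -
  have step: "x \<in> K" if "w \<in> K" "x \<in> avoid E f3" "w \<inter> x \<noteq> {}" for w x
    using pieces_eq[OF Ks(2) K(1) _ that(1) _ that(3)] that(2) unfolding Ks(1)[symmetric] by blast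
  have HE: "h \<in> avoid E f3" if "h \<in> H" for h
    using that f3(3) H(2) by (auto simp: avoid_def)
  obtain s where s: "s \<in> g" "s \<in> e" using g(2) by blast
  obtain h t where h: "h \<in> H" "t \<in> h" "t \<in> g" using g(3) by blast
  have "h \<inter> e = {}" using h H(2) by (auto simp: avoid_def)
  then have "s \<noteq> t" using s h by blast
  moreover have "card g = 2" using E g(1) by (simp add: two_uniform_def)
  ultimately have "g = {s, t}" using s h by (auto simp: card_2_iff)
  moreover have "s \<notin> f3" "t \<notin> f3" using s h f3 by blast+
  ultimately have "g \<in> avoid E f3" using g(1) by (simp add: avoid_def)
  then have "g \<in> K" using step[OF K(2), of g] g(2) by blast
  then have hK: "h \<in> K" using step[of g h] HE h by blast
  obtain h' where h': "h' \<in> H" "h \<inter> h' \<noteq> {}" "h' \<inter> f \<noteq> {}"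
    using piece_line_diameter[OF H(1) h(1) f] by blast
  show ?thesis using step[OF step[OF hK HE[OF h'(1)] h'(2)] HE[OF f] h'(3)] .
qed

lemma locally_spherical_Suc_nonempty: "locally_spherical (Suc n) E \<Longrightarrow> E \<noteq> {}"
  by (cases n) (auto simp: is_P3_def)

lemma locally_spherical_avoid: "locally_spherical (Suc n) E \<Longrightarrow> n \<noteq> 0 \<Longrightarrow> e \<in> E \<Longrightarrow> locally_spherical n (avoid E e)"
  by (cases n) auto

text \<open>The remaining edges are obtained by deleting the ends of a maximal matching of \<open>H\<close>, which
  consists of one edge for \<open>P\<^sub>3\<close> and of two edges for \<open>C\<^sub>5\<close> and \<open>K\<^sub>3\<^sub>,\<^sub>2\<close>.  So the induction hypothesis
  applies to them.\<close>
lemma split_off_standard_union: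
  fixes E :: "'a set set"
  assumes E: "two_uniform E" and n: "locally_spherical (Suc (Suc (Suc n))) E"
    and IH: "\<And>m (F :: 'a set set). m < Suc (Suc (Suc n)) \<Longrightarrow> two_uniform F \<Longrightarrow> locally_spherical m F \<Longrightarrow> standard_union m F"
    and H: "piece H" "H \<subseteq> E" "\<And>g. g \<in> E - H \<Longrightarrow> g \<inter> \<Union>H = {}"
  shows "standard_union (Suc (Suc (Suc n))) E"
proof -
  have av: "avoid E X = E - H" if "X \<subseteq> \<Union>H" "\<And>h. h \<in> H \<Longrightarrow> h \<inter> X \<noteq> {}" for X
  proof (intro equalityI subsetI)
    fix g assume "g \<in> avoid E X" then show "g \<in> E - H" using that(2) by (auto simp: avoid_def)
  next
    fix g assume "g \<in> E - H"
    then show "g \<in> avoid E X" using H(3)[of g] that(1) by (auto simp: avoid_def)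
  qed
  have D: "\<Union>H \<inter> \<Union>(E - H) = {}" using H(3) by blast
  have EH: "H \<union> (E - H) = E" using H(2) by blast
  have U: "two_uniform (E - H)" using E by (simp add: two_uniform_def)
  have two: "locally_spherical (Suc n) (E - H)" if "f \<in> H" "g \<in> H" "f \<inter> g = {}" "\<And>h. h \<in> H \<Longrightarrow> h \<inter> (f \<union> g) \<noteq> {}" for f g
  proof -
    have "locally_spherical (Suc (Suc n)) (avoid E f)" using locally_spherical_avoid[OF n] that H(2) by blast
    moreover have "g \<in> avoid E f" using that H(2) by (auto simp: avoid_def)
    ultimately have "locally_spherical (Suc n) (avoid (avoid E f) g)" using locally_spherical_avoid by blast
    moreover have "avoid E (f \<union> g) = E - H" using that by (intro av) auto
    ultimately show ?thesis by (simp add: avoid_avoid)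
  qed
  from H(1) show ?thesis
    unfolding piece_def
  proof (elim disjE)
    assume P: "is_P3 H"
    then obtain x y z where x: "H = {{x, y}, {x, z}}" unfolding is_P3_def by metis
    have "avoid E {x, y} = E - H" by (rule av) (auto simp: x)
    moreover have "locally_spherical (Suc (Suc n)) (avoid E {x, y})" using locally_spherical_avoid[OF n] H(2) x by simp
    ultimately have "standard_union (Suc (Suc n)) (E - H)" using IH[OF _ U] by (simp del: locally_spherical.simps)
    from standard_union_P3[OF P this D] show ?thesis unfolding EH by simp
  next
    assume C: "is_C5 H"
    then obtain a b c d k where x: "distinct [a, b, c, d, k]" "H = {{a, b}, {b, c}, {c, d}, {d, k}, {k, a}}"
      unfolding is_C5_def by metis
    have "locally_spherical (Suc n) (E - H)" by (rule two[of "{a, b}" "{c, d}"]) (use x in auto)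
    then have "standard_union (Suc n) (E - H)" using IH[OF _ U] by (simp del: locally_spherical.simps)
    from standard_union_C5[OF C this D] show ?thesis unfolding EH by simp
  next
    assume C: "is_K32 H"
    then obtain a b c p q where x: "distinct [a, b, c, p, q]"
      "H = {{a, p}, {b, p}, {c, p}, {a, q}, {b, q}, {c, q}}"
      unfolding is_K32_def by metis
    have "locally_spherical (Suc n) (E - H)" by (rule two[of "{a, p}" "{b, q}"]) (use x in auto)
    then have "standard_union (Suc n) (E - H)" using IH[OF _ U] by (simp del: locally_spherical.simps)
    from standard_union_K32[OF C this D] show ?thesis unfolding EH by simp
  qed
qed

lemma locally_spherical_3_imp_standard_union:
  assumes E: "two_uniform E" "locally_spherical 3 E"
  shows "standard_union 3 E"
proof -
  obtain e where e: "e \<in> E" using E(2) by (auto simp: eval_nat_numeral)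
  then obtain u v where uv: "e = {u, v}" using E(1) by (auto simp: two_uniform_def card_2_iff)
  have "locally_spherical 2 (avoid E e)" using E(2) e by (simp add: eval_nat_numeral)
  from locally_spherical_2_cases[OF two_uniform_avoid[OF E(1)] this] show ?thesis
  proof (elim disjE exE conjE)
    assume "is_C5 (avoid E e)"
    then obtain a b c d k where "distinct [a, b, c, d, k]"
      "avoid E e = {{a, b}, {b, c}, {c, d}, {d, k}, {k, a}}" unfolding is_C5_def by metis
    then show ?thesis using surface_C5[OF E, of u v] e unfolding uv by metis
  next
    assume "is_K32 (avoid E e)"
    then obtain a b c p q where "distinct [a, b, c, p, q]"
      "avoid E e = {{a, p}, {b, p}, {c, p}, {a, q}, {b, q}, {c, q}}" unfolding is_K32_def by metis
    then show ?thesis using surface_K32[OF E, of u v] e unfolding uv by metis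
  next
    fix x y z x' y' z'
    assume "distinct [x, y, z, x', y', z']" "avoid E e = {{x, y}, {x, z}, {x', y'}, {x', z'}}"
    then show ?thesis using surface_2P3[OF E, of u v] e unfolding uv by metis
  qed
qed

text \<open>The set of edges disjoint from \<open>e\<close> contains three disjoint edges.  They do not all lie in one
  component, so one of them can be removed without touching the components of the other two.  If
  both of these were joined to \<open>e\<close>, \<open>connected_through\<close> would put \<open>e\<close> and the two edges into one
  component.\<close>
lemma locally_spherical_4_imp_standard_union:
  fixes E :: "'a set set"
  assumes E: "two_uniform E" and n: "locally_spherical (Suc (Suc (Suc (Suc n)))) E"
    and IH: "\<And>m (F :: 'a set set). m < Suc (Suc (Suc (Suc n))) \<Longrightarrow> two_uniform F \<Longrightarrow> locally_spherical m F \<Longrightarrow> standard_union m F"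
  shows "standard_union (Suc (Suc (Suc (Suc n)))) E"
proof -
  have pcs: "\<exists>Hs. \<Union>Hs = avoid E f \<and> (\<forall>H\<in>Hs. piece H) \<and> pairwise (\<lambda>H K. \<Union>H \<inter> \<Union>K = {}) Hs"
    if "f \<in> E" for f
  proof -
    have "locally_spherical (Suc (Suc (Suc n))) (avoid E f)" by (rule locally_spherical_avoid[OF n _ that]) simp
    then have "standard_union (Suc (Suc (Suc n))) (avoid E f)"
      using IH[OF _ two_uniform_avoid[OF E]] by (simp del: locally_spherical.simps)
    then show ?thesis by (rule standard_union_pieces)
  qed
  obtain e where e: "e \<in> E" using locally_spherical_Suc_nonempty[OF n] by blast
  let ?F = "avoid E e"
  from pcs[OF e] obtain Hs where Hs: "\<Union>Hs = ?F" "\<forall>H\<in>Hs. piece H"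
    "pairwise (\<lambda>H K. \<Union>H \<inter> \<Union>K = {}) Hs" by (elim exE conjE)
  have gF: "locally_spherical (Suc (Suc (Suc n))) ?F" by (rule locally_spherical_avoid[OF n _ e]) simp
  obtain f1 where f1: "f1 \<in> ?F" using locally_spherical_Suc_nonempty[OF gF] by blast
  have g1: "locally_spherical (Suc (Suc n)) (avoid ?F f1)" by (rule locally_spherical_avoid[OF gF _ f1]) simp
  obtain f2 where f2: "f2 \<in> avoid ?F f1" using locally_spherical_Suc_nonempty[OF g1] by blast
  have g2: "locally_spherical (Suc n) (avoid (avoid ?F f1) f2)" by (rule locally_spherical_avoid[OF g1 _ f2]) simp
  obtain f3 where f3: "f3 \<in> avoid (avoid ?F f1) f2" using locally_spherical_Suc_nonempty[OF g2] by blast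
  have F: "f1 \<in> ?F" "f2 \<in> ?F" "f3 \<in> ?F" and dj: "f1 \<inter> f2 = {}" "f1 \<inter> f3 = {}" "f2 \<inter> f3 = {}"
    using f1 f2 f3 by (auto simp: avoid_def)
  have "\<exists>H\<in>Hs. \<forall>g\<in>E. g \<inter> e \<noteq> {} \<longrightarrow> g \<inter> \<Union>H = {}"
  proof (rule ccontr)
    assume n: "\<not> ?thesis"
    have adj: "\<exists>g\<in>E. g \<inter> e \<noteq> {} \<and> g \<inter> \<Union>H \<noteq> {}" if "H \<in> Hs" for H
    proof (rule ccontr)
      assume "\<not> ?thesis"
      then have "\<forall>g\<in>E. g \<inter> e \<noteq> {} \<longrightarrow> g \<inter> \<Union>H = {}" by meson
      from bexI[of "\<lambda>H. \<forall>g\<in>E. g \<inter> e \<noteq> {} \<longrightarrow> g \<inter> \<Union>H = {}", OF this that] n show False by (rule notE[rotated])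
    qed
    \<comment> \<open>Delete the ends of \<open>w\<close>: the components of \<open>x\<close> and \<open>y\<close> stay intact.\<close>
    have core: False
      if "x \<in> ?F" "y \<in> ?F" "w \<in> ?F" "x \<inter> y = {}" "H1 \<in> Hs" "H2 \<in> Hs" "H3 \<in> Hs"
        "x \<in> H1" "y \<in> H2" "w \<in> H3" "H1 \<noteq> H3" "H2 \<noteq> H3" for x y w H1 H2 H3
    proof -
      have w: "w \<in> E" "w \<inter> e = {}" using \<open>w \<in> ?F\<close> by (auto simp: avoid_def)
      from pcs[OF w(1)] obtain Ks where Ks: "\<Union>Ks = avoid E w" "\<forall>H\<in>Ks. piece H"
        "pairwise (\<lambda>H K. \<Union>H \<inter> \<Union>K = {}) Ks" by (elim exE conjE)
      have "e \<in> avoid E w" using e w by (auto simp: avoid_def)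
      then obtain K where K: "K \<in> Ks" "e \<in> K" using Ks(1) by blast
      have in_K: "f \<in> K" if "f \<in> H" "H \<in> Hs" "H \<noteq> H3" for f H
      proof -
        from adj[OF \<open>H \<in> Hs\<close>] obtain g where g: "g \<in> E" "g \<inter> e \<noteq> {}" "g \<inter> \<Union>H \<noteq> {}"
          by (elim bexE conjE)
        have "\<Union>H3 \<inter> \<Union>H = {}" using pairwiseD[OF Hs(3) \<open>H3 \<in> Hs\<close> \<open>H \<in> Hs\<close>] that(3) by simp
        then have "w \<inter> \<Union>H = {}" using \<open>w \<in> H3\<close> by blast
        moreover have "H \<subseteq> ?F" using Hs(1) that(2) by blast
        ultimately show ?thesis
          using connected_through[OF E e w _ bspec[OF Hs(2) that(2)] _ that(1) g Ks(1,3) K] by simp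
      qed
      have "x \<in> K" by (rule in_K[OF \<open>x \<in> H1\<close> \<open>H1 \<in> Hs\<close> \<open>H1 \<noteq> H3\<close>])
      moreover have "y \<in> K" by (rule in_K[OF \<open>y \<in> H2\<close> \<open>H2 \<in> Hs\<close> \<open>H2 \<noteq> H3\<close>])
      moreover have "two_uniform K" using two_uniform_avoid[OF E] K(1) Ks(1) by (auto simp: two_uniform_def)
      moreover have "e \<inter> x = {}" "e \<inter> y = {}" using that(1,2) by (auto simp: avoid_def)
      ultimately show False using piece_no_3_matching[OF bspec[OF Ks(2) K(1)] _ K(2), of x y] that(4) by simp
    qed
    obtain H1 where H1: "H1 \<in> Hs" "f1 \<in> H1" using F(1) unfolding Hs(1)[symmetric] by (rule UnionE)
    obtain H2 where H2: "H2 \<in> Hs" "f2 \<in> H2" using F(2) unfolding Hs(1)[symmetric] by (rule UnionE)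
    obtain H3 where H3: "H3 \<in> Hs" "f3 \<in> H3" using F(3) unfolding Hs(1)[symmetric] by (rule UnionE)
    note H = H1 H2 H3
    have "two_uniform H1" using two_uniform_avoid[OF E] H(1) Hs(1) by (auto simp: two_uniform_def)
    then have "\<not> (H1 = H2 \<and> H1 = H3)"
      using piece_no_3_matching[OF bspec[OF Hs(2) H(1)], of f1 f2 f3] H dj by auto
    then consider "H1 \<noteq> H3" "H2 \<noteq> H3" | "H1 = H3" "H2 \<noteq> H3" | "H2 = H3" "H1 \<noteq> H3" by blast
    then show False
    proof cases
      case 1
      show False by (rule core[OF F(1,2,3) dj(1) H(1,3,5,2,4,6) 1])
    next
      case 2
      show False by (rule core[OF F(1,3,2) dj(2) H(1,5,3,2,6,4)]) (use 2 in simp_all)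
    next
      case 3
      show False by (rule core[OF F(2,3,1) dj(3) H(3,5,1,4,6,2)]) (use 3 in simp_all)
    qed
  qed
  then obtain H where H: "H \<in> Hs" "\<forall>g\<in>E. g \<inter> e \<noteq> {} \<longrightarrow> g \<inter> \<Union>H = {}" by (elim bexE)
  have HF: "H \<subseteq> ?F" using H(1) Hs(1) by blast
  show ?thesis
  proof (rule split_off_standard_union[OF E n IH bspec[OF Hs(2) H(1)]])
    show "H \<subseteq> E" using HF by (auto simp: avoid_def)
    fix g assume g: "g \<in> E - H"
    show "g \<inter> \<Union>H = {}"
    proof (cases "g \<inter> e = {}")
      case True
      then have "g \<in> \<Union>Hs" using g unfolding Hs(1) by (simp add: avoid_def)
      then obtain K where K: "K \<in> Hs" "g \<in> K" by blast
      then have "K \<noteq> H" using g by blast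
      then have "\<Union>K \<inter> \<Union>H = {}" by (rule pairwiseD[OF Hs(3) K(1) H(1)])
      then show ?thesis using K(2) by blast
    next
      case False
      then show ?thesis using H(2) g by simp
    qed
  qed
qed

theorem locally_spherical_imp_standard_union:
  fixes E :: "'a set set"
  assumes "two_uniform E" "locally_spherical n E"
  shows "standard_union n E"
  using assms
proof (induction n arbitrary: E rule: less_induct)
  case (less n)
  consider "n = 0" | "n = 1" | "n = 2" | "n = 3" | m where "n = Suc (Suc (Suc (Suc m)))"
    by (metis One_nat_def numeral_2_eq_2 numeral_3_eq_3 not0_implies_Suc)
  then show ?case
  proof cases
    case 1 then show ?thesis using less.prems standard_union_empty by simp
  next
    case 2 then show ?thesis using less.prems standard_union_P3_alone by simp
  next
    case 3 then show ?thesis using less.prems locally_spherical_2_imp_standard_union by simp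
  next
    case 4 then show ?thesis using less.prems locally_spherical_3_imp_standard_union by simp
  next
    case 5
    show ?thesis
      unfolding 5
    proof (rule locally_spherical_4_imp_standard_union[OF less.prems(1) less.prems(2)[unfolded 5]])
      show "standard_union k F" if "k < Suc (Suc (Suc (Suc m)))" "two_uniform F" "locally_spherical k F" for k and F :: "'a set set"
        by (rule less.IH[OF _ that(2,3)]) (use that 5 in simp)
    qed
  qed
qed

section \<open>Matching complexes and their reduced homology\<close>

definition matchings :: "'a set set \<Rightarrow> 'a set set set"
  where "matchings E = {M. M \<subseteq> E \<and> pairwise disjnt M}"

lemma matching_complex_eq: "matching_complex G = matchings (graph_edges G)"
  by (simp add: matching_complex_def matchings_def is_matching_def)

lemma pairwise_disjnt_insert:
  "pairwise disjnt (insert e M) \<longleftrightarrow> (\<forall>f\<in>M. f \<noteq> e \<longrightarrow> f \<inter> e = {}) \<and> pairwise disjnt M"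
  by (auto simp: pairwise_insert disjnt_def)

lemma matchings_subset: "M \<in> matchings E \<Longrightarrow> N \<subseteq> M \<Longrightarrow> N \<in> matchings E"
  unfolding matchings_def by (auto intro: pairwise_subset)

lemma abstract_complex_matchings:
  fixes E :: "'a::finite set set"
  shows "abstract_complex (matchings E)"
  by (auto simp: abstract_complex_def intro: matchings_subset) (simp add: matchings_def)

lemma Union_matchings [simp]: "\<Union>(matchings E) = E"
proof
  show "E \<subseteq> \<Union>(matchings E)"
  proof
    fix e assume "e \<in> E"
    then have "{e} \<in> matchings E" by (simp add: matchings_def)
    then show "e \<in> \<Union>(matchings E)" by blast
  qed
qed (auto simp: matchings_def)

lemma insert_matchings:
  assumes "e \<in> E" "e \<noteq> {}"
  shows "insert e M \<in> matchings E \<and> e \<notin> M \<longleftrightarrow> M \<in> matchings (avoid E e)"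
proof -
  have "e \<notin> M" if "M \<subseteq> avoid E e" using that assms(2) by (auto simp: avoid_def)
  then show ?thesis
    using assms unfolding matchings_def mem_Collect_eq pairwise_disjnt_insert
    by (auto simp: avoid_def)
qed

lemma face_link_matchings:
  assumes E: "two_uniform E" and \<sigma>: "\<sigma> \<in> matchings E"
  shows "face_link (matchings E) \<sigma> = matchings (avoid E (\<Union>\<sigma>))"
proof -
  have ne: "f \<noteq> {}" if "f \<in> E" for f using E that by (auto simp: two_uniform_def)
  have "\<tau> \<in> matchings E \<and> \<tau> \<union> \<sigma> \<in> matchings E \<and> \<tau> \<inter> \<sigma> = {} \<longleftrightarrow> \<tau> \<in> matchings (avoid E (\<Union>\<sigma>))" for \<tau>
  proof
    assume *: "\<tau> \<in> matchings E \<and> \<tau> \<union> \<sigma> \<in> matchings E \<and> \<tau> \<inter> \<sigma> = {}"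
    have "f \<inter> g = {}" if "f \<in> \<tau>" "g \<in> \<sigma>" for f g
    proof -
      have "pairwise disjnt (\<tau> \<union> \<sigma>)" using * by (simp add: matchings_def)
      moreover have "f \<noteq> g" using * that by blast
      ultimately have "disjnt f g" using that by (intro pairwiseD[of disjnt "\<tau> \<union> \<sigma>"]) auto
      then show ?thesis by (simp add: disjnt_def)
    qed
    then have "f \<inter> \<Union>\<sigma> = {}" if "f \<in> \<tau>" for f using that by blast
    then show "\<tau> \<in> matchings (avoid E (\<Union>\<sigma>))"
      using * unfolding matchings_def avoid_def by auto
  next
    assume *: "\<tau> \<in> matchings (avoid E (\<Union>\<sigma>))"
    then have t: "\<tau> \<subseteq> E" "pairwise disjnt \<tau>" and d: "\<And>f g. f \<in> \<tau> \<Longrightarrow> g \<in> \<sigma> \<Longrightarrow> f \<inter> g = {}"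
      unfolding matchings_def avoid_def by (auto 0 3)
    have s: "\<sigma> \<subseteq> E" "pairwise disjnt \<sigma>" using \<sigma> by (auto simp: matchings_def)
    have "\<tau> \<inter> \<sigma> = {}"
    proof (rule ccontr)
      assume "\<tau> \<inter> \<sigma> \<noteq> {}"
      then obtain f where f: "f \<in> \<tau>" "f \<in> \<sigma>" by blast
      then have "f = {}" using d[of f f] by simp
      moreover have "f \<noteq> {}" using f t(1) ne by blast
      ultimately show False by simp
    qed
    moreover have "pairwise disjnt (\<tau> \<union> \<sigma>)"
    proof (rule pairwiseI)
      fix f g assume *: "f \<in> \<tau> \<union> \<sigma>" "g \<in> \<tau> \<union> \<sigma>" "f \<noteq> g"
      show "disjnt f g"
        using * pairwiseD[OF t(2), of f g] pairwiseD[OF s(2), of f g] d[of f g] d[of g f]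
        by (auto simp: disjnt_def)
    qed
    ultimately show "\<tau> \<in> matchings E \<and> \<tau> \<union> \<sigma> \<in> matchings E \<and> \<tau> \<inter> \<sigma> = {}"
      using t s unfolding matchings_def by simp
  qed
  then show ?thesis unfolding face_link_def by blast
qed

interpretation chains: vector_space chain_scale
  by (rule vector_space_chain_scale)

lemma chainsD:
  assumes "c \<in> oriented_chains \<Delta> p" "c xs \<noteq> 0"
  shows "distinct xs" "set xs \<in> \<Delta>" "int (length xs) = p + 1"
  using assms unfolding oriented_chains_def by blast+

lemma chains_swap:
  assumes "c \<in> oriented_chains \<Delta> p"
  shows "c (u # v # xs) = - c (v # u # xs)" "c (w # u # v # xs) = - c (w # v # u # xs)"
proof -
  have "c (ys @ u # v # xs) = - c (ys @ v # u # xs)" for ys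
    using assms unfolding oriented_chains_def by blast
  from this[of "[]"] this[of "[w]"]
  show "c (u # v # xs) = - c (v # u # xs)" "c (w # u # v # xs) = - c (w # v # u # xs)" by simp_all
qed

lemma dim_zero_chain: "chains.dim {(\<lambda>_. 0) :: 'v list \<Rightarrow> 'k::field} = 0"
proof -
  have "chains.span {} = chains.span {0 :: 'v list \<Rightarrow> 'k}"
    using chains.span_insert_0[of "{}"] by metis
  from chains.dim_eq_card[OF this chains.independent_empty] show ?thesis by (simp add: zero_fun_def)
qed

lemma zero_in_oriented_chains: "(\<lambda>_. 0) \<in> oriented_chains \<Delta> p"
  by (simp add: oriented_chains_def)

lemma oriented_boundary_zero: "oriented_boundary \<Delta> (\<lambda>_. 0) = (\<lambda>_. 0)"
  by (simp add: oriented_boundary_def)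

text \<open>The empty face is the boundary of the vertex \<open>e\<close>.\<close>
lemma reduced_betti_minus_one:
  fixes E :: "'a::finite set set"
  assumes "e \<in> E"
  shows "reduced_betti TYPE('k::field) (matchings E) (-1) = 0"
proof -
  have "(reduced_cycles (matchings E) (-1) :: ('a set list \<Rightarrow> 'k) set) \<subseteq> reduced_boundaries (matchings E) (-1)"
  proof
    fix c :: "'a set list \<Rightarrow> 'k" assume "c \<in> reduced_cycles (matchings E) (-1)"
    then have c: "c \<in> oriented_chains (matchings E) (-1)" by (simp add: reduced_cycles_def)
    have c0: "c xs = 0" if "xs \<noteq> []" for xs using chainsD(3)[OF c, of xs] that by auto
    define b where "b = (\<lambda>xs. if xs = [e] then c [] else 0)"
    have "b \<in> oriented_chains (matchings E) 0"
      using assms by (auto simp: oriented_chains_def b_def matchings_def Cons_eq_append_conv append_eq_Cons_conv)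
    moreover have "oriented_boundary (matchings E) b = c"
    proof
      fix xs show "oriented_boundary (matchings E) b xs = c xs"
      proof (cases xs)
        case Nil
        then show ?thesis using assms by (simp add: oriented_boundary_def b_def)
      next
        case (Cons x ys)
        then show ?thesis using c0[of xs] by (simp add: oriented_boundary_def b_def)
      qed
    qed
    ultimately show "c \<in> reduced_boundaries (matchings E) (-1)"
      unfolding reduced_boundaries_def by force
  qed
  then have "(reduced_cycles (matchings E) (-1) :: ('a set list \<Rightarrow> 'k) set) = reduced_boundaries (matchings E) (-1)"
    using reduced_boundaries_subset_cycles[OF abstract_complex_matchings] by blast
  then show ?thesis by (simp add: reduced_betti_def)
qed

lemma oriented_chains_high_dim:
  assumes "\<And>\<sigma>. \<sigma> \<in> \<Delta> \<Longrightarrow> int (card \<sigma>) \<le> p"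
  shows "oriented_chains \<Delta> p = {\<lambda>_. 0}"
proof -
  have "c = (\<lambda>_. 0)" if c: "c \<in> oriented_chains \<Delta> p" for c
  proof
    fix xs show "c xs = 0"
      using chainsD[OF c, of xs] assms[of "set xs"] distinct_card[of xs] by force
  qed
  then show ?thesis using zero_in_oriented_chains by blast
qed

lemma reduced_betti_high_dim:
  fixes \<Delta> :: "'v set set"
  assumes "\<And>\<sigma>. \<sigma> \<in> \<Delta> \<Longrightarrow> int (card \<sigma>) \<le> p"
  shows "reduced_betti TYPE('k::field) \<Delta> p = 0"
proof -
  have "reduced_cycles \<Delta> p = {(\<lambda>_. 0) :: 'v list \<Rightarrow> 'k}"
  proof -
    have ch: "oriented_chains \<Delta> p = {(\<lambda>_. 0) :: 'v list \<Rightarrow> 'k}"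
      by (rule oriented_chains_high_dim) (rule assms)
    have "reduced_cycles \<Delta> p \<subseteq> {(\<lambda>_. 0) :: 'v list \<Rightarrow> 'k}"
      unfolding ch[symmetric] by (simp add: reduced_cycles_def)
    moreover have "((\<lambda>_. 0) :: 'v list \<Rightarrow> 'k) \<in> reduced_cycles \<Delta> p"
      by (simp add: reduced_cycles_def zero_in_oriented_chains oriented_boundary_zero)
    ultimately show ?thesis by blast
  qed
  then show ?thesis unfolding reduced_betti_def by (simp add: dim_zero_chain)
qed

text \<open>The reduced cycles of a discrete set are the coefficient vectors of sum zero.  They form a line
  only for two points: with a third point \<open>h\<close>, the differences \<open>f - g\<close> and \<open>f - h\<close> are not
  proportional.\<close>
lemma reduced_betti_zero_two_points:
  fixes E :: "'a::finite set set"
  assumes disc: "\<And>f g. f \<in> E \<Longrightarrow> g \<in> E \<Longrightarrow> f \<inter> g \<noteq> {}"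
    and betti: "reduced_betti TYPE('k::field) (matchings E) 0 = 1"
  shows "\<exists>f g. f \<noteq> g \<and> E = {f, g}"
proof -
  let ?\<Delta> = "matchings E"
  let ?Z = "reduced_cycles ?\<Delta> 0 :: ('a set list \<Rightarrow> 'k) set"
  have card: "card \<sigma> \<le> 1" if "\<sigma> \<in> ?\<Delta>" for \<sigma>
  proof -
    have "f = g" if "f \<in> \<sigma>" "g \<in> \<sigma>" for f g
      using that disc[of f g] \<open>\<sigma> \<in> ?\<Delta>\<close> unfolding matchings_def pairwise_def disjnt_def by blast
    then show ?thesis by (simp add: card_le_Suc0_iff_eq)
  qed
  have "oriented_chains ?\<Delta> (0 + 1) = {(\<lambda>_. 0) :: 'a set list \<Rightarrow> 'k}"
    by (rule oriented_chains_high_dim) (use card in force)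
  then have "reduced_boundaries ?\<Delta> 0 = {(\<lambda>_. 0) :: 'a set list \<Rightarrow> 'k}"
    unfolding reduced_boundaries_def by (simp add: oriented_boundary_zero)
  then have dimZ: "chains.dim ?Z = 1"
    using betti by (simp add: reduced_betti_def dim_zero_chain)
  obtain B where B: "B \<subseteq> ?Z" "?Z \<subseteq> chains.span B" "card B = 1"
    using chains.basis_exists[of ?Z] dimZ by metis
  then obtain z where z: "B = {z}" using card_1_singletonE by blast
  have mult: "\<exists>\<alpha>. c = chain_scale \<alpha> z" if "c \<in> ?Z" for c
    using B(2) that unfolding z chains.span_singleton by blast
  have pt: "(\<lambda>xs. if xs = [f] then 1 else if xs = [g] then - 1 else 0) \<in> ?Z"
    if "f \<in> E" "g \<in> E" "f \<noteq> g" for f g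
  proof -
    have "(\<Sum>v\<in>E. (if v # xs = [f] then 1 else if v # xs = [g] then - 1 else 0)) = (0 :: 'k)" for xs
    proof (cases xs)
      case Nil
      have "(\<Sum>v\<in>E. (if v = f then 1 else if v = g then - 1 else 0)) =
        (\<Sum>v\<in>E. if v = f then 1 else 0) + (\<Sum>v\<in>E. if v = g then - 1 else (0 :: 'k))"
        unfolding sum.distrib[symmetric] by (rule sum.cong) (use that in auto)
      also have "\<dots> = 0" using that by simp
      finally have "(\<Sum>v\<in>E. (if v = f then 1 else if v = g then - 1 else 0)) = (0 :: 'k)" .
      moreover have "(\<Sum>v\<in>E. (if v # xs = [f] then 1 else if v # xs = [g] then - 1 else 0)) =
        (\<Sum>v\<in>E. (if v = f then 1 else if v = g then - 1 else (0 :: 'k)))"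
        by (rule sum.cong) (auto simp: Nil)
      ultimately show ?thesis by simp
    qed simp
    then have "oriented_boundary ?\<Delta> (\<lambda>xs. if xs = [f] then 1 else if xs = [g] then - 1 else 0 :: 'k) = (\<lambda>_. 0)"
      unfolding oriented_boundary_def Union_matchings by blast
    moreover have "(\<lambda>xs. if xs = [f] then 1 else if xs = [g] then - 1 else 0 :: 'k) \<in> oriented_chains ?\<Delta> 0"
      using that unfolding oriented_chains_def
      by (auto simp: matchings_def Cons_eq_append_conv append_eq_Cons_conv)
    ultimately show ?thesis unfolding reduced_cycles_def by simp
  qed
  have "E \<noteq> {}"
  proof
    assume "E = {}"
    then have "int (card \<sigma>) \<le> 0" if "\<sigma> \<in> ?\<Delta>" for \<sigma> using that by (auto simp: matchings_def)
    then have "reduced_betti TYPE('k) ?\<Delta> 0 = 0" by (rule reduced_betti_high_dim)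
    then show False using betti by simp
  qed
  then obtain f where f: "f \<in> E" by blast
  have "E \<noteq> {f}"
  proof
    assume E: "E = {f}"
    have "c = (\<lambda>_. 0)" if "c \<in> ?Z" for c
    proof
      fix xs
      have c: "c \<in> oriented_chains ?\<Delta> 0" and "oriented_boundary ?\<Delta> c [] = 0"
        using that by (auto simp: reduced_cycles_def)
      then have f0: "c [f] = 0" using E by (simp add: oriented_boundary_def)
      show "c xs = 0"
      proof (rule ccontr)
        assume n: "c xs \<noteq> 0"
        then have "length xs = 1" using chainsD(3)[OF c, of xs] by simp
        then obtain y where y: "xs = [y]" by (cases xs) auto
        then have "y \<in> E" using chainsD(2)[OF c n] by (simp add: matchings_def)
        then show False using n f0 y E by simp
      qed
    qed
    then have "?Z \<subseteq> {\<lambda>_. 0}" by blast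
    moreover have "(\<lambda>_. 0) \<in> ?Z"
      by (simp add: reduced_cycles_def zero_in_oriented_chains oriented_boundary_zero)
    ultimately have "?Z = {\<lambda>_. 0}" by blast
    then show False using dimZ dim_zero_chain by (metis zero_neq_one)
  qed
  then obtain g where g: "g \<in> E" "g \<noteq> f" using f by blast
  have "h = f \<or> h = g" if h: "h \<in> E" for h
  proof (rule ccontr)
    assume ne: "\<not> (h = f \<or> h = g)"
    obtain \<alpha> where a: "(\<lambda>xs. if xs = [f] then 1 else if xs = [g] then - 1 else 0) = chain_scale \<alpha> z"
      using mult[OF pt[of f g]] f g by metis
    obtain \<beta> where b: "(\<lambda>xs. if xs = [f] then 1 else if xs = [h] then - 1 else 0) = chain_scale \<beta> z"
      using mult[OF pt[of f h]] f h ne by metis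
    have "\<alpha> * z [f] = 1" "\<alpha> * z [h] = 0"
      using fun_cong[OF a, of "[f]"] fun_cong[OF a, of "[h]"] ne g by (simp_all add: chain_scale_def)
    then have "z [h] = 0" by auto
    then show False using fun_cong[OF b, of "[h]"] ne by (simp add: chain_scale_def)
  qed
  then have "E = {f, g}" using f g by blast
  then show ?thesis using g by blast
qed

lemma finite_distinct_lists: "finite {xs :: 'v::finite list. distinct xs}"
  using finite_subset_distinct[of "UNIV :: 'v set"] by simp

lemma sum_chain_apply: "(\<Sum>i\<in>I. (f i :: 'v list \<Rightarrow> 'k::field)) xs = (\<Sum>i\<in>I. f i xs)"
  by (induction I rule: infinite_finite_induct) auto

lemma oriented_chains_finite_dim:
  fixes \<Delta> :: "'v::finite set set"
  shows "(oriented_chains \<Delta> p :: ('v list \<Rightarrow> 'k::field) set) \<subseteq>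
    chains.span ((\<lambda>xs ys. if ys = xs then 1 else 0) ` {xs. distinct xs})"
proof
  fix c :: "'v list \<Rightarrow> 'k" assume c: "c \<in> oriented_chains \<Delta> p"
  let ?\<delta> = "\<lambda>xs ys :: 'v list. if ys = xs then 1 else (0 :: 'k)"
  have "c = (\<Sum>xs\<in>{xs. distinct xs}. chain_scale (c xs) (?\<delta> xs))"
  proof
    fix ys
    have "c ys = (\<Sum>xs\<in>{xs. distinct xs}. if xs = ys then c xs else 0)"
      unfolding sum.delta[OF finite_distinct_lists] using chainsD(1)[OF c, of ys] by auto
    also have "\<dots> = (\<Sum>xs\<in>{xs. distinct xs}. chain_scale (c xs) (?\<delta> xs) ys)"
      by (rule sum.cong) (auto simp: chain_scale_def)
    finally show "c ys = (\<Sum>xs\<in>{xs. distinct xs}. chain_scale (c xs) (?\<delta> xs)) ys"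
      by (simp add: sum_chain_apply)
  qed
  moreover have "(\<Sum>xs\<in>{xs. distinct xs}. chain_scale (c xs) (?\<delta> xs)) \<in> chains.span (?\<delta> ` {xs. distinct xs})"
    by (intro chains.span_sum chains.span_scale chains.span_base) blast
  ultimately show "c \<in> chains.span (?\<delta> ` {xs. distinct xs})" by simp
qed

text \<open>The Betti number is a difference of dimensions, so its vanishing gives equality of the spans only
  because the space of chains has a finite basis.\<close>
lemma cycles_span_boundaries:
  fixes \<Delta> :: "'v::finite set set"
  assumes \<Delta>: "abstract_complex \<Delta>" and betti: "reduced_betti TYPE('k::field) \<Delta> p = 0"
  shows "(reduced_cycles \<Delta> p :: ('v list \<Rightarrow> 'k) set) \<subseteq> chains.span (reduced_boundaries \<Delta> p)"
proof -
  let ?Z = "reduced_cycles \<Delta> p :: ('v list \<Rightarrow> 'k) set"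
  let ?B = "reduced_boundaries \<Delta> p :: ('v list \<Rightarrow> 'k) set"
  let ?S = "(\<lambda>xs ys :: 'v list. if ys = xs then 1 else (0 :: 'k)) ` {xs. distinct xs}"
  have fin: "finite ?S" using finite_distinct_lists by (rule finite_imageI)
  have Z: "?Z \<subseteq> chains.span ?S"
    using oriented_chains_finite_dim[of \<Delta> p] by (auto simp: reduced_cycles_def)
  obtain b where b: "b \<subseteq> ?B" "chains.independent b" "?B \<subseteq> chains.span b" "card b = chains.dim ?B"
    by (rule chains.basis_exists)
  have "b \<subseteq> ?Z" using b(1) reduced_boundaries_subset_cycles[OF \<Delta>] by blast
  then obtain b' where b': "b \<subseteq> b'" "b' \<subseteq> ?Z" "chains.independent b'" "?Z \<subseteq> chains.span b'"
    using chains.maximal_independent_subset_extend[OF _ b(2)] by metis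
  have finb': "finite b'"
    using chains.independent_span_bound[OF fin b'(3)] b'(2) Z by blast
  have "chains.dim ?Z = card b'" by (rule chains.dim_unique[OF b'(2,4,3) refl])
  then have "card b' \<le> card b" using betti b(4) by (simp add: reduced_betti_def)
  then have "b = b'" using card_seteq[OF finb' b'(1)] by blast
  then show ?thesis using b'(4) chains.span_mono[OF b(1)] by blast
qed

text \<open>The elementary chain of the oriented edge from \<open>u\<close> to \<open>v\<close>.\<close>
definition arc :: "'v \<Rightarrow> 'v \<Rightarrow> 'v list \<Rightarrow> 'k::field"
  where "arc u v = (\<lambda>xs. if xs = [u, v] then 1 else if xs = [v, u] then - 1 else 0)"

lemma arc_in_chains: "u \<noteq> v \<Longrightarrow> {u, v} \<in> \<Delta> \<Longrightarrow> arc u v \<in> oriented_chains \<Delta> 1"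
  by (auto simp: oriented_chains_def arc_def insert_commute Cons_eq_append_conv append_eq_Cons_conv)

lemma boundary_arc:
  assumes "finite (\<Union>\<Delta>)" "u \<noteq> v" "u \<in> \<Union>\<Delta>" "v \<in> \<Union>\<Delta>"
  shows "oriented_boundary \<Delta> (arc u v) = (\<lambda>xs. (if xs = [v] then 1 else 0) - (if xs = [u] then 1 else 0 :: 'k::field))"
proof
  fix xs :: "'a list"
  have "oriented_boundary \<Delta> (arc u v) xs =
    (\<Sum>x\<in>\<Union>\<Delta>. (if x = u then if xs = [v] then 1 else 0 else 0) - (if x = v then if xs = [u] then 1 else 0 else (0 :: 'k)))"
    unfolding oriented_boundary_def by (rule sum.cong) (use assms(2) in \<open>auto simp: arc_def\<close>)
  also have "\<dots> = (if xs = [v] then 1 else 0) - (if xs = [u] then 1 else 0)"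
    unfolding sum_subtractf using assms by simp
  finally show "oriented_boundary \<Delta> (arc u v) xs = (if xs = [v] then 1 else 0) - (if xs = [u] then 1 else 0 :: 'k)" .
qed

lemma oriented_chains_add:
  "c \<in> oriented_chains \<Delta> p \<Longrightarrow> c' \<in> oriented_chains \<Delta> p \<Longrightarrow> (\<lambda>xs. c xs + c' xs) \<in> oriented_chains \<Delta> p"
  unfolding oriented_chains_def mem_Collect_eq by (metis add.right_neutral minus_add_distrib)

lemma oriented_boundary_add:
  "oriented_boundary \<Delta> (\<lambda>xs. c xs + c' xs) = (\<lambda>xs. oriented_boundary \<Delta> c xs + oriented_boundary \<Delta> c' xs)"
  by (simp add: oriented_boundary_def sum.distrib)

lemma square_cycle:
  assumes \<Delta>: "abstract_complex \<Delta>"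
    and "{f, g} \<in> \<Delta>" "{g, h} \<in> \<Delta>" "{h, k} \<in> \<Delta>" "{k, f} \<in> \<Delta>" "f \<noteq> g" "g \<noteq> h" "h \<noteq> k" "k \<noteq> f"
  shows "(\<lambda>xs. arc f g xs + (arc g h xs + (arc h k xs + arc k f xs :: 'k::field))) \<in> reduced_cycles \<Delta> 1"
proof -
  have fin: "finite (\<Union>\<Delta>)" using \<Delta> by (auto simp: abstract_complex_def)
  have v: "f \<in> \<Union>\<Delta>" "g \<in> \<Union>\<Delta>" "h \<in> \<Union>\<Delta>" "k \<in> \<Union>\<Delta>" using assms by blast+
  show ?thesis
    unfolding reduced_cycles_def mem_Collect_eq
  proof
    show "(\<lambda>xs. arc f g xs + (arc g h xs + (arc h k xs + arc k f xs :: 'k))) \<in> oriented_chains \<Delta> 1"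
      using assms by (intro oriented_chains_add arc_in_chains)
    show "oriented_boundary \<Delta> (\<lambda>xs. arc f g xs + (arc g h xs + (arc h k xs + arc k f xs :: 'k))) = (\<lambda>_. 0)"
      unfolding oriented_boundary_add using assms v by (simp add: boundary_arc[OF fin] fun_eq_iff)
  qed
qed

lemma boundary_edge:
  fixes E :: "'a::finite set set"
  assumes b: "b \<in> oriented_chains (matchings E) 2" and uv: "avoid E (u \<union> v) = {x, y}" "x \<noteq> y"
    and E: "two_uniform E"
  shows "oriented_boundary (matchings E) b [u, v] = b [x, u, v] + b [y, u, v]"
proof -
  have "b [w, u, v] = 0" if w: "w \<in> E - {x, y}" for w
  proof (rule ccontr)
    assume n: "b [w, u, v] \<noteq> 0"
    have "distinct [w, u, v]" "{w, u, v} \<in> matchings E"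
      using chainsD(1,2)[OF b n] by simp_all
    then have "disjnt w u" "disjnt w v"
      unfolding matchings_def by (auto simp: pairwise_insert)
    then have "w \<in> avoid E (u \<union> v)" using w by (auto simp: avoid_def disjnt_def)
    then show False using uv w by simp
  qed
  moreover have "{x, y} \<subseteq> E" using uv(1) by (auto simp: avoid_def)
  ultimately have "(\<Sum>w\<in>E. b [w, u, v]) = (\<Sum>w\<in>{x, y}. b [w, u, v])"
    by (intro sum.mono_neutral_right) auto
  then show ?thesis using uv(2) by (simp add: oriented_boundary_def)
qed

text \<open>A linear functional \<open>\<Phi>\<close> that vanishes on boundaries and a closed walk on which it does not vanish.
  The eight edges in \<open>\<Phi>\<close> are those crossed by a closed strip of eight triangles in which
  consecutive triangles share an edge.  With suitable signs the contributions of each triangle of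
  the strip cancel, and the walk of length four crosses the strip once.  All coefficients are
  \<open>\<plusminus>1\<close>, so the argument is valid over every field.\<close>
lemma torus_betti:
  fixes E :: "'a::finite set set"
  assumes "is_K43 E"
  shows "reduced_betti TYPE('k::field) (matchings E) 1 \<noteq> 0"
proof
  assume betti: "reduced_betti TYPE('k) (matchings E) 1 = 0"
  obtain a b c d p q r where D: "distinct [a, b, c, d, p, q, r]"
    and E: "E = {{a, p}, {b, p}, {c, p}, {d, p}, {a, q}, {b, q}, {c, q}, {d, q},
         {a, r}, {b, r}, {c, r}, {d, r}}"
    using assms unfolding is_K43_def by metis
  have ne: "a \<noteq> b" "a \<noteq> c" "a \<noteq> d" "a \<noteq> p" "a \<noteq> q" "a \<noteq> r" "b \<noteq> c" "b \<noteq> d" "b \<noteq> p" "b \<noteq> q" "b \<noteq> r"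
    "c \<noteq> d" "c \<noteq> p" "c \<noteq> q" "c \<noteq> r" "d \<noteq> p" "d \<noteq> q" "d \<noteq> r" "p \<noteq> q" "p \<noteq> r" "q \<noteq> r"
    using D by auto
  note ne = ne ne[symmetric]
  have uni: "two_uniform E" using ne by (simp add: two_uniform_def E card_insert_if)
  \<comment> \<open>The edges shared by consecutive triangles of the strip, which is given by the assignments of columns to
    \<open>p, q, r\<close>: \<open>abc, dbc, dac, bac, bad, cad, cbd, abd\<close>, and back to \<open>abc\<close>.\<close>
  define \<Phi> :: "('a set list \<Rightarrow> 'k) \<Rightarrow> 'k" where
    "\<Phi> = (\<lambda>z. z [{b, q}, {c, r}] + z [{d, p}, {c, r}] + z [{a, q}, {c, r}] - z [{b, p}, {a, q}]
      + z [{a, q}, {d, r}] + z [{c, p}, {d, r}] + z [{b, q}, {d, r}] - z [{a, p}, {b, q}])"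
  have bd: "\<Phi> (oriented_boundary (matchings E) z) = 0" if z: "z \<in> oriented_chains (matchings E) 2" for z
  proof -
    note be = boundary_edge[OF z _ _ uni]
    have
      "oriented_boundary (matchings E) z [{b, q}, {c, r}] = z [{a, p}, {b, q}, {c, r}] + z [{d, p}, {b, q}, {c, r}]"
      "oriented_boundary (matchings E) z [{d, p}, {c, r}] = z [{a, q}, {d, p}, {c, r}] + z [{b, q}, {d, p}, {c, r}]"
      "oriented_boundary (matchings E) z [{a, q}, {c, r}] = z [{b, p}, {a, q}, {c, r}] + z [{d, p}, {a, q}, {c, r}]"
      "oriented_boundary (matchings E) z [{b, p}, {a, q}] = z [{c, r}, {b, p}, {a, q}] + z [{d, r}, {b, p}, {a, q}]"
      "oriented_boundary (matchings E) z [{a, q}, {d, r}] = z [{b, p}, {a, q}, {d, r}] + z [{c, p}, {a, q}, {d, r}]"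
      "oriented_boundary (matchings E) z [{c, p}, {d, r}] = z [{a, q}, {c, p}, {d, r}] + z [{b, q}, {c, p}, {d, r}]"
      "oriented_boundary (matchings E) z [{b, q}, {d, r}] = z [{a, p}, {b, q}, {d, r}] + z [{c, p}, {b, q}, {d, r}]"
      "oriented_boundary (matchings E) z [{a, p}, {b, q}] = z [{c, r}, {a, p}, {b, q}] + z [{d, r}, {a, p}, {b, q}]"
      by (rule be; simp add: E avoid_insert ne doubleton_eq_iff)+
    moreover have
      "z [{a, q}, {d, p}, {c, r}] = - z [{d, p}, {a, q}, {c, r}]"
      "z [{b, q}, {d, p}, {c, r}] = - z [{d, p}, {b, q}, {c, r}]"
      "z [{a, q}, {c, p}, {d, r}] = - z [{c, p}, {a, q}, {d, r}]"
      "z [{b, q}, {c, p}, {d, r}] = - z [{c, p}, {b, q}, {d, r}]"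
      by (rule chains_swap(1)[OF z])+
    moreover
    have rot: "z [x, y, w] = z [y, w, x]" for x y w
      using chains_swap(1)[OF z, of x y "[w]"] chains_swap(2)[OF z, of y x w "[]"] by simp
    have
      "z [{c, r}, {b, p}, {a, q}] = z [{b, p}, {a, q}, {c, r}]"
      "z [{d, r}, {b, p}, {a, q}] = z [{b, p}, {a, q}, {d, r}]"
      "z [{c, r}, {a, p}, {b, q}] = z [{a, p}, {b, q}, {c, r}]"
      "z [{d, r}, {a, p}, {b, q}] = z [{a, p}, {b, q}, {d, r}]"
      by (rule rot)+
    ultimately show ?thesis unfolding \<Phi>_def by simp
  qed
  have lin: "chains.subspace {z. \<Phi> z = 0}"
  proof -
    have "\<Phi> (chain_scale \<alpha> z) = \<alpha> * \<Phi> z" "\<Phi> (z + z') = \<Phi> z + \<Phi> z'" "\<Phi> 0 = 0" for \<alpha> z z'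
      by (simp_all add: \<Phi>_def chain_scale_def algebra_simps)
    then show ?thesis by (simp add: chains.subspace_def)
  qed
  have "chains.span (reduced_boundaries (matchings E) 1) \<subseteq> {z. \<Phi> z = 0}"
    by (rule chains.span_minimal[OF _ lin]) (use bd in \<open>auto simp: reduced_boundaries_def\<close>)
  then have Z: "\<Phi> z = 0" if "z \<in> reduced_cycles (matchings E) 1" for z
    using that cycles_span_boundaries[OF abstract_complex_matchings betti] by blast
  \<comment> \<open>Of the edges in \<open>\<Phi>\<close>, this closed walk uses only the one from \<open>ap\<close> to \<open>bq\<close>.\<close>
  let ?f = "{a, p}" and ?g = "{b, q}" and ?h = "{c, p}" and ?k = "{d, q}"
  have "(\<lambda>xs. arc ?f ?g xs + (arc ?g ?h xs + (arc ?h ?k xs + arc ?k ?f xs :: 'k))) \<in> reduced_cycles (matchings E) 1"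
    by (rule square_cycle[OF abstract_complex_matchings])
      (simp_all add: matchings_def E pairwise_insert disjnt_def ne doubleton_eq_iff)
  from Z[OF this] show False
    unfolding \<Phi>_def arc_def by (simp add: ne doubleton_eq_iff)
qed

section \<open>From homology to links\<close>

text \<open>In contrast to the condition for a homology manifold, the empty face is included here.\<close>
definition spherical_links :: "'k::field itself \<Rightarrow> int \<Rightarrow> 'a set set \<Rightarrow> bool"
  where "spherical_links k m E \<longleftrightarrow>
    (\<forall>\<sigma>\<in>matchings E. has_sphere_homology k (matchings (avoid E (\<Union>\<sigma>))) (m - int (card \<sigma>)))"

lemma has_sphere_homology_avoid:
  fixes E :: "'a::finite set set"
  assumes E: "two_uniform E" and e: "e \<in> E"
    and links: "\<And>\<sigma>. \<sigma> \<in> matchings E \<Longrightarrow> \<sigma> \<noteq> {} \<Longrightarrow>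
      has_sphere_homology k (matchings (avoid E (\<Union>\<sigma>))) (m - int (card \<sigma>))"
  shows "spherical_links k (m - 1) (avoid E e)"
  unfolding spherical_links_def
proof
  fix \<sigma> assume s: "\<sigma> \<in> matchings (avoid E e)"
  have "e \<noteq> {}" using E e by (auto simp: two_uniform_def)
  then have i: "insert e \<sigma> \<in> matchings E" "e \<notin> \<sigma>" using insert_matchings[OF e, of \<sigma>] s by auto
  have card: "m - int (card (insert e \<sigma>)) = m - 1 - int (card \<sigma>)" using i(2) by simp
  have av: "avoid (avoid E e) (\<Union>\<sigma>) = avoid E (\<Union>(insert e \<sigma>))" by (simp add: avoid_avoid)
  from links[OF i(1) insert_not_empty]
  show "has_sphere_homology k (matchings (avoid (avoid E e) (\<Union>\<sigma>))) (m - 1 - int (card \<sigma>))"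
    unfolding av card .
qed

lemma avoid_nothing [simp]: "avoid E {} = E"
  by (auto simp: avoid_def)

lemma spherical_links_betti:
  assumes "spherical_links k m E"
  shows "reduced_betti k (matchings E) p = (if p = m then 1 else 0)"
proof -
  have "{} \<in> matchings E" by (simp add: matchings_def)
  then show ?thesis using assms unfolding spherical_links_def has_sphere_homology_def by fastforce
qed

lemma intersecting_pair_is_P3:
  assumes "two_uniform {f, g}" "f \<noteq> g" "f \<inter> g \<noteq> {}"
  shows "is_P3 {f, g}"
proof -
  obtain x where x: "x \<in> f" "x \<in> g" using assms(3) by blast
  have c: "card f = 2" "card g = 2" using assms(1) by (auto simp: two_uniform_def)
  obtain y where y: "f = {x, y}" "y \<noteq> x" using c(1) x(1) by (auto simp: card_2_iff)
  obtain z where z: "g = {x, z}" "z \<noteq> x" using c(2) x(2) by (auto simp: card_2_iff)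
  have "distinct [x, y, z]" using y z assms(2) by auto
  then show ?thesis unfolding y z by (rule is_P3I)
qed

text \<open>The link of a vertex of a complex with spherical links has spherical links again, so that the
  induction is over the dimension.\<close>
lemma spherical_links_locally_spherical:
  fixes E :: "'a::finite set set"
  assumes "spherical_links TYPE('k::field) (int n - 1) E" "two_uniform E"
  shows "locally_spherical n E"
  using assms
proof (induction n arbitrary: E)
  case 0
  have "reduced_betti TYPE('k) (matchings E) (-1) = 1" using spherical_links_betti[OF "0.prems"(1)] by simp
  then have "e \<notin> E" for e using reduced_betti_minus_one[of e E, where ?'k = 'k] by auto
  then show ?case by auto
next
  case (Suc n)
  have b: "reduced_betti TYPE('k) (matchings E) p = (if p = int n then 1 else 0)" for p
    using spherical_links_betti[OF Suc.prems(1)] by simp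
  have ne: "E \<noteq> {}"
  proof
    assume "E = {}"
    then have "int (card \<sigma>) \<le> int n" if "\<sigma> \<in> matchings E" for \<sigma> using that by (simp add: matchings_def)
    then have "reduced_betti TYPE('k) (matchings E) (int n) = 0" by (rule reduced_betti_high_dim)
    then show False using b by simp
  qed
  have IH: "locally_spherical n (avoid E e)" if "e \<in> E" for e
  proof (rule Suc.IH[OF _ two_uniform_avoid[OF Suc.prems(2)]])
    have "spherical_links TYPE('k) (int (Suc n) - 1 - 1) (avoid E e)"
      by (rule has_sphere_homology_avoid[OF Suc.prems(2) that])
        (use Suc.prems(1) in \<open>simp add: spherical_links_def\<close>)
    then show "spherical_links TYPE('k) (int n - 1) (avoid E e)" by simp
  qed
  show ?case
  proof (cases n)
    case 0
    have meet: "f \<inter> g \<noteq> {}" if "f \<in> E" "g \<in> E" for f g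
    proof
      assume "f \<inter> g = {}"
      then have "f \<in> avoid E g" using that by (simp add: avoid_def)
      then show False using IH[OF that(2)] 0 by simp
    qed
    moreover have "reduced_betti TYPE('k) (matchings E) 0 = 1" using b[of 0] 0 by simp
    ultimately obtain f g where fg: "f \<noteq> g" "E = {f, g}"
      using reduced_betti_zero_two_points[of E, where ?'k = 'k] by blast
    then have "is_P3 E" using intersecting_pair_is_P3[of f g] Suc.prems(2) meet by simp
    then show ?thesis using 0 by simp
  next
    case (Suc k)
    have "\<not> is_K43 E" if "k = 1"
    proof -
      have "reduced_betti TYPE('k) (matchings E) 1 = 0" using b[of 1] Suc that by simp
      then show ?thesis using torus_betti[of E, where ?'k = 'k] by auto
    qed
    then show ?thesis using ne IH Suc by simp
  qed
qed

text \<open>Passing to the link of a vertex provides the condition for the empty face.  Because \<open>d \<ge> 3\<close>, the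
  surfaces that must not be tori occur only inside such links.\<close>
lemma homology_manifold_locally_spherical:
  fixes G :: "'a::finite graph"
  assumes d: "d \<ge> 3" and G: "finite_simple_graph G"
    and M: "homology_manifold TYPE('k::field) d (matching_complex G)"
  shows "locally_spherical (Suc d) (graph_edges G)"
proof -
  let ?E = "graph_edges G"
  have U: "two_uniform ?E" using G by (auto simp: two_uniform_def finite_simple_graph_def)
  have dim: "complex_dim (matchings ?E) = int d"
    and links: "\<And>\<sigma>. \<sigma> \<in> matchings ?E \<Longrightarrow> \<sigma> \<noteq> {} \<Longrightarrow>
      has_sphere_homology TYPE('k) (face_link (matchings ?E) \<sigma>) (int d - int (card \<sigma>))"
    using M by (auto simp: homology_manifold_def matching_complex_eq)
  have "?E \<noteq> {}"
  proof
    assume "?E = {}"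
    then have "matchings ?E = {{}}" by (auto simp: matchings_def)
    then show False using dim d by (simp add: complex_dim_def)
  qed
  moreover have "locally_spherical d (avoid ?E e)" if "e \<in> ?E" for e
  proof (rule spherical_links_locally_spherical[OF _ two_uniform_avoid[OF U]])
    show "spherical_links TYPE('k) (int d - 1) (avoid ?E e)"
      using links by (intro has_sphere_homology_avoid[OF U that]) (simp add: face_link_matchings[OF U])
  qed
  moreover obtain n where "d = Suc n" "n \<noteq> 1" using d by (cases d) auto
  ultimately show ?thesis by simp
qed

section \<open>Simplicial spheres from linear maps\<close>

lemma face_hull_iff:
  fixes x :: "real ^ 'v::finite"
  shows "x \<in> convex hull ((\<lambda>v. axis v 1) ` \<sigma>) \<longleftrightarrow>
    (\<forall>v. 0 \<le> x $ v) \<and> (\<forall>v. v \<notin> \<sigma> \<longrightarrow> x $ v = 0) \<and> (\<Sum>v\<in>UNIV. x $ v) = 1"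
proof
  let ?S = "{x :: real ^ 'v. (\<forall>v. 0 \<le> x $ v) \<and> (\<forall>v. v \<notin> \<sigma> \<longrightarrow> x $ v = 0) \<and> (\<Sum>v\<in>UNIV. x $ v) = 1}"
  have "convex ?S"
    unfolding convex_def by (auto simp: sum.distrib sum_distrib_left[symmetric])
  moreover have "(\<lambda>v. axis v 1) ` \<sigma> \<subseteq> ?S"
    by (auto simp: axis_def)
  ultimately have "convex hull ((\<lambda>v. axis v 1) ` \<sigma>) \<subseteq> ?S" by (rule hull_minimal[rotated])
  moreover assume "x \<in> convex hull ((\<lambda>v. axis v 1) ` \<sigma>)"
  ultimately show "(\<forall>v. 0 \<le> x $ v) \<and> (\<forall>v. v \<notin> \<sigma> \<longrightarrow> x $ v = 0) \<and> (\<Sum>v\<in>UNIV. x $ v) = 1" by blast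
next
  assume x: "(\<forall>v. 0 \<le> x $ v) \<and> (\<forall>v. v \<notin> \<sigma> \<longrightarrow> x $ v = 0) \<and> (\<Sum>v\<in>UNIV. x $ v) = 1"
  have s1: "(\<Sum>v\<in>\<sigma>. x $ v) = (\<Sum>v\<in>UNIV. x $ v)"
    by (rule sum.mono_neutral_left) (use x in auto)
  have "x = (\<Sum>v\<in>UNIV. x $ v *\<^sub>R axis v 1)"
    using basis_expansion[of x] by (simp add: scalar_mult_eq_scaleR)
  also have "\<dots> = (\<Sum>v\<in>\<sigma>. x $ v *\<^sub>R axis v 1)"
    by (rule sum.mono_neutral_right) (use x in auto)
  also have "\<dots> \<in> convex hull ((\<lambda>v. axis v 1) ` \<sigma>)"
    using x s1 by (intro convex_sum convex_convex_hull) (auto intro: hull_inc)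
  finally show "x \<in> convex hull ((\<lambda>v. axis v 1) ` \<sigma>)" .
qed

text \<open>The geometric realization is the slice of this cone where the coordinates add up to 1.\<close>
definition complex_cone :: "'v::finite set set \<Rightarrow> (real ^ 'v) set"
  where "complex_cone \<Delta> = {x. (\<forall>v. 0 \<le> x $ v) \<and> {v. x $ v \<noteq> 0} \<in> \<Delta>}"

lemma geometric_realization_cone:
  assumes "abstract_complex \<Delta>"
  shows "geometric_realization \<Delta> = {x \<in> complex_cone \<Delta>. (\<Sum>v\<in>UNIV. x $ v) = 1}"
proof (intro equalityI subsetI)
  fix x assume "x \<in> geometric_realization \<Delta>"
  then obtain \<sigma> where s: "\<sigma> \<in> \<Delta>" "x \<in> convex hull ((\<lambda>v. axis v 1) ` \<sigma>)"
    unfolding geometric_realization_def by blast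
  then have "{v. x $ v \<noteq> 0} \<subseteq> \<sigma>" unfolding face_hull_iff by blast
  then have "{v. x $ v \<noteq> 0} \<in> \<Delta>" using assms s(1) unfolding abstract_complex_def by blast
  then show "x \<in> {x \<in> complex_cone \<Delta>. (\<Sum>v\<in>UNIV. x $ v) = 1}"
    using s(2) unfolding face_hull_iff complex_cone_def by blast
next
  fix x assume x: "x \<in> {x \<in> complex_cone \<Delta>. (\<Sum>v\<in>UNIV. x $ v) = 1}"
  then have "x \<in> convex hull ((\<lambda>v. axis v 1) ` {v. x $ v \<noteq> 0})"
    unfolding face_hull_iff complex_cone_def by simp
  then show "x \<in> geometric_realization \<Delta>"
    using x unfolding geometric_realization_def complex_cone_def by blast
qed

lemma not_affine_dependent_axes: "\<not> affine_dependent ((\<lambda>v. axis v (1 :: real) :: real ^ 'v::finite) ` \<sigma>)"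
proof
  assume "affine_dependent ((\<lambda>v. axis v (1 :: real) :: real ^ 'v) ` \<sigma>)"
  then have "dependent ((\<lambda>v. axis v (1 :: real) :: real ^ 'v) ` \<sigma>)"
    by (rule affine_dependent_imp_dependent)
  moreover have "(\<lambda>v. axis v (1 :: real) :: real ^ 'v) ` \<sigma> \<subseteq> Basis" by auto
  ultimately show False using independent_Basis dependent_mono by blast
qed

lemma inj_axis: "inj_on (\<lambda>v. axis v (1 :: real) :: real ^ 'v::finite) \<sigma>"
  by (auto simp: inj_on_def axis_eq_axis)

lemma simplicial_complex_realization:
  fixes \<Delta> :: "'v::finite set set"
  assumes \<Delta>: "abstract_complex \<Delta>"
  shows "simplicial_complex ((\<lambda>\<sigma>. convex hull ((\<lambda>v. axis v (1 :: real) :: real ^ 'v) ` \<sigma>)) ` \<Delta>)"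
proof -
  let ?a = "\<lambda>v. axis v (1 :: real) :: real ^ 'v"
  let ?h = "\<lambda>\<sigma>. convex hull (?a ` \<sigma>)"
  note nd = not_affine_dependent_axes
  have face: "F \<in> ?h ` \<Delta>" if F: "\<sigma> \<in> \<Delta>" "F face_of ?h \<sigma>" for F \<sigma>
  proof -
    obtain c where c: "c \<subseteq> ?a ` \<sigma>" "F = convex hull c"
      using F(2) unfolding face_of_convex_hull_affine_independent[OF nd] by blast
    obtain \<tau> where t: "\<tau> \<subseteq> \<sigma>" "c = ?a ` \<tau>" using c(1) by (rule subset_imageE)
    then have "\<tau> \<in> \<Delta>" using \<Delta> F(1) unfolding abstract_complex_def by blast
    then show ?thesis using t c by blast
  qed
  have inter: "(?h \<sigma> \<inter> ?h \<tau>) face_of ?h \<sigma>" for \<sigma> \<tau>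
  proof -
    have "?h \<sigma> \<inter> ?h \<tau> = convex hull (?a ` \<sigma> \<inter> ?a ` \<tau>)"
      by (rule convex_hull_Int[symmetric]) (use nd[of "\<sigma> \<union> \<tau>"] in \<open>simp add: image_Un\<close>)
    then show ?thesis
      unfolding face_of_convex_hull_affine_independent[OF nd] by blast
  qed
  have simplex: "\<exists>n. n simplex ?h \<sigma>" for \<sigma>
    unfolding simplex_def using nd[of \<sigma>]
    by (intro exI[of _ "int (card \<sigma>) - 1"] exI[of _ "?a ` \<sigma>"]) (simp add: card_image inj_axis)
  show ?thesis
    unfolding simplicial_complex_def using face inter simplex by auto
qed

text \<open>Cones instead of realizations make the maps linear instead of affine, and preserving the sum of the
  coordinates makes them restrict to the realizations.\<close>
definition linearly_equivalent :: "'v::finite set set \<Rightarrow> 'v set set \<Rightarrow> bool"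
  where "linearly_equivalent \<Delta> \<Gamma> \<longleftrightarrow> (\<exists>f :: real ^ 'v \<Rightarrow> real ^ 'v. linear f \<and>
    (\<forall>x. (\<Sum>v\<in>UNIV. f x $ v) = (\<Sum>v\<in>UNIV. x $ v)) \<and>
    bij_betw f (complex_cone \<Delta>) (complex_cone \<Gamma>))"

lemma linearly_equivalent_refl: "linearly_equivalent \<Delta> \<Delta>"
  unfolding linearly_equivalent_def
  by (intro exI[of _ "\<lambda>x. x"]) (simp add: linear_id[unfolded id_def] bij_betw_def)

lemma linearly_equivalent_trans:
  assumes "linearly_equivalent \<Delta> \<Gamma>" "linearly_equivalent \<Gamma> \<Theta>"
  shows "linearly_equivalent \<Delta> \<Theta>"
proof -
  obtain f where f: "linear f" "\<And>x. (\<Sum>v\<in>UNIV. f x $ v) = (\<Sum>v\<in>UNIV. x $ v)"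
    "bij_betw f (complex_cone \<Delta>) (complex_cone \<Gamma>)"
    using assms(1) unfolding linearly_equivalent_def by blast
  obtain g where g: "linear g" "\<And>x. (\<Sum>v\<in>UNIV. g x $ v) = (\<Sum>v\<in>UNIV. x $ v)"
    "bij_betw g (complex_cone \<Gamma>) (complex_cone \<Theta>)"
    using assms(2) unfolding linearly_equivalent_def by blast
  show ?thesis
    unfolding linearly_equivalent_def
    using linear_compose[OF f(1) g(1)] bij_betw_trans[OF f(3) g(3)] f(2) g(2)
    by (intro exI[of _ "g \<circ> f"]) simp
qed

definition simplex_boundary :: "'v set \<Rightarrow> 'v set set"
  where "simplex_boundary W = {\<tau>. \<tau> \<subset> W}"

lemma rel_frontier_simplex:
  "rel_frontier (convex hull ((\<lambda>v. axis v (1 :: real) :: real ^ 'v::finite) ` W)) =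
    geometric_realization (simplex_boundary W)"
proof -
  let ?a = "\<lambda>v. axis v (1 :: real) :: real ^ 'v"
  have "rel_frontier (convex hull (?a ` W)) = \<Union>{convex hull (?a ` W - {x}) |x. x \<in> ?a ` W}"
    by (rule rel_frontier_convex_hull_cases[OF not_affine_dependent_axes])
  also have "\<dots> = (\<Union>w\<in>W. convex hull (?a ` W - {?a w}))"
    by (simp add: Setcompr_eq_image image_image)
  also have "\<dots> = (\<Union>w\<in>W. convex hull (?a ` (W - {w})))"
  proof -
    have "?a ` W - {?a w} = ?a ` (W - {w})" for w
      by (auto simp: axis_eq_axis)
    then show ?thesis by simp
  qed
  also have "\<dots> = geometric_realization (simplex_boundary W)"
  proof (intro equalityI subsetI)
    fix x assume "x \<in> (\<Union>w\<in>W. convex hull (?a ` (W - {w})))"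
    then show "x \<in> geometric_realization (simplex_boundary W)"
      unfolding geometric_realization_def simplex_boundary_def by blast
  next
    fix x assume "x \<in> geometric_realization (simplex_boundary W)"
    then obtain \<tau> where t: "\<tau> \<subset> W" "x \<in> convex hull (?a ` \<tau>)"
      unfolding geometric_realization_def simplex_boundary_def by blast
    then obtain w where w: "w \<in> W" "\<tau> \<subseteq> W - {w}" by blast
    then have "convex hull (?a ` \<tau>) \<subseteq> convex hull (?a ` (W - {w}))"
      by (intro hull_mono image_mono)
    then show "x \<in> (\<Union>w\<in>W. convex hull (?a ` (W - {w})))" using t w by blast
  qed
  finally show ?thesis .
qed

text \<open>A linear map is affine on every face, so the faces themselves form the triangulation that piecewise
  linearity asks for.  Compactness gives the continuity of the inverse.\<close>
lemma linearly_equivalent_imp_sphere: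
  fixes \<Delta> :: "'v::finite set set"
  assumes \<Delta>: "abstract_complex \<Delta>" and eq: "linearly_equivalent \<Delta> (simplex_boundary W)"
    and W: "card W = d + 2"
  shows "combinatorial_sphere d \<Delta>"
proof -
  let ?a = "\<lambda>v. axis v (1 :: real) :: real ^ 'v"
  let ?T = "convex hull (?a ` W)"
  obtain f where f: "linear f" "\<And>x. (\<Sum>v\<in>UNIV. f x $ v) = (\<Sum>v\<in>UNIV. x $ v)"
    "bij_betw f (complex_cone \<Delta>) (complex_cone (simplex_boundary W))"
    using eq unfolding linearly_equivalent_def by blast
  have "W \<noteq> {}" using W by auto
  then have bW: "abstract_complex (simplex_boundary W)"
    by (auto simp: abstract_complex_def simplex_boundary_def)
  have inj: "inj_on f (geometric_realization \<Delta>)"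
    using f(3) unfolding geometric_realization_cone[OF \<Delta>] bij_betw_def by (auto intro: inj_on_subset)
  have "complex_cone (simplex_boundary W) = f ` complex_cone \<Delta>" using f(3) by (simp add: bij_betw_def)
  then have img: "f ` geometric_realization \<Delta> = geometric_realization (simplex_boundary W)"
    unfolding geometric_realization_cone[OF \<Delta>] geometric_realization_cone[OF bW] by (auto simp: f(2))
  have "finite \<Delta>" by simp
  then have cpt: "compact (geometric_realization \<Delta>)"
    unfolding geometric_realization_def
    by (intro compact_UN compact_convex_hull finite_imp_compact) auto
  have cont: "continuous_on (geometric_realization \<Delta>) f"
    using f(1) by (intro linear_continuous_on) (simp add: linear_conv_bounded_linear)
  obtain g where g: "homeomorphism (geometric_realization \<Delta>) (rel_frontier ?T) f g"
    using homeomorphism_compact[OF cpt cont _ inj] img unfolding rel_frontier_simplex by metis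
  have "piecewise_linear_on (geometric_realization \<Delta>) f"
    unfolding piecewise_linear_on_def
  proof (intro exI conjI ballI)
    show "simplicial_complex ((\<lambda>\<sigma>. convex hull (?a ` \<sigma>)) ` \<Delta>)"
      by (rule simplicial_complex_realization[OF \<Delta>])
    show "\<Union>((\<lambda>\<sigma>. convex hull (?a ` \<sigma>)) ` \<Delta>) = geometric_realization \<Delta>"
      by (simp add: geometric_realization_def)
    show "linear f" by (rule f(1))
    show "f x = f x + 0" for x by simp
  qed
  moreover have "(int d + 1) simplex ?T"
    unfolding simplex_def using W not_affine_dependent_axes[of W]
    by (intro exI[of _ "?a ` W"]) (simp add: card_image inj_axis)
  ultimately show ?thesis
    unfolding combinatorial_sphere_def pl_homeomorphic_def using \<Delta> g by blast
qed

text \<open>The faces without \<open>v\<close> are the faces of \<open>\<Delta>\<close> that do not contain \<open>\<sigma>\<close>; those with \<open>v\<close> form the cone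
  from \<open>v\<close> over the boundary of the star of \<open>\<sigma>\<close>.\<close>
definition stellar :: "'v set set \<Rightarrow> 'v set \<Rightarrow> 'v \<Rightarrow> 'v set set"
  where "stellar \<Delta> \<sigma> v = {\<tau>. if v \<in> \<tau> then (\<tau> - {v}) \<union> \<sigma> \<in> \<Delta> \<and> \<not> \<sigma> \<subseteq> \<tau> else \<tau> \<in> \<Delta> \<and> \<not> \<sigma> \<subseteq> \<tau>}"

lemma abstract_complex_stellar:
  fixes \<Delta> :: "'v::finite set set"
  assumes \<Delta>: "abstract_complex \<Delta>" and \<sigma>: "\<sigma> \<noteq> {}"
  shows "abstract_complex (stellar \<Delta> \<sigma> v)"
proof -
  have down: "\<tau> \<in> \<Delta>" if "\<rho> \<in> \<Delta>" "\<tau> \<subseteq> \<rho>" for \<rho> \<tau>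
    using \<Delta> that unfolding abstract_complex_def by blast
  have "\<tau> \<in> stellar \<Delta> \<sigma> v" if r: "\<rho> \<in> stellar \<Delta> \<sigma> v" "\<tau> \<subseteq> \<rho>" for \<rho> \<tau>
  proof -
    have n: "\<not> \<sigma> \<subseteq> \<tau>" using r by (auto simp: stellar_def split: if_splits)
    show ?thesis
    proof (cases "v \<in> \<tau>")
      case True
      then have "(\<rho> - {v}) \<union> \<sigma> \<in> \<Delta>" using r by (auto simp: stellar_def)
      then have "(\<tau> - {v}) \<union> \<sigma> \<in> \<Delta>" by (rule down) (use r in blast)
      then show ?thesis using True n by (simp add: stellar_def)
    next
      case False
      have "\<tau> \<in> \<Delta>"
      proof (cases "v \<in> \<rho>")
        case True
        then have "(\<rho> - {v}) \<union> \<sigma> \<in> \<Delta>" using r by (simp add: stellar_def)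
        then show ?thesis by (rule down) (use r False in blast)
      next
        case False
        then have "\<rho> \<in> \<Delta>" using r by (simp add: stellar_def)
        then show ?thesis by (rule down) (use r in blast)
      qed
      then show ?thesis using False n by (simp add: stellar_def)
    qed
  qed
  moreover have "{} \<in> stellar \<Delta> \<sigma> v" using \<Delta> \<sigma> by (simp add: stellar_def abstract_complex_def)
  ultimately show ?thesis by (auto simp: abstract_complex_def)
qed

text \<open>The map \<open>f\<close> spreads the coordinate of \<open>v\<close> evenly over \<open>\<sigma>\<close>, which means that \<open>v\<close> goes to the
  barycentre of \<open>\<sigma>\<close>.  A point of the subdivision has a coordinate zero on \<open>\<sigma>\<close>, so the amount
  that was spread is the minimum \<open>m\<close> of the image over \<open>\<sigma>\<close>, and \<open>g\<close> takes it back.\<close>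
lemma stellar_linearly_equivalent:
  fixes \<Delta> :: "'v::finite set set"
  assumes \<Delta>: "abstract_complex \<Delta>" and \<sigma>: "\<sigma> \<in> \<Delta>" "\<sigma> \<noteq> {}" and v: "v \<notin> \<Union>\<Delta>"
  shows "linearly_equivalent (stellar \<Delta> \<sigma> v) \<Delta>"
proof -
  define k where "k = real (card \<sigma>)"
  have k: "k > 0" using \<sigma>(2) by (simp add: k_def card_gt_0_iff)
  have down: "\<tau> \<in> \<Delta>" if "\<rho> \<in> \<Delta>" "\<tau> \<subseteq> \<rho>" for \<rho> \<tau>
    using \<Delta> that unfolding abstract_complex_def by blast
  have v\<sigma>: "v \<notin> \<sigma>" using v \<sigma> by blast
  define f :: "real ^ 'v \<Rightarrow> real ^ 'v" where
    "f = (\<lambda>x. \<chi> w. if w = v then 0 else x $ w + (if w \<in> \<sigma> then x $ v / k else 0))"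
  define m :: "real ^ 'v \<Rightarrow> real" where "m = (\<lambda>y. Min ((\<lambda>w. y $ w) ` \<sigma>))"
  define g :: "real ^ 'v \<Rightarrow> real ^ 'v" where
    "g = (\<lambda>y. \<chi> w. if w = v then k * m y else y $ w - (if w \<in> \<sigma> then m y else 0))"
  have m_le: "m y \<le> y $ w" if "w \<in> \<sigma>" for y w unfolding m_def using that by simp
  have m_in: "\<exists>w\<in>\<sigma>. m y = y $ w" for y
  proof -
    have "m y \<in> (\<lambda>w. y $ w) ` \<sigma>" unfolding m_def using \<sigma>(2) by (intro Min_in) auto
    then show ?thesis by blast
  qed
  have lin: "linear f"
    by (rule linearI) (simp_all add: f_def vec_eq_iff add_divide_distrib algebra_simps)
  have "(\<Sum>w\<in>UNIV. f x $ w) = (\<Sum>w\<in>UNIV. x $ w)" for x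
  proof -
    have "(\<Sum>w\<in>UNIV. f x $ w) = (\<Sum>w\<in>UNIV. x $ w - (if w = v then x $ v else 0) + (if w \<in> \<sigma> then x $ v / k else 0))"
      by (rule sum.cong) (use v\<sigma> in \<open>auto simp: f_def\<close>)
    also have "\<dots> = (\<Sum>w\<in>UNIV. x $ w) - x $ v + (\<Sum>w\<in>\<sigma>. x $ v / k)"
      by (simp add: sum.distrib sum_subtractf sum.If_cases)
    also have "(\<Sum>w\<in>\<sigma>. x $ v / k) = x $ v" using \<sigma>(2) by (simp add: k_def)
    finally show ?thesis by simp
  qed
  moreover have "bij_betw f (complex_cone (stellar \<Delta> \<sigma> v)) (complex_cone \<Delta>)"
  proof (rule bij_betw_byWitness[where f' = g])
    have mf: "m (f x) = x $ v / k" if x: "x \<in> complex_cone (stellar \<Delta> \<sigma> v)" for x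
    proof -
      have "\<not> \<sigma> \<subseteq> {w. x $ w \<noteq> 0}" using x by (auto simp: complex_cone_def stellar_def split: if_splits)
      then obtain w where w: "w \<in> \<sigma>" "x $ w = 0" by blast
      have wv: "w \<noteq> v" using w(1) v\<sigma> by blast
      have "m (f x) \<le> x $ v / k" using w m_le[OF w(1), of "f x"] wv by (simp add: f_def)
      moreover obtain w' where w': "w' \<in> \<sigma>" "m (f x) = f x $ w'" using m_in by blast
      moreover have "f x $ w' \<ge> x $ v / k"
      proof -
        have "w' \<noteq> v" using w'(1) v\<sigma> by blast
        then show ?thesis using x w'(1) by (simp add: f_def complex_cone_def)
      qed
      ultimately show ?thesis by simp
    qed
    show "\<forall>x\<in>complex_cone (stellar \<Delta> \<sigma> v). g (f x) = x"
    proof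
      fix x assume x: "x \<in> complex_cone (stellar \<Delta> \<sigma> v)"
      show "g (f x) = x" using k v\<sigma> unfolding vec_eq_iff g_def vec_lambda_beta mf[OF x]
        by (simp add: f_def)
    qed
    show "\<forall>y\<in>complex_cone \<Delta>. f (g y) = y"
    proof
      fix y assume y: "y \<in> complex_cone \<Delta>"
      then have "y $ v = 0" using v by (auto simp: complex_cone_def)
      then show "f (g y) = y" using k v\<sigma> by (auto simp: vec_eq_iff f_def g_def)
    qed
    show "f ` complex_cone (stellar \<Delta> \<sigma> v) \<subseteq> complex_cone \<Delta>"
    proof
      fix y assume "y \<in> f ` complex_cone (stellar \<Delta> \<sigma> v)"
      then obtain x where x: "x \<in> complex_cone (stellar \<Delta> \<sigma> v)" "y = f x" by blast
      have pos: "0 \<le> x $ w" for w using x(1) by (simp add: complex_cone_def)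
      have S: "{w. x $ w \<noteq> 0} \<in> stellar \<Delta> \<sigma> v" using x(1) by (simp add: complex_cone_def)
      have "{w. f x $ w \<noteq> 0} \<in> \<Delta>"
      proof (cases "x $ v = 0")
        case True
        then have "{w. x $ w \<noteq> 0} \<in> \<Delta>" using S by (auto simp: stellar_def)
        then show ?thesis by (rule down) (use True in \<open>auto simp: f_def split: if_splits\<close>)
      next
        case False
        then have "{w. x $ w \<noteq> 0} - {v} \<union> \<sigma> \<in> \<Delta>" using S by (auto simp: stellar_def)
        then show ?thesis by (rule down) (auto simp: f_def split: if_splits)
      qed
      then show "y \<in> complex_cone \<Delta>" using pos k x(2) by (simp add: complex_cone_def f_def)
    qed
    show "g ` complex_cone \<Delta> \<subseteq> complex_cone (stellar \<Delta> \<sigma> v)"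
    proof
      fix x assume "x \<in> g ` complex_cone \<Delta>"
      then obtain y where y: "y \<in> complex_cone \<Delta>" "x = g y" by blast
      have pos: "0 \<le> y $ w" for w using y(1) by (simp add: complex_cone_def)
      have S: "{w. y $ w \<noteq> 0} \<in> \<Delta>" using y(1) by (simp add: complex_cone_def)
      then have yv: "y $ v = 0" using v by blast
      obtain w where w: "w \<in> \<sigma>" "m y = y $ w" using m_in by blast
      then have m0: "m y \<ge> 0" using pos by simp
      have "w \<noteq> v" using w(1) v\<sigma> by blast
      then have gw: "g y $ w = 0" using w by (simp add: g_def)
      have n: "\<not> \<sigma> \<subseteq> {w. g y $ w \<noteq> 0}" using gw w by blast
      have "{w. g y $ w \<noteq> 0} \<in> stellar \<Delta> \<sigma> v"
      proof (cases "m y = 0")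
        case True
        then have "{w. g y $ w \<noteq> 0} = {w. y $ w \<noteq> 0}" using yv by (auto simp: g_def)
        then show ?thesis using S n yv by (simp add: stellar_def)
      next
        case False
        then have mp: "m y > 0" using m0 by simp
        have "{w. g y $ w \<noteq> 0} - {v} \<union> \<sigma> \<in> \<Delta>"
        proof (rule down[OF S])
          have "y $ u \<noteq> 0" if "u \<in> \<sigma>" for u using m_le[OF that, of y] mp by simp
          then show "{w. g y $ w \<noteq> 0} - {v} \<union> \<sigma> \<subseteq> {w. y $ w \<noteq> 0}"
            by (auto simp: g_def split: if_splits)
        qed
        moreover have "g y $ v \<noteq> 0" using False k by (simp add: g_def)
        ultimately show ?thesis using n by (simp add: stellar_def)
      qed
      moreover have "0 \<le> g y $ w" for w using pos m_le[of w y] m0 k by (simp add: g_def)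
      ultimately show "x \<in> complex_cone (stellar \<Delta> \<sigma> v)" using y(2) by (simp add: complex_cone_def)
    qed
  qed
  ultimately show ?thesis unfolding linearly_equivalent_def using lin by blast
qed

section \<open>Joins as iterated stellar subdivisions\<close>

text \<open>The set \<open>U\<close> is a reservoir of vertices for the whole construction.  Subdividing a vertex renames it,
  so a vertex of an earlier stage may be missing in the final complex; a vertex that is to be new
  at every stage has to be chosen outside \<open>U\<close>.\<close>
inductive stellar_sphere :: "'v::finite set \<Rightarrow> nat \<Rightarrow> 'v set set \<Rightarrow> bool" for U where
  simplex_boundary: "W \<subseteq> U \<Longrightarrow> card W = n + 1 \<Longrightarrow> stellar_sphere U n (simplex_boundary W)"
| stellar: "stellar_sphere U n \<Delta> \<Longrightarrow> \<sigma> \<in> \<Delta> \<Longrightarrow> \<sigma> \<noteq> {} \<Longrightarrow> v \<in> U \<Longrightarrow> v \<notin> \<Union>\<Delta> \<Longrightarrow>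
    stellar_sphere U n (stellar \<Delta> \<sigma> v)"

lemma stellar_sphere_complex:
  "stellar_sphere U n \<Delta> \<Longrightarrow> abstract_complex \<Delta> \<and> \<Union>\<Delta> \<subseteq> U"
proof (induction rule: stellar_sphere.induct)
  case (simplex_boundary W n)
  then have "W \<noteq> {}" by auto
  then show ?case using simplex_boundary by (auto simp: abstract_complex_def simplex_boundary_def)
next
  case (stellar n \<Delta> \<sigma> v)
  have "\<tau> \<subseteq> U" if "\<tau> \<in> stellar \<Delta> \<sigma> v" for \<tau>
    using that stellar by (auto simp: stellar_def split: if_splits)
  then show ?case using stellar abstract_complex_stellar by blast
qed

lemma stellar_sphere_equivalent:
  "stellar_sphere U n \<Delta> \<Longrightarrow> \<exists>W. card W = n + 1 \<and> linearly_equivalent \<Delta> (simplex_boundary W)"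
proof (induction rule: stellar_sphere.induct)
  case (simplex_boundary W n)
  then show ?case using linearly_equivalent_refl by blast
next
  case (stellar n \<Delta> \<sigma> v)
  have "linearly_equivalent (stellar \<Delta> \<sigma> v) \<Delta>"
    using stellar stellar_sphere_complex by (intro stellar_linearly_equivalent) blast+
  then show ?case using stellar.IH linearly_equivalent_trans by blast
qed

lemma stellar_sphere_mono:
  "stellar_sphere U n \<Delta> \<Longrightarrow> U \<subseteq> V \<Longrightarrow> stellar_sphere V n \<Delta>"
proof (induction rule: stellar_sphere.induct)
  case (simplex_boundary W n)
  then show ?case by (intro stellar_sphere.simplex_boundary) auto
next
  case (stellar n \<Delta> \<sigma> v)
  then show ?case by (intro stellar_sphere.stellar) auto
qed

text \<open>The join with the two points \<open>h\<close> and \<open>k\<close>, if these are not vertices of \<open>\<Delta>\<close>.\<close>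
definition suspension :: "'v \<Rightarrow> 'v \<Rightarrow> 'v set set \<Rightarrow> 'v set set"
  where "suspension h k \<Delta> = {\<tau>. \<tau> - {h, k} \<in> \<Delta> \<and> \<not> (h \<in> \<tau> \<and> k \<in> \<tau>)}"

lemma suspension_fresh: "v \<notin> \<Union>\<Delta> \<Longrightarrow> v \<noteq> h \<Longrightarrow> v \<noteq> k \<Longrightarrow> v \<notin> \<Union>(suspension h k \<Delta>)"
  by (auto simp: suspension_def)

lemma stellar_fresh: "v \<notin> \<Union>\<Delta> \<Longrightarrow> v \<noteq> w \<Longrightarrow> v \<notin> \<Union>(stellar \<Delta> \<sigma> w)"
  by (auto simp: stellar_def split: if_splits)

text \<open>The cone from \<open>h\<close> over the boundary of the simplex \<open>W\<close>, together with \<open>W\<close> itself, is the boundary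
  of the simplex on \<open>W\<close> and \<open>h\<close>.  Subdividing \<open>W\<close> by \<open>k\<close> replaces it by the second cone.\<close>
lemma suspension_simplex_boundary:
  assumes "W \<noteq> {}" "h \<notin> W" "k \<notin> W" "h \<noteq> k"
  shows "suspension h k (simplex_boundary W) = stellar (simplex_boundary (insert h W)) W k"
proof -
  have "\<tau> - {h, k} \<subset> W \<and> \<not> (h \<in> \<tau> \<and> k \<in> \<tau>) \<longleftrightarrow>
    (if k \<in> \<tau> then (\<tau> - {k}) \<union> W \<subset> insert h W \<and> \<not> W \<subseteq> \<tau> else \<tau> \<subset> insert h W \<and> \<not> W \<subseteq> \<tau>)" for \<tau>
    using assms by (cases "k \<in> \<tau>"; cases "h \<in> \<tau>") (simp_all, blast+)
  then show ?thesis unfolding suspension_def stellar_def simplex_boundary_def by simp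
qed

lemma suspension_stellar:
  assumes "v \<noteq> h" "v \<noteq> k" "h \<notin> \<sigma>" "k \<notin> \<sigma>"
  shows "suspension h k (stellar \<Delta> \<sigma> v) = stellar (suspension h k \<Delta>) \<sigma> v"
proof -
  have 1: "(\<tau> - {v} \<union> \<sigma>) - {h, k} = \<tau> - {h, k} - {v} \<union> \<sigma>" for \<tau> using assms by blast
  have 2: "\<sigma> \<subseteq> \<tau> - {h, k} \<longleftrightarrow> \<sigma> \<subseteq> \<tau>" for \<tau> using assms by blast
  show ?thesis unfolding suspension_def stellar_def mem_Collect_eq 1 2 using assms by (intro Collect_cong) auto
qed

lemma stellar_sphere_suspension:
  assumes "stellar_sphere U n \<Delta>" "h \<notin> U" "k \<notin> U" "h \<noteq> k"
  shows "stellar_sphere (insert h (insert k U)) (n + 1) (suspension h k \<Delta>)"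
  using assms(1)
proof (induction rule: stellar_sphere.induct)
  case (simplex_boundary W n)
  then have W: "W \<noteq> {}" "h \<notin> W" "k \<notin> W" using assms by auto
  have "stellar_sphere (insert h (insert k U)) (n + 1) (simplex_boundary (insert h W))"
    using simplex_boundary W by (intro stellar_sphere.simplex_boundary) auto
  then show ?case unfolding suspension_simplex_boundary[OF W assms(4)]
    by (rule stellar_sphere.stellar) (use W assms(4) in \<open>auto simp: simplex_boundary_def\<close>)
next
  case (stellar n \<Delta> \<sigma> v)
  have U: "\<Union>\<Delta> \<subseteq> U" using stellar_sphere_complex stellar.hyps(1) by blast
  have n: "v \<noteq> h" "v \<noteq> k" "h \<notin> \<sigma>" "k \<notin> \<sigma>" using stellar.hyps assms U by blast+
  show ?case unfolding suspension_stellar[OF n]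
  proof (rule stellar_sphere.stellar[OF stellar.IH _ stellar.hyps(3)])
    have "\<sigma> - {h, k} = \<sigma>" using n by blast
    then show "\<sigma> \<in> suspension h k \<Delta>" using stellar.hyps(2) n by (simp add: suspension_def)
    show "v \<in> insert h (insert k U)" using stellar.hyps(4) by simp
    show "v \<notin> \<Union>(suspension h k \<Delta>)" using stellar.hyps(5) n by (auto simp: suspension_def)
  qed
qed

text \<open>The set is the join of \<open>\<Delta>\<close> with the pentagon \<open>a c e b d\<close>, written in terms of its non-edges.
  Replacing the vertex \<open>a\<close> by an edge from \<open>c\<close> to \<open>d\<close> turns the pentagon into the join of the
  pairs \<open>b, c\<close> and \<open>d, e\<close>.\<close>
lemma sphere_join_pentagon:
  assumes s: "stellar_sphere U n \<Delta>" and d: "distinct [a, b, c, d, e]"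
    and U: "a \<notin> U" "b \<notin> U" "c \<notin> U" "d \<notin> U" "e \<notin> U"
  shows "stellar_sphere (U \<union> {a, b, c, d, e}) (n + 2)
    {\<tau>. \<tau> - {a, b, c, d, e} \<in> \<Delta> \<and> \<not> (a \<in> \<tau> \<and> b \<in> \<tau>) \<and> \<not> (b \<in> \<tau> \<and> c \<in> \<tau>) \<and>
      \<not> (c \<in> \<tau> \<and> d \<in> \<tau>) \<and> \<not> (d \<in> \<tau> \<and> e \<in> \<tau>) \<and> \<not> (e \<in> \<tau> \<and> a \<in> \<tau>)}"
proof -
  have AU: "\<Union>\<Delta> \<subseteq> U" and 0: "{} \<in> \<Delta>" using stellar_sphere_complex[OF s] by (auto simp: abstract_complex_def)
  let ?\<Gamma> = "suspension c b (suspension e d \<Delta>)"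
  have "stellar_sphere (insert e (insert d U)) (n + 1) (suspension e d \<Delta>)"
    using d U by (intro stellar_sphere_suspension[OF s]) auto
  then have "stellar_sphere (insert c (insert b (insert e (insert d U)))) (n + 1 + 1) ?\<Gamma>"
    by (rule stellar_sphere_suspension) (use d U in auto)
  then have "stellar_sphere (U \<union> {a, b, c, d, e}) (n + 1 + 1) ?\<Gamma>"
    by (rule stellar_sphere_mono) auto
  moreover have mem: "\<tau> \<in> ?\<Gamma> \<longleftrightarrow> \<tau> - {b, c, d, e} \<in> \<Delta> \<and> \<not> (b \<in> \<tau> \<and> c \<in> \<tau>) \<and> \<not> (d \<in> \<tau> \<and> e \<in> \<tau>)" for \<tau>
  proof -
    have "\<tau> - {c, b} - {e, d} = \<tau> - {b, c, d, e}" by blast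
    then show ?thesis using d by (auto simp: suspension_def)
  qed
  have a: "a \<notin> \<Union>?\<Gamma>" using AU U(1) d by (intro suspension_fresh) auto
  have cd: "{c, d} \<in> ?\<Gamma>" using 0 d unfolding mem by auto
  ultimately have "stellar_sphere (U \<union> {a, b, c, d, e}) (n + 1 + 1) (stellar ?\<Gamma> {c, d} a)"
    using a by (intro stellar_sphere.stellar) auto
  moreover have "\<tau> \<in> stellar ?\<Gamma> {c, d} a \<longleftrightarrow> \<tau> - {a, b, c, d, e} \<in> \<Delta> \<and>
      \<not> (a \<in> \<tau> \<and> b \<in> \<tau>) \<and> \<not> (b \<in> \<tau> \<and> c \<in> \<tau>) \<and>
      \<not> (c \<in> \<tau> \<and> d \<in> \<tau>) \<and> \<not> (d \<in> \<tau> \<and> e \<in> \<tau>) \<and> \<not> (e \<in> \<tau> \<and> a \<in> \<tau>)" for \<tau>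
  proof (cases "a \<in> \<tau>")
    case True
    have *: "(\<tau> - {a} \<union> {c, d}) - {b, c, d, e} = \<tau> - {a, b, c, d, e}" by blast
    have "\<tau> \<in> stellar ?\<Gamma> {c, d} a \<longleftrightarrow> \<tau> - {a} \<union> {c, d} \<in> ?\<Gamma> \<and> \<not> (c \<in> \<tau> \<and> d \<in> \<tau>)"
      using True by (simp add: stellar_def)
    also have "\<dots> \<longleftrightarrow> \<tau> - {a, b, c, d, e} \<in> \<Delta> \<and> b \<notin> \<tau> \<and> e \<notin> \<tau> \<and> \<not> (c \<in> \<tau> \<and> d \<in> \<tau>)"
      unfolding mem * using d by auto
    finally show ?thesis using True by blast
  next
    case False
    then have *: "\<tau> - {b, c, d, e} = \<tau> - {a, b, c, d, e}" by blast
    have "\<tau> \<in> stellar ?\<Gamma> {c, d} a \<longleftrightarrow> \<tau> \<in> ?\<Gamma> \<and> \<not> (c \<in> \<tau> \<and> d \<in> \<tau>)"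
      using False by (simp add: stellar_def)
    then show ?thesis unfolding mem * using False by blast
  qed
  ultimately show ?thesis
    using Collect_mem_eq[of "stellar ?\<Gamma> {c, d} a"] by (simp del: Collect_mem_eq)
qed

text \<open>The join of \<open>\<Delta>\<close> with the hexagon \<open>a b' c a' b c'\<close>, again in terms of non-edges.  Replacing \<open>a\<close> by an
  edge from \<open>b'\<close> to \<open>c'\<close> and \<open>a'\<close> by an edge from \<open>b\<close> to \<open>c\<close> leaves the join of the pairs
  \<open>b, b'\<close> and \<open>c, c'\<close>.\<close>
lemma sphere_join_hexagon:
  assumes s: "stellar_sphere U n \<Delta>" and d: "distinct [a, b, c, a', b', c']"
    and U: "a \<notin> U" "b \<notin> U" "c \<notin> U" "a' \<notin> U" "b' \<notin> U" "c' \<notin> U"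
  shows "stellar_sphere (U \<union> {a, b, c, a', b', c'}) (n + 2)
    {\<tau>. \<tau> - {a, b, c, a', b', c'} \<in> \<Delta> \<and> \<not> (a \<in> \<tau> \<and> b \<in> \<tau>) \<and> \<not> (b \<in> \<tau> \<and> c \<in> \<tau>) \<and> \<not> (a \<in> \<tau> \<and> c \<in> \<tau>) \<and>
      \<not> (a' \<in> \<tau> \<and> b' \<in> \<tau>) \<and> \<not> (b' \<in> \<tau> \<and> c' \<in> \<tau>) \<and> \<not> (a' \<in> \<tau> \<and> c' \<in> \<tau>) \<and>
      \<not> (a \<in> \<tau> \<and> a' \<in> \<tau>) \<and> \<not> (b \<in> \<tau> \<and> b' \<in> \<tau>) \<and> \<not> (c \<in> \<tau> \<and> c' \<in> \<tau>)}"
proof -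
  have AU: "\<Union>\<Delta> \<subseteq> U" and 0: "{} \<in> \<Delta>" using stellar_sphere_complex[OF s] by (auto simp: abstract_complex_def)
  let ?\<Gamma> = "suspension b b' (suspension c c' \<Delta>)"
  let ?V = "U \<union> {a, b, c, a', b', c'}"
  have "stellar_sphere (insert c (insert c' U)) (n + 1) (suspension c c' \<Delta>)"
    using d U by (intro stellar_sphere_suspension[OF s]) auto
  then have "stellar_sphere (insert b (insert b' (insert c (insert c' U)))) (n + 1 + 1) ?\<Gamma>"
    by (rule stellar_sphere_suspension) (use d U in auto)
  then have G: "stellar_sphere ?V (n + 1 + 1) ?\<Gamma>"
    by (rule stellar_sphere_mono) auto
  have mem: "\<tau> \<in> ?\<Gamma> \<longleftrightarrow> \<tau> - {b, b', c, c'} \<in> \<Delta> \<and> \<not> (b \<in> \<tau> \<and> b' \<in> \<tau>) \<and> \<not> (c \<in> \<tau> \<and> c' \<in> \<tau>)" for \<tau>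
  proof -
    have "\<tau> - {b, b'} - {c, c'} = \<tau> - {b, b', c, c'}" by blast
    then show ?thesis using d by (auto simp: suspension_def)
  qed
  have aG: "a' \<notin> \<Union>?\<Gamma>" using AU U d by (intro suspension_fresh) auto
  have "{b, c} \<in> ?\<Gamma>" using 0 d unfolding mem by auto
  then have G': "stellar_sphere ?V (n + 1 + 1) (stellar ?\<Gamma> {b, c} a')"
    using aG G by (intro stellar_sphere.stellar) auto
  have mem': "\<tau> \<in> stellar ?\<Gamma> {b, c} a' \<longleftrightarrow> \<tau> - {b, c, a', b', c'} \<in> \<Delta> \<and> \<not> (b \<in> \<tau> \<and> c \<in> \<tau>) \<and>
    \<not> (b \<in> \<tau> \<and> b' \<in> \<tau>) \<and> \<not> (c \<in> \<tau> \<and> c' \<in> \<tau>) \<and> \<not> (a' \<in> \<tau> \<and> b' \<in> \<tau>) \<and> \<not> (a' \<in> \<tau> \<and> c' \<in> \<tau>)" for \<tau>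
  proof (cases "a' \<in> \<tau>")
    case True
    have *: "(\<tau> - {a'} \<union> {b, c}) - {b, b', c, c'} = \<tau> - {b, c, a', b', c'}" by blast
    have "\<tau> \<in> stellar ?\<Gamma> {b, c} a' \<longleftrightarrow> \<tau> - {a'} \<union> {b, c} \<in> ?\<Gamma> \<and> \<not> (b \<in> \<tau> \<and> c \<in> \<tau>)"
      using True by (simp add: stellar_def)
    also have "\<dots> \<longleftrightarrow> \<tau> - {b, c, a', b', c'} \<in> \<Delta> \<and> b' \<notin> \<tau> \<and> c' \<notin> \<tau> \<and> \<not> (b \<in> \<tau> \<and> c \<in> \<tau>)"
      unfolding mem * using d by auto
    finally show ?thesis using True by blast
  next
    case False
    then have *: "\<tau> - {b, b', c, c'} = \<tau> - {b, c, a', b', c'}" by blast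
    have "\<tau> \<in> stellar ?\<Gamma> {b, c} a' \<longleftrightarrow> \<tau> \<in> ?\<Gamma> \<and> \<not> (b \<in> \<tau> \<and> c \<in> \<tau>)"
      using False by (simp add: stellar_def)
    then show ?thesis unfolding mem * using False by blast
  qed
  have aG': "a \<notin> \<Union>(stellar ?\<Gamma> {b, c} a')" using AU U d by (intro stellar_fresh suspension_fresh) auto
  have bc': "{b', c'} \<in> stellar ?\<Gamma> {b, c} a'" using 0 d unfolding mem' by auto
  have "stellar_sphere ?V (n + 1 + 1) (stellar (stellar ?\<Gamma> {b, c} a') {b', c'} a)"
    by (rule stellar_sphere.stellar[OF G' bc' _ _ aG']) auto
  moreover have "\<tau> \<in> stellar (stellar ?\<Gamma> {b, c} a') {b', c'} a \<longleftrightarrow>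
      \<tau> - {a, b, c, a', b', c'} \<in> \<Delta> \<and> \<not> (a \<in> \<tau> \<and> b \<in> \<tau>) \<and> \<not> (b \<in> \<tau> \<and> c \<in> \<tau>) \<and> \<not> (a \<in> \<tau> \<and> c \<in> \<tau>) \<and>
      \<not> (a' \<in> \<tau> \<and> b' \<in> \<tau>) \<and> \<not> (b' \<in> \<tau> \<and> c' \<in> \<tau>) \<and> \<not> (a' \<in> \<tau> \<and> c' \<in> \<tau>) \<and>
      \<not> (a \<in> \<tau> \<and> a' \<in> \<tau>) \<and> \<not> (b \<in> \<tau> \<and> b' \<in> \<tau>) \<and> \<not> (c \<in> \<tau> \<and> c' \<in> \<tau>)" (is "?L \<longleftrightarrow> ?R") for \<tau>
  proof (cases "a \<in> \<tau>")
    case True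
    have *: "(\<tau> - {a} \<union> {b', c'}) - {b, c, a', b', c'} = \<tau> - {a, b, c, a', b', c'}" by blast
    have "?L \<longleftrightarrow> \<tau> - {a} \<union> {b', c'} \<in> stellar ?\<Gamma> {b, c} a' \<and> \<not> (b' \<in> \<tau> \<and> c' \<in> \<tau>)"
      using True by (simp add: stellar_def[of "stellar ?\<Gamma> {b, c} a'"])
    also have "\<dots> \<longleftrightarrow> \<tau> - {a, b, c, a', b', c'} \<in> \<Delta> \<and> b \<notin> \<tau> \<and> c \<notin> \<tau> \<and> a' \<notin> \<tau> \<and> \<not> (b' \<in> \<tau> \<and> c' \<in> \<tau>)"
      unfolding mem' * using d by auto
    finally show ?thesis using True by blast
  next
    case False
    then have *: "\<tau> - {b, c, a', b', c'} = \<tau> - {a, b, c, a', b', c'}" by blast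
    have "?L \<longleftrightarrow> \<tau> \<in> stellar ?\<Gamma> {b, c} a' \<and> \<not> (b' \<in> \<tau> \<and> c' \<in> \<tau>)"
      using False by (simp add: stellar_def[of "stellar ?\<Gamma> {b, c} a'"])
    then show ?thesis unfolding mem' * using False by blast
  qed
  ultimately show ?thesis
    using Collect_mem_eq[of "stellar (stellar ?\<Gamma> {b, c} a') {b', c'} a"] by (simp del: Collect_mem_eq)
qed

lemma matchings_Un:
  assumes "\<Union>H \<inter> \<Union>R = {}"
  shows "\<tau> \<in> matchings (H \<union> R) \<longleftrightarrow> \<tau> - H \<in> matchings R \<and> pairwise disjnt (\<tau> \<inter> H)"
proof
  assume "\<tau> \<in> matchings (H \<union> R)"
  then show "\<tau> - H \<in> matchings R \<and> pairwise disjnt (\<tau> \<inter> H)"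
    by (auto simp: matchings_def intro: pairwise_subset)
next
  assume *: "\<tau> - H \<in> matchings R \<and> pairwise disjnt (\<tau> \<inter> H)"
  have cross: "disjnt f g" if "f \<in> H" "g \<in> \<tau> - H" for f g
  proof -
    have "g \<in> R" using * that by (auto simp: matchings_def)
    then show ?thesis using assms that unfolding disjnt_def by blast
  qed
  have "pairwise disjnt \<tau>"
  proof (rule pairwiseI)
    fix f g assume fg: "f \<in> \<tau>" "g \<in> \<tau>" "f \<noteq> g"
    have R: "pairwise disjnt (\<tau> - H)" and H: "pairwise disjnt (\<tau> \<inter> H)" using * by (auto simp: matchings_def)
    show "disjnt f g"
      using fg cross[of f g] cross[of g f] pairwiseD[OF R, of f g] pairwiseD[OF H, of f g]
      by (cases "f \<in> H"; cases "g \<in> H") (auto simp: disjnt_sym)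
  qed
  then show "\<tau> \<in> matchings (H \<union> R)" using * by (auto simp: matchings_def)
qed

lemma pairwise_Int_insert:
  "pairwise disjnt (\<tau> \<inter> insert f H) \<longleftrightarrow>
    pairwise disjnt (\<tau> \<inter> H) \<and> (f \<in> \<tau> \<longrightarrow> (\<forall>g\<in>H. g \<in> \<tau> \<longrightarrow> g \<noteq> f \<longrightarrow> disjnt f g))"
  by (cases "f \<in> \<tau>") (auto simp: pairwise_insert disjnt_sym)

lemma edge_notin_disjoint:
  assumes "\<Union>H \<inter> \<Union>R = {}" "{} \<notin> H \<union> R" "h \<in> H"
  shows "h \<notin> insert {} R"
proof
  assume h: "h \<in> insert {} R"
  have ne: "h \<noteq> {}" using assms(2,3) by auto
  then obtain x where "x \<in> h" by blast
  then have "x \<in> \<Union>H \<inter> \<Union>R" using h ne assms(3) by auto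
  then show False using assms(1) by simp
qed

text \<open>The induction starts from the complex whose only face is the empty one.  This is the boundary of a
  \<open>0\<close>-simplex, whose vertex must never occur as an edge; the empty set serves this purpose.\<close>
lemma standard_union_imp_stellar_sphere:
  fixes E :: "'a::finite set set"
  assumes "standard_union n E" "{} \<notin> E"
  shows "stellar_sphere (insert {} E) n (matchings E)"
  using assms
proof (induction rule: standard_union.induct)
  case standard_union_empty
  have "\<tau> \<subset> {w} \<longleftrightarrow> \<tau> = {}" for \<tau> and w :: "'a set" by blast
  then have "simplex_boundary {{} :: 'a set} = {{}}" by (simp add: simplex_boundary_def)
  moreover have "matchings {} = {{} :: 'a set set}" by (auto simp: matchings_def)
  ultimately have "matchings {} = simplex_boundary {{} :: 'a set}" by simp
  then show ?case by (simp add: stellar_sphere.simplex_boundary)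
next
  case (standard_union_P3 H n R)
  obtain x y z where H: "distinct [x, y, z]" "H = {{x, y}, {x, z}}"
    using standard_union_P3.hyps(1) unfolding is_P3_def by metis
  have s: "stellar_sphere (insert {} R) n (matchings R)" using standard_union_P3 by simp
  have "h \<notin> insert {} R" if "h \<in> H" for h
    by (rule edge_notin_disjoint[OF standard_union_P3.hyps(3) standard_union_P3.prems that])
  then have "stellar_sphere (insert {x, y} (insert {x, z} (insert {} R))) (n + 1) (suspension {x, y} {x, z} (matchings R))"
    using H by (intro stellar_sphere_suspension[OF s]) (auto simp: doubleton_eq_iff)
  moreover have "matchings (H \<union> R) = suspension {x, y} {x, z} (matchings R)"
    unfolding suspension_def set_eq_iff matchings_Un[OF standard_union_P3.hyps(3)] using H
    by (simp add: pairwise_Int_insert disjnt_def doubleton_eq_iff) blast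
  moreover have "insert {x, y} (insert {x, z} (insert {} R)) = insert {} (H \<union> R)" using H by auto
  ultimately show ?case by simp
next
  case (standard_union_C5 H n R)
  obtain a b c d k where H: "distinct [a, b, c, d, k]" "H = {{a, b}, {b, c}, {c, d}, {d, k}, {k, a}}"
    using standard_union_C5.hyps(1) unfolding is_C5_def by metis
  have s: "stellar_sphere (insert {} R) n (matchings R)" using standard_union_C5 by simp
  have "h \<notin> insert {} R" if "h \<in> H" for h
    by (rule edge_notin_disjoint[OF standard_union_C5.hyps(3) standard_union_C5.prems that])
  then have "stellar_sphere (insert {} R \<union> H) (n + 2) {\<tau>. \<tau> - H \<in> matchings R \<and>
      \<not> ({a, b} \<in> \<tau> \<and> {b, c} \<in> \<tau>) \<and> \<not> ({b, c} \<in> \<tau> \<and> {c, d} \<in> \<tau>) \<and> \<not> ({c, d} \<in> \<tau> \<and> {d, k} \<in> \<tau>) \<and>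
      \<not> ({d, k} \<in> \<tau> \<and> {k, a} \<in> \<tau>) \<and> \<not> ({k, a} \<in> \<tau> \<and> {a, b} \<in> \<tau>)}"
    unfolding H(2) using H(1) by (intro sphere_join_pentagon[OF s]) (auto simp: doubleton_eq_iff)
  moreover have "matchings (H \<union> R) = {\<tau>. \<tau> - H \<in> matchings R \<and>
      \<not> ({a, b} \<in> \<tau> \<and> {b, c} \<in> \<tau>) \<and> \<not> ({b, c} \<in> \<tau> \<and> {c, d} \<in> \<tau>) \<and> \<not> ({c, d} \<in> \<tau> \<and> {d, k} \<in> \<tau>) \<and>
      \<not> ({d, k} \<in> \<tau> \<and> {k, a} \<in> \<tau>) \<and> \<not> ({k, a} \<in> \<tau> \<and> {a, b} \<in> \<tau>)}"
  proof -
    have "pairwise disjnt (\<tau> \<inter> H) \<longleftrightarrow> 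
      \<not> ({a, b} \<in> \<tau> \<and> {b, c} \<in> \<tau>) \<and> \<not> ({b, c} \<in> \<tau> \<and> {c, d} \<in> \<tau>) \<and> \<not> ({c, d} \<in> \<tau> \<and> {d, k} \<in> \<tau>) \<and>
      \<not> ({d, k} \<in> \<tau> \<and> {k, a} \<in> \<tau>) \<and> \<not> ({k, a} \<in> \<tau> \<and> {a, b} \<in> \<tau>)" for \<tau>
      unfolding H(2) using H(1) by (simp add: pairwise_Int_insert disjnt_def doubleton_eq_iff) blast
    then show ?thesis unfolding set_eq_iff matchings_Un[OF standard_union_C5.hyps(3)] by simp
  qed
  moreover have "insert {} R \<union> H = insert {} (H \<union> R)" by blast
  ultimately show ?case by simp
next
  case (standard_union_K32 H n R)
  obtain a b c p q where H: "distinct [a, b, c, p, q]"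
    "H = {{a, p}, {b, p}, {c, p}, {a, q}, {b, q}, {c, q}}"
    using standard_union_K32.hyps(1) unfolding is_K32_def by metis
  have s: "stellar_sphere (insert {} R) n (matchings R)" using standard_union_K32 by simp
  have "h \<notin> insert {} R" if "h \<in> H" for h
    by (rule edge_notin_disjoint[OF standard_union_K32.hyps(3) standard_union_K32.prems that])
  then have "stellar_sphere (insert {} R \<union> H) (n + 2) {\<tau>. \<tau> - H \<in> matchings R \<and>
      \<not> ({a, p} \<in> \<tau> \<and> {b, p} \<in> \<tau>) \<and> \<not> ({b, p} \<in> \<tau> \<and> {c, p} \<in> \<tau>) \<and> \<not> ({a, p} \<in> \<tau> \<and> {c, p} \<in> \<tau>) \<and>
      \<not> ({a, q} \<in> \<tau> \<and> {b, q} \<in> \<tau>) \<and> \<not> ({b, q} \<in> \<tau> \<and> {c, q} \<in> \<tau>) \<and> \<not> ({a, q} \<in> \<tau> \<and> {c, q} \<in> \<tau>) \<and>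
      \<not> ({a, p} \<in> \<tau> \<and> {a, q} \<in> \<tau>) \<and> \<not> ({b, p} \<in> \<tau> \<and> {b, q} \<in> \<tau>) \<and> \<not> ({c, p} \<in> \<tau> \<and> {c, q} \<in> \<tau>)}"
    unfolding H(2) using H(1) by (intro sphere_join_hexagon[OF s]) (auto simp: doubleton_eq_iff)
  moreover have "matchings (H \<union> R) = {\<tau>. \<tau> - H \<in> matchings R \<and>
      \<not> ({a, p} \<in> \<tau> \<and> {b, p} \<in> \<tau>) \<and> \<not> ({b, p} \<in> \<tau> \<and> {c, p} \<in> \<tau>) \<and> \<not> ({a, p} \<in> \<tau> \<and> {c, p} \<in> \<tau>) \<and>
      \<not> ({a, q} \<in> \<tau> \<and> {b, q} \<in> \<tau>) \<and> \<not> ({b, q} \<in> \<tau> \<and> {c, q} \<in> \<tau>) \<and> \<not> ({a, q} \<in> \<tau> \<and> {c, q} \<in> \<tau>) \<and>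
      \<not> ({a, p} \<in> \<tau> \<and> {a, q} \<in> \<tau>) \<and> \<not> ({b, p} \<in> \<tau> \<and> {b, q} \<in> \<tau>) \<and> \<not> ({c, p} \<in> \<tau> \<and> {c, q} \<in> \<tau>)}"
  proof -
    have "pairwise disjnt (\<tau> \<inter> H) \<longleftrightarrow> 
      \<not> ({a, p} \<in> \<tau> \<and> {b, p} \<in> \<tau>) \<and> \<not> ({b, p} \<in> \<tau> \<and> {c, p} \<in> \<tau>) \<and> \<not> ({a, p} \<in> \<tau> \<and> {c, p} \<in> \<tau>) \<and>
      \<not> ({a, q} \<in> \<tau> \<and> {b, q} \<in> \<tau>) \<and> \<not> ({b, q} \<in> \<tau> \<and> {c, q} \<in> \<tau>) \<and> \<not> ({a, q} \<in> \<tau> \<and> {c, q} \<in> \<tau>) \<and>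
      \<not> ({a, p} \<in> \<tau> \<and> {a, q} \<in> \<tau>) \<and> \<not> ({b, p} \<in> \<tau> \<and> {b, q} \<in> \<tau>) \<and> \<not> ({c, p} \<in> \<tau> \<and> {c, q} \<in> \<tau>)" for \<tau>
      unfolding H(2) using H(1) by (simp add: pairwise_Int_insert disjnt_def doubleton_eq_iff) blast
    then show ?thesis unfolding set_eq_iff matchings_Un[OF standard_union_K32.hyps(3)] by simp
  qed
  moreover have "insert {} R \<union> H = insert {} (H \<union> R)" by blast
  ultimately show ?case by simp
qed

section \<open>The components of the graph\<close>

lemma path_graph_3_iso:
  assumes "is_P3 H"
  shows "graph_isomorphic (\<Union>H, H) (path_graph 3)"
proof -
  obtain x y z where d: "distinct [x, y, z]" and H: "H = {{x, y}, {x, z}}"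
    using assms unfolding is_P3_def by metis
  define f where "f = (\<lambda>v. if v = y then 0 else if v = x then 1 else (2 :: nat))"
  have V: "\<Union>H = {x, y, z}" unfolding H by auto
  have f: "f y = 0" "f x = 1" "f z = 2" using d by (auto simp: f_def)
  have "{..<3} = {0, 1, 2 :: nat}" by auto
  then have bij: "bij_betw f (\<Union>H) (graph_verts (path_graph 3))"
    unfolding path_graph_def V fst_conv bij_betw_def using d f by auto
  have "graph_edges (path_graph 3) = {{0, 1}, {1, 2}}"
  proof -
    have "Suc i < 3 \<longleftrightarrow> i = 0 \<or> i = 1" for i by auto
    then show ?thesis unfolding path_graph_def snd_conv by (auto simp: numeral_2_eq_2)
  qed
  then have "(\<lambda>e. f ` e) ` H = graph_edges (path_graph 3)"
    unfolding H using f by (simp add: insert_commute)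
  then show ?thesis unfolding graph_isomorphic_def using bij by auto
qed

lemma cycle_graph_5_iso:
  assumes "is_C5 H"
  shows "graph_isomorphic (\<Union>H, H) (cycle_graph 5)"
proof -
  obtain a b c d k where ds: "distinct [a, b, c, d, k]"
    and H: "H = {{a, b}, {b, c}, {c, d}, {d, k}, {k, a}}"
    using assms unfolding is_C5_def by metis
  define f where "f = (\<lambda>v. if v = a then 0 else if v = b then 1 else if v = c then 2
    else if v = d then 3 else (4 :: nat))"
  have V: "\<Union>H = {a, b, c, d, k}" unfolding H by auto
  have f: "f a = 0" "f b = 1" "f c = 2" "f d = 3" "f k = 4" using ds by (auto simp: f_def)
  have I: "{..<5} = {0, 1, 2, 3, 4 :: nat}" by auto
  then have bij: "bij_betw f (\<Union>H) (graph_verts (cycle_graph 5))"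
    unfolding cycle_graph_def V fst_conv bij_betw_def using ds f by auto
  have "graph_edges (cycle_graph 5) = (\<lambda>i. {i, Suc i mod 5}) ` {..<5}"
    unfolding cycle_graph_def by auto
  also have "\<dots> = {{0, 1}, {1, 2}, {2, 3}, {3, 4}, {4, 0}}" unfolding I by (simp add: numeral_2_eq_2)
  finally have "(\<lambda>e. f ` e) ` H = graph_edges (cycle_graph 5)"
    unfolding H using f by simp
  then show ?thesis unfolding graph_isomorphic_def using bij by auto
qed

lemma complete_bipartite_graph_3_2_iso:
  assumes "is_K32 H"
  shows "graph_isomorphic (\<Union>H, H) (complete_bipartite_graph 3 2)"
proof -
  obtain a b c p q where ds: "distinct [a, b, c, p, q]"
    and H: "H = {{a, p}, {b, p}, {c, p}, {a, q}, {b, q}, {c, q}}"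
    using assms unfolding is_K32_def by metis
  define f :: "'a \<Rightarrow> nat + nat" where "f = (\<lambda>v. if v = a then Inl 0 else if v = b then Inl 1
    else if v = c then Inl 2 else if v = p then Inr 0 else Inr 1)"
  have V: "\<Union>H = {a, b, c, p, q}" unfolding H by auto
  have f: "f a = Inl 0" "f b = Inl 1" "f c = Inl 2" "f p = Inr 0" "f q = Inr 1"
    using ds by (auto simp: f_def)
  have I: "{..<3} = {0, 1, 2 :: nat}" "{..<2} = {0, 1 :: nat}" by auto
  have "{..<3} <+> {..<2} = {Inl 0, Inl 1, Inl (2 :: nat), Inr 0, Inr (1 :: nat)} "
    unfolding I by auto
  then have bij: "bij_betw f (\<Union>H) (graph_verts (complete_bipartite_graph 3 2))"
    unfolding complete_bipartite_graph_def V fst_conv bij_betw_def using ds f by auto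
  have "graph_edges (complete_bipartite_graph 3 2) = (\<Union>i\<in>{..<3}. (\<lambda>j. {Inl i, Inr j}) ` {..<2})"
    unfolding complete_bipartite_graph_def by auto
  also have "\<dots> = {{Inl 0, Inr 0}, {Inl 1, Inr 0}, {Inl 2, Inr 0},
      {Inl 0, Inr 1}, {Inl 1, Inr 1}, {Inl 2, Inr 1}}"
    unfolding I by (simp add: insert_commute)
  finally have "(\<lambda>e. f ` e) ` H = graph_edges (complete_bipartite_graph 3 2)"
    unfolding H using f by simp
  then show ?thesis unfolding graph_isomorphic_def using bij by auto
qed

lemma standard_union_graph_decomposition:
  fixes G :: "'a::finite graph"
  assumes G: "finite_simple_graph G" "no_isolated_vertices G" and standard_union: "standard_union n (graph_edges G)"
  shows "\<exists>\<H>. disjoint_union_of_graphs G \<H> \<and>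
            (\<forall>H\<in>\<H>. finite_simple_graph H \<and>
               (graph_isomorphic H (path_graph 3) \<or>
                graph_isomorphic H (cycle_graph 5) \<or>
                graph_isomorphic H (complete_bipartite_graph 3 2)))"
proof -
  from standard_union_pieces[OF standard_union] obtain Hs where Hs: "\<Union>Hs = graph_edges G" "\<forall>H\<in>Hs. piece H"
    "pairwise (\<lambda>H K. \<Union>H \<inter> \<Union>K = {}) Hs" by (elim exE conjE)
  let ?\<H> = "(\<lambda>H. (\<Union>H, H)) ` Hs"
  have V: "graph_verts G = \<Union>(graph_edges G)"
    using G unfolding finite_simple_graph_def no_isolated_vertices_def by blast
  have "pairwise (\<lambda>H H'. disjnt (graph_verts H) (graph_verts H')) ?\<H>"
  proof (rule pairwiseI)
    fix A B assume "A \<in> ?\<H>" "B \<in> ?\<H>" "A \<noteq> B"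
    then obtain H K where "A = (\<Union>H, H)" "B = (\<Union>K, K)" "H \<in> Hs" "K \<in> Hs" "H \<noteq> K" by blast
    then show "disjnt (graph_verts A) (graph_verts B)"
      using pairwiseD[OF Hs(3), of H K] by (simp add: disjnt_def)
  qed
  moreover have "graph_verts G = (\<Union>H\<in>?\<H>. graph_verts H)" "graph_edges G = (\<Union>H\<in>?\<H>. graph_edges H)"
    unfolding V Hs(1)[symmetric] by auto
  ultimately have "disjoint_union_of_graphs G ?\<H>" unfolding disjoint_union_of_graphs_def by simp
  moreover have "finite_simple_graph (\<Union>H, H)" if "H \<in> Hs" for H
  proof -
    have "H \<subseteq> graph_edges G" using that Hs(1) by blast
    then have "\<forall>e\<in>H. card e = 2" using G(1) by (auto simp: finite_simple_graph_def)
    then show ?thesis by (auto simp: finite_simple_graph_def)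
  qed
  moreover have "graph_isomorphic (\<Union>H, H) (path_graph 3) \<or> graph_isomorphic (\<Union>H, H) (cycle_graph 5) \<or>
      graph_isomorphic (\<Union>H, H) (complete_bipartite_graph 3 2)" if "H \<in> Hs" for H
    using bspec[OF Hs(2) that] path_graph_3_iso cycle_graph_5_iso complete_bipartite_graph_3_2_iso
    unfolding piece_def by blast
  ultimately show ?thesis by (intro exI[of _ ?\<H>]) auto
qed

section \<open>The classification\<close>

theorem theorem4p3:
  fixes G :: "'a::finite graph" and d :: nat
  assumes "d \<ge> 3"
    and "finite_simple_graph G"
    and "no_isolated_vertices G"
    and "homology_manifold TYPE('k::field) d (matching_complex G)"
  shows "(\<exists>\<H>. disjoint_union_of_graphs G \<H> \<and>
            (\<forall>H\<in>\<H>. finite_simple_graph H \<and>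
               (graph_isomorphic H (path_graph 3) \<or>
                graph_isomorphic H (cycle_graph 5) \<or>
                graph_isomorphic H (complete_bipartite_graph 3 2)))) \<and>
         combinatorial_sphere d (matching_complex G)"
proof
  let ?E = "graph_edges G"
  have U: "two_uniform ?E"
    using assms(2) by (auto simp: two_uniform_def finite_simple_graph_def)
  have standard_union: "standard_union (Suc d) ?E"
    by (rule locally_spherical_imp_standard_union[OF U homology_manifold_locally_spherical[OF assms(1,2,4)]])
  show "\<exists>\<H>. disjoint_union_of_graphs G \<H> \<and>
            (\<forall>H\<in>\<H>. finite_simple_graph H \<and>
               (graph_isomorphic H (path_graph 3) \<or>
                graph_isomorphic H (cycle_graph 5) \<or>
                graph_isomorphic H (complete_bipartite_graph 3 2)))"
    by (rule standard_union_graph_decomposition[OF assms(2,3) standard_union])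
  have "{} \<notin> ?E" using U by (auto simp: two_uniform_def)
  then have sphere: "stellar_sphere (insert {} ?E) (Suc d) (matching_complex G)"
    unfolding matching_complex_eq by (rule standard_union_imp_stellar_sphere[OF standard_union])
  obtain W where "card W = Suc d + 1" "linearly_equivalent (matching_complex G) (simplex_boundary W)"
    using stellar_sphere_equivalent[OF sphere] by blast
  then show "combinatorial_sphere d (matching_complex G)"
    using stellar_sphere_complex[OF sphere] by (intro linearly_equivalent_imp_sphere) simp_all
qed

end
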